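(* Let $\mathcal H$ be an SSH structure on $\mathcal C=\mathcal H([1])$. Then $\mathcal H$ defines a symmetric monoidal structure on $\mathcal C$. Explicitly, the product $(F,G)\mapsto F\otimes G$ is the functor $\mathcal C\times\mathcal C\to\mathcal C$ obtained by applying $\mathcal H$ to the map $([1],[1])\to([1])$ given by two copies of the identity of $[1]$, lying over the active map $[2]_*\to[1]_*$.
   Context: **Conventions.** $\Bbbk$ is a field of characteristic $0$; $\mathbf{Vect}$ is the category of finite-dimensional $\Bbbk$-vector spaces; $[n]=\{1,\dots,n\}$. $\mathbf{FinSet}_*$ is the category of pointed finite sets; $[n]_*=\{1,\dots,n,*\}$. A map in $\mathbf{FinSet}_*$ is active if the preimage of the basepoint is the basepoint. **$\mathbf{2Vect}_{gr}$.** A 2-vector space is a semisimple $\Bbbk$-linear category equivalent to a finite sum of copies of $\mathbf{Vect}$. The bicategory $\mathbf{2Vect}_{gr}$ has as objects the sequences $(\mathcal C_n)_{n\ge 0}$ of 2-vector spaces (thought of as graded categories), as 1-morphisms finite sums of exact functors of bounded degree, as 2-morphisms natural transformations. Every 1-morphism has left and right adjoints. **$\mathbf{FinSet}^{\sqcup}\to\mathbf{FinSet}_*$.** Objects over $I$: collections $(S_i)_{i\in I}$ of finite sets with $S_{*}$ a point (omitted from notation). Morphisms over $\varphi:I\to J$: collections of maps $S_i\to T_{\varphi(i)}$, $i\in I$. **$\mathbf{2Vect}_{gr}^{\otimes}\to\mathbf{FinSet}_*$.** Objects over $I$: collections $(\mathcal C_i)_{i\in I}$ of objects of $\mathbf{2Vect}_{gr}$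 with $\mathcal C_*=0$. A 1-morphism $(\mathcal C_i)\to(\mathcal D_j)$ over $\varphi:I\to J$ is a collection of multi-exact bounded functors $f_j:\prod_{\varphi(i)=j}\mathcal C_i\to\mathcal D_j$ (finite sums of multi-exact functors of non-negative bounded degree; the empty product is $\mathbf{Vect}$, so for empty fibre $f_j$ is an object of $\mathcal D_j$). 2-morphisms are collections of natural transformations. **coCartesian arrows.** For $p:\mathcal E\to B$ a functor from a bicategory to a 1-category, $F:X\to Y$ over $f$ is coCartesian if for all $Z$ and $g:p(Y)\to p(Z)$, precomposition with $F$ is an equivalence from the category of arrows $Y\to Z$ over $g$ to the category of arrows $X\to Z$ over $g f$. **Beck–Chevalley (BC) condition.** For a square with top $g:A\to B$, left $f:A\to C$, right $h:B\to D$, bottom $i:C\to D$ and 2-morphism $\alpha:hg\Rightarrow if$: the left mate is $\alpha_L:i_Lh\to i_Lhgg_L\to i_Lifg_L\to fg_L$, where $g_L,i_L$ are left adjoints; the right mate is $\alpha_R:gf_R\to h_Rhgf_R\to h_Riff_R\to h_Ri$, where $f_R,h_R$ are right adjoints. The square satisfies the BC condition if its mates are invertible (the left mate is invertible iff the right mate is, when both exist). **SSH category.** A symmetric self-adjoint Hopf (SSH) category is a pseudofunctor $\mathcal H:\mathbf{FinSet}^\sqcup\to\mathbf{2Vect}_{gr}^\otimes$ over $\mathbf{FinSet}_*$ which (1) takes maps to degree-zero maps, (2) takes coCartesian arrows to coCartesian arrows, (3) takes Cartesian squares in the fibre over $[1]_*$ (i.e. in $\mathbf{FinSet}$) to squares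 satisfying the BC condition. One says $\mathcal H$ is an SSH structure on $\mathcal C=\mathcal H([1])$. *)

theory Defs
  imports Complex_Main "HOL-Library.FuncSet" "HOL-Library.Function_Algebras"
begin

section \<open>Categories\<close>

record ('o, 'a) cat =
  Obj :: "'o set"
  Arr :: "'a set"
  Dom :: "'a \<Rightarrow> 'o"
  Cod :: "'a \<Rightarrow> 'o"
  Idn :: "'o \<Rightarrow> 'a"
  Cmp :: "'a \<Rightarrow> 'a \<Rightarrow> 'a"

text \<open>Composition is in applicative order: \<open>Cmp C g f\<close> is \<open>g\<close> after \<open>f\<close>.\<close>

definition hom :: "('o, 'a, 'm) cat_scheme \<Rightarrow> 'o \<Rightarrow> 'o \<Rightarrow> 'a set" where
  "hom C X Y = {f \<in> Arr C. Dom C f = X \<and> Cod C f = Y}"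

locale category =
  fixes C :: "('o, 'a, 'm) cat_scheme"
  assumes dom_obj: "f \<in> Arr C \<Longrightarrow> Dom C f \<in> Obj C"
    and cod_obj: "f \<in> Arr C \<Longrightarrow> Cod C f \<in> Obj C"
    and idn_hom: "X \<in> Obj C \<Longrightarrow> Idn C X \<in> hom C X X"
    and cmp_hom: "f \<in> hom C X Y \<Longrightarrow> g \<in> hom C Y Z \<Longrightarrow> Cmp C g f \<in> hom C X Z"
    and cmp_assoc: "f \<in> hom C W X \<Longrightarrow> g \<in> hom C X Y \<Longrightarrow> h \<in> hom C Y Z \<Longrightarrow>
      Cmp C h (Cmp C g f) = Cmp C (Cmp C h g) f"
    and idn_left: "f \<in> hom C X Y \<Longrightarrow> Cmp C (Idn C Y) f = f"
    and idn_right: "f \<in> hom C X Y \<Longrightarrow> Cmp C f (Idn C X) = f"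

definition inverse_arrows :: "('o, 'a, 'm) cat_scheme \<Rightarrow> 'a \<Rightarrow> 'a \<Rightarrow> bool" where
  "inverse_arrows C f g \<longleftrightarrow> f \<in> Arr C \<and> g \<in> hom C (Cod C f) (Dom C f) \<and>
     Cmp C g f = Idn C (Dom C f) \<and> Cmp C f g = Idn C (Cod C f)"

definition iso_arr :: "('o, 'a, 'm) cat_scheme \<Rightarrow> 'a \<Rightarrow> bool" where
  "iso_arr C f \<longleftrightarrow> (\<exists>g. inverse_arrows C f g)"

definition inv_arr :: "('o, 'a, 'm) cat_scheme \<Rightarrow> 'a \<Rightarrow> 'a" where
  "inv_arr C f = (THE g. inverse_arrows C f g)"

definition mono_arr :: "('o, 'a, 'm) cat_scheme \<Rightarrow> 'a \<Rightarrow> bool" where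
  "mono_arr C m \<longleftrightarrow> m \<in> Arr C \<and>
     (\<forall>X. \<forall>f \<in> hom C X (Dom C m). \<forall>g \<in> hom C X (Dom C m). Cmp C m f = Cmp C m g \<longrightarrow> f = g)"

definition zero_object :: "('o, 'a, 'm) cat_scheme \<Rightarrow> 'o \<Rightarrow> bool" where
  "zero_object C Z \<longleftrightarrow> Z \<in> Obj C \<and>
     (\<forall>X \<in> Obj C. (\<exists>!f. f \<in> hom C X Z) \<and> (\<exists>!f. f \<in> hom C Z X))"

text \<open>The square with top \<open>g\<close>, left \<open>f\<close>, right \<open>h\<close> and bottom \<open>i\<close>.\<close>

definition pullback_square :: "('o, 'a, 'm) cat_scheme \<Rightarrow> 'a \<Rightarrow> 'a \<Rightarrow> 'a \<Rightarrow> 'a \<Rightarrow> bool" where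
  "pullback_square C g f h i \<longleftrightarrow>
     g \<in> Arr C \<and> f \<in> Arr C \<and> h \<in> Arr C \<and> i \<in> Arr C \<and>
     Dom C g = Dom C f \<and> Cod C g = Dom C h \<and> Cod C f = Dom C i \<and> Cod C h = Cod C i \<and>
     Cmp C h g = Cmp C i f \<and>
     (\<forall>X \<in> Obj C. \<forall>a \<in> hom C X (Dom C h). \<forall>b \<in> hom C X (Dom C i). Cmp C h a = Cmp C i b \<longrightarrow>
        (\<exists>!u. u \<in> hom C X (Dom C g) \<and> Cmp C g u = a \<and> Cmp C f u = b))"

subsection \<open>Functors and natural transformations\<close>

record ('o, 'a, 'p, 'b) fnctr =
  fo :: "'o \<Rightarrow> 'p"
  fa :: "'a \<Rightarrow> 'b"

definition is_functor ::
  "('o, 'a, 'm) cat_scheme \<Rightarrow> ('p, 'b, 'n) cat_scheme \<Rightarrow> ('o, 'a, 'p, 'b) fnctr \<Rightarrow> bool" where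
  "is_functor C D F \<longleftrightarrow>
     fo F \<in> Obj C \<rightarrow>\<^sub>E Obj D \<and> fa F \<in> Arr C \<rightarrow>\<^sub>E Arr D \<and>
     (\<forall>f \<in> Arr C. Dom D (fa F f) = fo F (Dom C f) \<and> Cod D (fa F f) = fo F (Cod C f)) \<and>
     (\<forall>X \<in> Obj C. fa F (Idn C X) = Idn D (fo F X)) \<and>
     (\<forall>f \<in> Arr C. \<forall>g \<in> Arr C. Cod C f = Dom C g \<longrightarrow>
        fa F (Cmp C g f) = Cmp D (fa F g) (fa F f))"

definition id_functor :: "('o, 'a, 'm) cat_scheme \<Rightarrow> ('o, 'a, 'o, 'a) fnctr" where
  "id_functor C = \<lparr>fo = (\<lambda>X \<in> Obj C. X), fa = (\<lambda>f \<in> Arr C. f)\<rparr>"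

definition cmp_functor ::
  "('o, 'a, 'm) cat_scheme \<Rightarrow> ('p, 'b, 'q, 'c) fnctr \<Rightarrow> ('o, 'a, 'p, 'b) fnctr \<Rightarrow>
   ('o, 'a, 'q, 'c) fnctr" where
  "cmp_functor C G F = \<lparr>fo = (\<lambda>X \<in> Obj C. fo G (fo F X)), fa = (\<lambda>f \<in> Arr C. fa G (fa F f))\<rparr>"

definition nat_trans ::
  "('o, 'a, 'm) cat_scheme \<Rightarrow> ('p, 'b, 'n) cat_scheme \<Rightarrow>
   ('o, 'a, 'p, 'b) fnctr \<Rightarrow> ('o, 'a, 'p, 'b) fnctr \<Rightarrow> ('o \<Rightarrow> 'b) \<Rightarrow> bool" where
  "nat_trans C D F G t \<longleftrightarrow>
     t \<in> (\<Pi>\<^sub>E X \<in> Obj C. hom D (fo F X) (fo G X)) \<and>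
     (\<forall>f \<in> Arr C. Cmp D (t (Cod C f)) (fa F f) = Cmp D (fa G f) (t (Dom C f)))"

definition nat_iso ::
  "('o, 'a, 'm) cat_scheme \<Rightarrow> ('p, 'b, 'n) cat_scheme \<Rightarrow>
   ('o, 'a, 'p, 'b) fnctr \<Rightarrow> ('o, 'a, 'p, 'b) fnctr \<Rightarrow> ('o \<Rightarrow> 'b) \<Rightarrow> bool" where
  "nat_iso C D F G t \<longleftrightarrow> nat_trans C D F G t \<and> (\<forall>X \<in> Obj C. iso_arr D (t X))"

definition is_equivalence ::
  "('o, 'a, 'm) cat_scheme \<Rightarrow> ('p, 'b, 'n) cat_scheme \<Rightarrow> ('o, 'a, 'p, 'b) fnctr \<Rightarrow> bool" where
  "is_equivalence C D F \<longleftrightarrow> is_functor C D F \<and>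
     (\<exists>G s t. is_functor D C G \<and>
        nat_iso C C (id_functor C) (cmp_functor C G F) s \<and>
        nat_iso D D (cmp_functor D F G) (id_functor D) t)"

subsection \<open>Symmetric monoidal structures\<close>

record ('o, 'a) monoidal_data =
  tenO :: "'o \<Rightarrow> 'o \<Rightarrow> 'o"
  tenA :: "'a \<Rightarrow> 'a \<Rightarrow> 'a"
  unit_ob :: "'o"
  assoc :: "'o \<Rightarrow> 'o \<Rightarrow> 'o \<Rightarrow> 'a"
  lunit :: "'o \<Rightarrow> 'a"
  runit :: "'o \<Rightarrow> 'a"
  braid :: "'o \<Rightarrow> 'o \<Rightarrow> 'a"

locale symmetric_monoidal = category C
  for C :: "('o, 'a, 'm) cat_scheme" +
  fixes M :: "('o, 'a) monoidal_data"
  assumes ten_obj: "X \<in> Obj C \<Longrightarrow> Y \<in> Obj C \<Longrightarrow> tenO M X Y \<in> Obj C"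
    and ten_hom: "f \<in> hom C X X' \<Longrightarrow> g \<in> hom C Y Y' \<Longrightarrow>
      tenA M f g \<in> hom C (tenO M X Y) (tenO M X' Y')"
    and ten_idn: "X \<in> Obj C \<Longrightarrow> Y \<in> Obj C \<Longrightarrow>
      tenA M (Idn C X) (Idn C Y) = Idn C (tenO M X Y)"
    and ten_cmp: "f \<in> hom C X X' \<Longrightarrow> f' \<in> hom C X' X'' \<Longrightarrow>
      g \<in> hom C Y Y' \<Longrightarrow> g' \<in> hom C Y' Y'' \<Longrightarrow>
      tenA M (Cmp C f' f) (Cmp C g' g) = Cmp C (tenA M f' g') (tenA M f g)"
    and unit_obj: "unit_ob M \<in> Obj C"
    and assoc_iso: "X \<in> Obj C \<Longrightarrow> Y \<in> Obj C \<Longrightarrow> Z \<in> Obj C \<Longrightarrow>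
      assoc M X Y Z \<in> hom C (tenO M (tenO M X Y) Z) (tenO M X (tenO M Y Z)) \<and>
      iso_arr C (assoc M X Y Z)"
    and assoc_nat: "f \<in> hom C X X' \<Longrightarrow> g \<in> hom C Y Y' \<Longrightarrow> h \<in> hom C Z Z' \<Longrightarrow>
      Cmp C (assoc M X' Y' Z') (tenA M (tenA M f g) h) =
      Cmp C (tenA M f (tenA M g h)) (assoc M X Y Z)"
    and lunit_iso: "X \<in> Obj C \<Longrightarrow>
      lunit M X \<in> hom C (tenO M (unit_ob M) X) X \<and> iso_arr C (lunit M X)"
    and lunit_nat: "f \<in> hom C X X' \<Longrightarrow>
      Cmp C (lunit M X') (tenA M (Idn C (unit_ob M)) f) = Cmp C f (lunit M X)"
    and runit_iso: "X \<in> Obj C \<Longrightarrow>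
      runit M X \<in> hom C (tenO M X (unit_ob M)) X \<and> iso_arr C (runit M X)"
    and runit_nat: "f \<in> hom C X X' \<Longrightarrow>
      Cmp C (runit M X') (tenA M f (Idn C (unit_ob M))) = Cmp C f (runit M X)"
    and braid_iso: "X \<in> Obj C \<Longrightarrow> Y \<in> Obj C \<Longrightarrow>
      braid M X Y \<in> hom C (tenO M X Y) (tenO M Y X) \<and> iso_arr C (braid M X Y)"
    and braid_nat: "f \<in> hom C X X' \<Longrightarrow> g \<in> hom C Y Y' \<Longrightarrow>
      Cmp C (braid M X' Y') (tenA M f g) = Cmp C (tenA M g f) (braid M X Y)"
    and pentagon: "W \<in> Obj C \<Longrightarrow> X \<in> Obj C \<Longrightarrow> Y \<in> Obj C \<Longrightarrow> Z \<in> Obj C \<Longrightarrow>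
      Cmp C (tenA M (Idn C W) (assoc M X Y Z))
        (Cmp C (assoc M W (tenO M X Y) Z) (tenA M (assoc M W X Y) (Idn C Z))) =
      Cmp C (assoc M W X (tenO M Y Z)) (assoc M (tenO M W X) Y Z)"
    and triangle: "X \<in> Obj C \<Longrightarrow> Y \<in> Obj C \<Longrightarrow>
      Cmp C (tenA M (Idn C X) (lunit M Y)) (assoc M X (unit_ob M) Y) =
      tenA M (runit M X) (Idn C Y)"
    and hexagon: "X \<in> Obj C \<Longrightarrow> Y \<in> Obj C \<Longrightarrow> Z \<in> Obj C \<Longrightarrow>
      Cmp C (assoc M Y Z X) (Cmp C (braid M X (tenO M Y Z)) (assoc M X Y Z)) =
      Cmp C (tenA M (Idn C Y) (braid M X Z))
        (Cmp C (assoc M Y X Z) (tenA M (braid M X Y) (Idn C Z)))"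
    and symmetry: "X \<in> Obj C \<Longrightarrow> Y \<in> Obj C \<Longrightarrow>
      Cmp C (braid M Y X) (braid M X Y) = Idn C (tenO M X Y)"

section \<open>Linear categories and 2-vector spaces\<close>

record ('o, 'a, 'k) lincat = "('o, 'a) cat" +
  Zero :: "'o \<Rightarrow> 'o \<Rightarrow> 'a"
  Add :: "'a \<Rightarrow> 'a \<Rightarrow> 'a"
  Scl :: "'k \<Rightarrow> 'a \<Rightarrow> 'a"

locale linear_category = category C
  for C :: "('o, 'a, 'k :: field) lincat" +
  assumes zero_hom: "X \<in> Obj C \<Longrightarrow> Y \<in> Obj C \<Longrightarrow> Zero C X Y \<in> hom C X Y"
    and add_hom: "f \<in> hom C X Y \<Longrightarrow> g \<in> hom C X Y \<Longrightarrow> Add C f g \<in> hom C X Y"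
    and scl_hom: "f \<in> hom C X Y \<Longrightarrow> Scl C c f \<in> hom C X Y"
    and add_assoc: "f \<in> hom C X Y \<Longrightarrow> g \<in> hom C X Y \<Longrightarrow> h \<in> hom C X Y \<Longrightarrow>
      Add C (Add C f g) h = Add C f (Add C g h)"
    and add_commute: "f \<in> hom C X Y \<Longrightarrow> g \<in> hom C X Y \<Longrightarrow> Add C f g = Add C g f"
    and add_zero: "f \<in> hom C X Y \<Longrightarrow> Add C f (Zero C X Y) = f"
    and add_inverse: "f \<in> hom C X Y \<Longrightarrow> Add C f (Scl C (- 1) f) = Zero C X Y"
    and scl_add: "f \<in> hom C X Y \<Longrightarrow> g \<in> hom C X Y \<Longrightarrow>
      Scl C c (Add C f g) = Add C (Scl C c f) (Scl C c g)"
    and add_scl: "f \<in> hom C X Y \<Longrightarrow> Scl C (c + d) f = Add C (Scl C c f) (Scl C d f)"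
    and scl_scl: "f \<in> hom C X Y \<Longrightarrow> Scl C c (Scl C d f) = Scl C (c * d) f"
    and scl_one: "f \<in> hom C X Y \<Longrightarrow> Scl C 1 f = f"
    and cmp_add_left: "f \<in> hom C X Y \<Longrightarrow> g \<in> hom C Y Z \<Longrightarrow> g' \<in> hom C Y Z \<Longrightarrow>
      Cmp C (Add C g g') f = Add C (Cmp C g f) (Cmp C g' f)"
    and cmp_add_right: "f \<in> hom C X Y \<Longrightarrow> f' \<in> hom C X Y \<Longrightarrow> g \<in> hom C Y Z \<Longrightarrow>
      Cmp C g (Add C f f') = Add C (Cmp C g f) (Cmp C g f')"
    and cmp_scl_left: "f \<in> hom C X Y \<Longrightarrow> g \<in> hom C Y Z \<Longrightarrow>
      Cmp C (Scl C c g) f = Scl C c (Cmp C g f)"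
    and cmp_scl_right: "f \<in> hom C X Y \<Longrightarrow> g \<in> hom C Y Z \<Longrightarrow>
      Cmp C g (Scl C c f) = Scl C c (Cmp C g f)"

primrec sum_arr :: "('o, 'a, 'k) lincat \<Rightarrow> 'o \<Rightarrow> 'o \<Rightarrow> nat \<Rightarrow> (nat \<Rightarrow> 'a) \<Rightarrow> 'a" where
  "sum_arr C X Y 0 f = Zero C X Y"
| "sum_arr C X Y (Suc r) f = Add C (sum_arr C X Y r f) (f r)"

text \<open>\<open>X\<close> is the direct sum of \<open>S 0, \<dots>, S (r - 1)\<close>.\<close>

definition direct_sum ::
  "('o, 'a, 'k) lincat \<Rightarrow> nat \<Rightarrow> (nat \<Rightarrow> 'o) \<Rightarrow> 'o \<Rightarrow> (nat \<Rightarrow> 'a) \<Rightarrow> (nat \<Rightarrow> 'a) \<Rightarrow> bool" where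
  "direct_sum C r S X inc prj \<longleftrightarrow> X \<in> Obj C \<and>
     (\<forall>k<r. S k \<in> Obj C \<and> inc k \<in> hom C (S k) X \<and> prj k \<in> hom C X (S k)) \<and>
     (\<forall>k<r. \<forall>l<r. Cmp C (prj k) (inc l) = (if k = l then Idn C (S k) else Zero C (S l) (S k))) \<and>
     sum_arr C X X r (\<lambda>k. Cmp C (inc k) (prj k)) = Idn C X"

definition simple_object :: "('o, 'a, 'k) lincat \<Rightarrow> 'o \<Rightarrow> bool" where
  "simple_object C S \<longleftrightarrow> S \<in> Obj C \<and> \<not> zero_object C S \<and>
     (\<forall>m. mono_arr C m \<and> Cod C m = S \<longrightarrow> zero_object C (Dom C m) \<or> iso_arr C m)"

definition semisimple :: "('o, 'a, 'k) lincat \<Rightarrow> bool" where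
  "semisimple C \<longleftrightarrow>
     (\<forall>X \<in> Obj C. \<exists>r S inc prj. (\<forall>k<r. simple_object C (S k)) \<and> direct_sum C r S X inc prj)"

definition is_kernel :: "('o, 'a, 'k) lincat \<Rightarrow> 'a \<Rightarrow> 'a \<Rightarrow> bool" where
  "is_kernel C g f \<longleftrightarrow> f \<in> Arr C \<and> g \<in> Arr C \<and> Cod C f = Dom C g \<and>
     Cmp C g f = Zero C (Dom C f) (Cod C g) \<and>
     (\<forall>h \<in> Arr C. Cod C h = Dom C g \<and> Cmp C g h = Zero C (Dom C h) (Cod C g) \<longrightarrow>
        (\<exists>!u. u \<in> hom C (Dom C h) (Dom C f) \<and> Cmp C f u = h))"

definition is_cokernel :: "('o, 'a, 'k) lincat \<Rightarrow> 'a \<Rightarrow> 'a \<Rightarrow> bool" where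
  "is_cokernel C f g \<longleftrightarrow> f \<in> Arr C \<and> g \<in> Arr C \<and> Cod C f = Dom C g \<and>
     Cmp C g f = Zero C (Dom C f) (Cod C g) \<and>
     (\<forall>h \<in> Arr C. Dom C h = Cod C f \<and> Cmp C h f = Zero C (Dom C f) (Cod C h) \<longrightarrow>
        (\<exists>!u. u \<in> hom C (Cod C g) (Cod C h) \<and> Cmp C u g = h))"

definition short_exact :: "('o, 'a, 'k) lincat \<Rightarrow> 'a \<Rightarrow> 'a \<Rightarrow> bool" where
  "short_exact C f g \<longleftrightarrow> is_kernel C g f \<and> is_cokernel C f g"

definition linear_functor ::
  "('o, 'a, 'k) lincat \<Rightarrow> ('p, 'b, 'k) lincat \<Rightarrow> ('o, 'a, 'p, 'b) fnctr \<Rightarrow> bool" where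
  "linear_functor C D F \<longleftrightarrow> is_functor C D F \<and>
     (\<forall>X Y. \<forall>f \<in> hom C X Y. \<forall>g \<in> hom C X Y. fa F (Add C f g) = Add D (fa F f) (fa F g)) \<and>
     (\<forall>f \<in> Arr C. \<forall>c. fa F (Scl C c f) = Scl D c (fa F f))"

text \<open>
  \<open>Vect\<close> has as objects the finite-dimensional subspaces of the space of all sequences of scalars,
  so it contains every finite-dimensional vector space up to isomorphism.
\<close>

definition seq_scale :: "'k :: field \<Rightarrow> (nat \<Rightarrow> 'k) \<Rightarrow> nat \<Rightarrow> 'k" where
  "seq_scale c v = (\<lambda>n. c * v n)"

definition linear_maps :: "(nat \<Rightarrow> 'k :: field) set \<Rightarrow> (nat \<Rightarrow> 'k) set \<Rightarrow> ((nat \<Rightarrow> 'k) \<Rightarrow> nat \<Rightarrow> 'k) set" where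
  "linear_maps V W = {f \<in> V \<rightarrow>\<^sub>E W. (\<forall>x \<in> V. \<forall>y \<in> V. f (x + y) = f x + f y) \<and>
     (\<forall>c. \<forall>x \<in> V. f (seq_scale c x) = seq_scale c (f x))}"

definition Vect ::
  "((nat \<Rightarrow> 'k) set, (nat \<Rightarrow> 'k) set \<times> ((nat \<Rightarrow> 'k) \<Rightarrow> nat \<Rightarrow> 'k) \<times> (nat \<Rightarrow> 'k) set, 'k :: field) lincat"
  where
  "Vect = (let Ob = {module.span seq_scale B |B. finite B} in
     \<lparr>Obj = Ob,
      Arr = {(V, f, W). V \<in> Ob \<and> W \<in> Ob \<and> f \<in> linear_maps V W},
      Dom = (\<lambda>(V, f, W). V),
      Cod = (\<lambda>(V, f, W). W),
      Idn = (\<lambda>V. (V, (\<lambda>x \<in> V. x), V)),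
      Cmp = (\<lambda>(V', g, W') (V, f, W). (V, (\<lambda>x \<in> V. g (f x)), W')),
      Zero = (\<lambda>V W. (V, (\<lambda>x \<in> V. 0), W)),
      Add = (\<lambda>(V, f, W) (V', g, W'). (V, (\<lambda>x \<in> V. f x + g x), W)),
      Scl = (\<lambda>c (V, f, W). (V, (\<lambda>x \<in> V. seq_scale c (f x)), W))\<rparr>)"

text \<open>
  The product of finitely many linear categories. It serves both as the finite direct sum of linear
  categories and as the domain of multifunctors; for \<open>A = {}\<close> it has a single object and arrow.
\<close>

definition Prod :: "nat set \<Rightarrow> (nat \<Rightarrow> ('o, 'a, 'k) lincat) \<Rightarrow> (nat \<Rightarrow> 'o, nat \<Rightarrow> 'a, 'k) lincat" where
  "Prod A C =
     \<lparr>Obj = (\<Pi>\<^sub>E i \<in> A. Obj (C i)),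
      Arr = (\<Pi>\<^sub>E i \<in> A. Arr (C i)),
      Dom = (\<lambda>f. \<lambda>i \<in> A. Dom (C i) (f i)),
      Cod = (\<lambda>f. \<lambda>i \<in> A. Cod (C i) (f i)),
      Idn = (\<lambda>X. \<lambda>i \<in> A. Idn (C i) (X i)),
      Cmp = (\<lambda>g f. \<lambda>i \<in> A. Cmp (C i) (g i) (f i)),
      Zero = (\<lambda>X Y. \<lambda>i \<in> A. Zero (C i) (X i) (Y i)),
      Add = (\<lambda>f g. \<lambda>i \<in> A. Add (C i) (f i) (g i)),
      Scl = (\<lambda>c f. \<lambda>i \<in> A. Scl (C i) c (f i))\<rparr>"

definition two_vector_space :: "('o, 'a, 'k :: field) lincat \<Rightarrow> bool" where
  "two_vector_space C \<longleftrightarrow> linear_category C \<and> semisimple C \<and>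
     (\<exists>n F. linear_functor C (Prod {..<n} (\<lambda>_. Vect)) F \<and>
            is_equivalence C (Prod {..<n} (\<lambda>_. Vect)) F)"

section \<open>Graded 2-vector spaces and multi-exact functors\<close>

type_synonym ('o, 'a, 'k) grcat = "nat \<Rightarrow> ('o, 'a, 'k) lincat"

definition graded_two_vector_space :: "('o, 'a, 'k :: field) grcat \<Rightarrow> bool" where
  "graded_two_vector_space C \<longleftrightarrow> (\<forall>n. two_vector_space (C n))"

text \<open>
  The graded category attached to a sequence of 2-vector spaces: the direct sum of its terms, whose
  objects are the sequences of objects almost all of which are zero. A functor between graded
  categories is a functor between these direct sums; it is of degree \<open>d\<close> if it sends the \<open>n\<close>-th
  summand to the \<open>(n + d)\<close>-th one.
\<close>

definition tot :: "('o, 'a, 'k) grcat \<Rightarrow> (nat \<Rightarrow> 'o, nat \<Rightarrow> 'a, 'k) lincat" where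
  "tot C = (let Ob = {X. (\<forall>n. X n \<in> Obj (C n)) \<and> finite {n. \<not> zero_object (C n) (X n)}} in
     \<lparr>Obj = Ob,
      Arr = {f. (\<forall>n. f n \<in> Arr (C n)) \<and>
                (\<lambda>n. Dom (C n) (f n)) \<in> Ob \<and> (\<lambda>n. Cod (C n) (f n)) \<in> Ob},
      Dom = (\<lambda>f n. Dom (C n) (f n)),
      Cod = (\<lambda>f n. Cod (C n) (f n)),
      Idn = (\<lambda>X n. Idn (C n) (X n)),
      Cmp = (\<lambda>g f n. Cmp (C n) (g n) (f n)),
      Zero = (\<lambda>X Y n. Zero (C n) (X n) (Y n)),
      Add = (\<lambda>f g n. Add (C n) (f n) (g n)),
      Scl = (\<lambda>c f n. Scl (C n) c (f n))\<rparr>)"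

text \<open>The degree ranges over the integers; in a negative degree only zero objects are homogeneous.\<close>

definition homogeneous :: "('o, 'a, 'k) grcat \<Rightarrow> int \<Rightarrow> (nat \<Rightarrow> 'o) \<Rightarrow> bool" where
  "homogeneous C d X \<longleftrightarrow> X \<in> Obj (tot C) \<and> (\<forall>n. int n \<noteq> d \<longrightarrow> zero_object (C n) (X n))"

type_synonym ('o, 'a) multifunctor =
  "(nat \<Rightarrow> nat \<Rightarrow> 'o, nat \<Rightarrow> nat \<Rightarrow> 'a, nat \<Rightarrow> 'o, nat \<Rightarrow> 'a) fnctr"

definition multi_exact ::
  "nat set \<Rightarrow> (nat \<Rightarrow> ('o, 'a, 'k) lincat) \<Rightarrow> ('p, 'b, 'k) lincat \<Rightarrow>
   (nat \<Rightarrow> 'o, nat \<Rightarrow> 'a, 'p, 'b) fnctr \<Rightarrow> bool" where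
  "multi_exact A C D F \<longleftrightarrow> is_functor (Prod A C) D F \<and>
     (\<forall>i \<in> A. \<forall>u \<in> Arr (Prod A C).
        (\<forall>v \<in> hom (C i) (Dom (C i) (u i)) (Cod (C i) (u i)).
           fa F (u(i := Add (C i) (u i) v)) = Add D (fa F u) (fa F (u(i := v)))) \<and>
        (\<forall>c. fa F (u(i := Scl (C i) c (u i))) = Scl D c (fa F u))) \<and>
     (\<forall>i \<in> A. \<forall>X \<in> Obj (Prod A C). \<forall>f g. short_exact (C i) f g \<longrightarrow>
        short_exact D (fa F ((Idn (Prod A C) X)(i := f))) (fa F ((Idn (Prod A C) X)(i := g))))"

definition of_degree ::
  "int \<Rightarrow> nat set \<Rightarrow> (nat \<Rightarrow> ('o, 'a, 'k) grcat) \<Rightarrow> ('o, 'a, 'k) grcat \<Rightarrow>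
   ('o, 'a) multifunctor \<Rightarrow> bool" where
  "of_degree d A C D F \<longleftrightarrow>
     (\<forall>X \<in> Obj (Prod A (\<lambda>i. tot (C i))). \<forall>n :: nat \<Rightarrow> nat.
        (\<forall>i \<in> A. homogeneous (C i) (int (n i)) (X i)) \<longrightarrow>
        homogeneous D (int (\<Sum>i \<in> A. n i) + d) (fo F X))"

text \<open>Finite direct sums of multi-exact functors whose degrees lie in \<open>L\<close>.\<close>

definition bounded_multi_exact ::
  "int set \<Rightarrow> nat set \<Rightarrow> (nat \<Rightarrow> ('o, 'a, 'k) grcat) \<Rightarrow> ('o, 'a, 'k) grcat \<Rightarrow>
   ('o, 'a) multifunctor \<Rightarrow> bool" where
  "bounded_multi_exact L A C D F \<longleftrightarrow>
     (let P = Prod A (\<lambda>i. tot (C i)) in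
      multi_exact A (\<lambda>i. tot (C i)) (tot D) F \<and>
      (\<exists>r d G inc prj.
         (\<forall>k<r. d k \<in> L \<and> multi_exact A (\<lambda>i. tot (C i)) (tot D) (G k) \<and>
                of_degree (d k) A C D (G k) \<and>
                nat_trans P (tot D) (G k) F (inc k) \<and> nat_trans P (tot D) F (G k) (prj k)) \<and>
         (\<forall>X \<in> Obj P. direct_sum (tot D) r (\<lambda>k. fo (G k) X) (fo F X)
                         (\<lambda>k. inc k X) (\<lambda>k. prj k X))))"

section \<open>Bicategories\<close>

text \<open>
  All bicategories occurring here are strict. Horizontal composition \<open>hcmp B s t\<close> is defined for
  \<open>t\<close> between arrows \<open>x \<rightarrow> y\<close> and \<open>s\<close> between arrows \<open>y \<rightarrow> z\<close>.
\<close>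

record ('x, 'f, 't) bicat =
  Ob0 :: "'x set"
  Ar1 :: "'f set"
  dom1 :: "'f \<Rightarrow> 'x"
  cod1 :: "'f \<Rightarrow> 'x"
  id1 :: "'x \<Rightarrow> 'f"
  cmp1 :: "'f \<Rightarrow> 'f \<Rightarrow> 'f"
  Ar2 :: "'t set"
  dom2 :: "'t \<Rightarrow> 'f"
  cod2 :: "'t \<Rightarrow> 'f"
  id2 :: "'f \<Rightarrow> 't"
  vcmp :: "'t \<Rightarrow> 't \<Rightarrow> 't"
  hcmp :: "'t \<Rightarrow> 't \<Rightarrow> 't"

definition hom1 :: "('x, 'f, 't) bicat \<Rightarrow> 'x \<Rightarrow> 'x \<Rightarrow> 'f set" where
  "hom1 B x y = {f \<in> Ar1 B. dom1 B f = x \<and> cod1 B f = y}"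

definition hom2 :: "('x, 'f, 't) bicat \<Rightarrow> 'f \<Rightarrow> 'f \<Rightarrow> 't set" where
  "hom2 B f g = {t \<in> Ar2 B. dom2 B t = f \<and> cod2 B t = g}"

abbreviation lwhisk :: "('x, 'f, 't) bicat \<Rightarrow> 'f \<Rightarrow> 't \<Rightarrow> 't" where
  "lwhisk B f t \<equiv> hcmp B (id2 B f) t"

abbreviation rwhisk :: "('x, 'f, 't) bicat \<Rightarrow> 't \<Rightarrow> 'f \<Rightarrow> 't" where
  "rwhisk B t f \<equiv> hcmp B t (id2 B f)"

definition inverse2 :: "('x, 'f, 't) bicat \<Rightarrow> 't \<Rightarrow> 't \<Rightarrow> bool" where
  "inverse2 B t s \<longleftrightarrow> t \<in> Ar2 B \<and> s \<in> hom2 B (cod2 B t) (dom2 B t) \<and>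
     vcmp B s t = id2 B (dom2 B t) \<and> vcmp B t s = id2 B (cod2 B t)"

definition invertible2 :: "('x, 'f, 't) bicat \<Rightarrow> 't \<Rightarrow> bool" where
  "invertible2 B t \<longleftrightarrow> (\<exists>s. inverse2 B t s)"

definition inv2 :: "('x, 'f, 't) bicat \<Rightarrow> 't \<Rightarrow> 't" where
  "inv2 B t = (THE s. inverse2 B t s)"

definition equivalence1 :: "('x, 'f, 't) bicat \<Rightarrow> 'f \<Rightarrow> bool" where
  "equivalence1 B f \<longleftrightarrow> f \<in> Ar1 B \<and>
     (\<exists>g \<in> hom1 B (cod1 B f) (dom1 B f).
        (\<exists>s \<in> hom2 B (id1 B (dom1 B f)) (cmp1 B g f). invertible2 B s) \<and>
        (\<exists>t \<in> hom2 B (cmp1 B f g) (id1 B (cod1 B f)). invertible2 B t))"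

text \<open>A 1-category, viewed as a bicategory with only identity 2-morphisms.\<close>

definition discrete_bicat :: "('o, 'a, 'm) cat_scheme \<Rightarrow> ('o, 'a, 'a) bicat" where
  "discrete_bicat C =
     \<lparr>Ob0 = Obj C, Ar1 = Arr C, dom1 = Dom C, cod1 = Cod C, id1 = Idn C, cmp1 = Cmp C,
      Ar2 = Arr C, dom2 = (\<lambda>f. f), cod2 = (\<lambda>f. f), id2 = (\<lambda>f. f),
      vcmp = (\<lambda>g f. f), hcmp = Cmp C\<rparr>"

subsection \<open>Mates and the Beck--Chevalley condition\<close>

text \<open>\<open>l\<close> is left adjoint to \<open>r\<close> with unit \<open>un\<close> and counit \<open>co\<close>.\<close>

definition adjunction :: "('x, 'f, 't) bicat \<Rightarrow> 'f \<Rightarrow> 'f \<Rightarrow> 't \<Rightarrow> 't \<Rightarrow> bool" where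
  "adjunction B l r un co \<longleftrightarrow>
     l \<in> Ar1 B \<and> r \<in> hom1 B (cod1 B l) (dom1 B l) \<and>
     un \<in> hom2 B (id1 B (dom1 B l)) (cmp1 B r l) \<and>
     co \<in> hom2 B (cmp1 B l r) (id1 B (cod1 B l)) \<and>
     vcmp B (rwhisk B co l) (lwhisk B l un) = id2 B l \<and>
     vcmp B (lwhisk B r co) (rwhisk B un r) = id2 B r"

text \<open>
  A square with top \<open>g\<close>, left \<open>f\<close>, right \<open>h\<close>, bottom \<open>i\<close> and 2-morphism \<open>al\<close> from \<open>hg\<close> to \<open>if\<close>.
\<close>

definition bc_square :: "('x, 'f, 't) bicat \<Rightarrow> 'f \<Rightarrow> 'f \<Rightarrow> 'f \<Rightarrow> 'f \<Rightarrow> 't \<Rightarrow> bool" where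
  "bc_square B g f h i al \<longleftrightarrow>
     g \<in> Ar1 B \<and> f \<in> Ar1 B \<and> h \<in> Ar1 B \<and> i \<in> Ar1 B \<and>
     dom1 B g = dom1 B f \<and> cod1 B g = dom1 B h \<and> cod1 B f = dom1 B i \<and> cod1 B h = cod1 B i \<and>
     al \<in> hom2 B (cmp1 B h g) (cmp1 B i f)"

definition left_mate ::
  "('x, 'f, 't) bicat \<Rightarrow> 'f \<Rightarrow> 'f \<Rightarrow> 't \<Rightarrow> 'f \<Rightarrow> 't \<Rightarrow> 'f \<Rightarrow> 't \<Rightarrow> 't" where
  "left_mate B f h al gL ung iL coi =
     vcmp B (rwhisk B coi (cmp1 B f gL))
       (vcmp B (lwhisk B iL (rwhisk B al gL)) (lwhisk B (cmp1 B iL h) ung))"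

definition right_mate ::
  "('x, 'f, 't) bicat \<Rightarrow> 'f \<Rightarrow> 'f \<Rightarrow> 't \<Rightarrow> 'f \<Rightarrow> 't \<Rightarrow> 'f \<Rightarrow> 't \<Rightarrow> 't" where
  "right_mate B g i al fR cof hR unh =
     vcmp B (lwhisk B (cmp1 B hR i) cof)
       (vcmp B (lwhisk B hR (rwhisk B al fR)) (rwhisk B unh (cmp1 B g fR)))"

definition beck_chevalley :: "('x, 'f, 't) bicat \<Rightarrow> 'f \<Rightarrow> 'f \<Rightarrow> 'f \<Rightarrow> 'f \<Rightarrow> 't \<Rightarrow> bool" where
  "beck_chevalley B g f h i al \<longleftrightarrow> bc_square B g f h i al \<and>
     (\<exists>gL ung cog iL uni coi. adjunction B gL g ung cog \<and> adjunction B iL i uni coi \<and>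
        invertible2 B (left_mate B f h al gL ung iL coi)) \<and>
     (\<exists>fR unf cof hR unh coh. adjunction B f fR unf cof \<and> adjunction B h hR unh coh \<and>
        invertible2 B (right_mate B g i al fR cof hR unh))"

subsection \<open>Bicategories over a 1-category\<close>

text \<open>
  A functor from a bicategory \<open>E\<close> to a 1-category is given by its actions \<open>p0\<close> on objects and \<open>p1\<close>
  on 1-morphisms.
\<close>

definition arrows_over ::
  "('x, 'f, 't) bicat \<Rightarrow> ('f \<Rightarrow> 'b) \<Rightarrow> 'x \<Rightarrow> 'x \<Rightarrow> 'b \<Rightarrow> ('f, 't) cat" where
  "arrows_over E p1 x y b =
     (let Ob = {f \<in> hom1 E x y. p1 f = b} in
      \<lparr>Obj = Ob, Arr = {t \<in> Ar2 E. dom2 E t \<in> Ob \<and> cod2 E t \<in> Ob},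
       Dom = dom2 E, Cod = cod2 E, Idn = id2 E, Cmp = vcmp E\<rparr>)"

definition precomposition ::
  "('x, 'f, 't) bicat \<Rightarrow> 'f \<Rightarrow> ('f, 't) cat \<Rightarrow> ('f, 't, 'f, 't) fnctr" where
  "precomposition E F C = \<lparr>fo = (\<lambda>G \<in> Obj C. cmp1 E G F), fa = (\<lambda>t \<in> Arr C. rwhisk E t F)\<rparr>"

definition cocartesian ::
  "('x, 'f, 't) bicat \<Rightarrow> ('b, 'c, 'm) cat_scheme \<Rightarrow> ('x \<Rightarrow> 'b) \<Rightarrow> ('f \<Rightarrow> 'c) \<Rightarrow> 'f \<Rightarrow> bool" where
  "cocartesian E B p0 p1 F \<longleftrightarrow> F \<in> Ar1 E \<and>
     (\<forall>z \<in> Ob0 E. \<forall>g \<in> hom B (p0 (cod1 E F)) (p0 z).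
        is_equivalence
          (arrows_over E p1 (cod1 E F) z g)
          (arrows_over E p1 (dom1 E F) z (Cmp B g (p1 F)))
          (precomposition E F (arrows_over E p1 (cod1 E F) z g)))"

definition fibre_bicat ::
  "('x, 'f, 't) bicat \<Rightarrow> ('b, 'c, 'm) cat_scheme \<Rightarrow> ('x \<Rightarrow> 'b) \<Rightarrow> ('f \<Rightarrow> 'c) \<Rightarrow> 'b \<Rightarrow>
   ('x, 'f, 't) bicat" where
  "fibre_bicat E B p0 p1 b =
     (let A = {f \<in> Ar1 E. p0 (dom1 E f) = b \<and> p0 (cod1 E f) = b \<and> p1 f = Idn B b} in
      E\<lparr>Ob0 := {x \<in> Ob0 E. p0 x = b}, Ar1 := A,
        Ar2 := {t \<in> Ar2 E. dom2 E t \<in> A \<and> cod2 E t \<in> A}\<rparr>)"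

definition fibre_cat ::
  "('o, 'a) cat \<Rightarrow> ('b, 'c, 'm) cat_scheme \<Rightarrow> ('o \<Rightarrow> 'b) \<Rightarrow> ('a \<Rightarrow> 'c) \<Rightarrow> 'b \<Rightarrow> ('o, 'a) cat" where
  "fibre_cat E B p0 p1 b =
     E\<lparr>Obj := {x \<in> Obj E. p0 x = b},
       Arr := {f \<in> Arr E. p0 (Dom E f) = b \<and> p0 (Cod E f) = b \<and> p1 f = Idn B b}\<rparr>"

subsection \<open>Pseudofunctors from a 1-category\<close>

text \<open>
  \<open>pmu H g f\<close> is the compositor from \<open>H g \<circ> H f\<close> to \<open>H (g \<circ> f)\<close> and \<open>pun H x\<close> the unitor from
  \<open>id\<close> to \<open>H id\<close>. Associators and unitors of the target are identities.
\<close>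

record ('o, 'a, 'x, 'f, 't) psfun =
  pob :: "'o \<Rightarrow> 'x"
  par :: "'a \<Rightarrow> 'f"
  pmu :: "'a \<Rightarrow> 'a \<Rightarrow> 't"
  pun :: "'o \<Rightarrow> 't"

locale pseudofunctor =
  fixes C :: "('o, 'a, 'm) cat_scheme"
    and B :: "('x, 'f, 't) bicat"
    and H :: "('o, 'a, 'x, 'f, 't) psfun"
  assumes pob_ob: "x \<in> Obj C \<Longrightarrow> pob H x \<in> Ob0 B"
    and par_hom: "f \<in> hom C x y \<Longrightarrow> par H f \<in> hom1 B (pob H x) (pob H y)"
    and pmu_hom: "f \<in> hom C x y \<Longrightarrow> g \<in> hom C y z \<Longrightarrow>
      pmu H g f \<in> hom2 B (cmp1 B (par H g) (par H f)) (par H (Cmp C g f)) \<and>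
      invertible2 B (pmu H g f)"
    and pun_hom: "x \<in> Obj C \<Longrightarrow>
      pun H x \<in> hom2 B (id1 B (pob H x)) (par H (Idn C x)) \<and> invertible2 B (pun H x)"
    and pmu_assoc: "f \<in> hom C w x \<Longrightarrow> g \<in> hom C x y \<Longrightarrow> h \<in> hom C y z \<Longrightarrow>
      vcmp B (pmu H h (Cmp C g f)) (lwhisk B (par H h) (pmu H g f)) =
      vcmp B (pmu H (Cmp C h g) f) (rwhisk B (pmu H h g) (par H f))"
    and pun_right: "f \<in> hom C x y \<Longrightarrow>
      vcmp B (pmu H f (Idn C x)) (lwhisk B (par H f) (pun H x)) = id2 B (par H f)"
    and pun_left: "f \<in> hom C x y \<Longrightarrow>
      vcmp B (pmu H (Idn C y) f) (rwhisk B (pun H y) (par H f)) = id2 B (par H f)"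

section \<open>Collections over pointed finite sets\<close>

text \<open>
  A pointed finite set is represented as \<open>I\<close> with a base point adjoined, for \<open>I\<close> a finite set of
  natural numbers, and a pointed map as the corresponding partial function, undefined where the
  value is the base point. Collections are indexed by \<open>I\<close>, leaving out the base point.
\<close>

definition pointed_map :: "nat set \<Rightarrow> (nat \<rightharpoonup> nat) \<Rightarrow> nat set \<Rightarrow> bool" where
  "pointed_map I \<phi> J \<longleftrightarrow> finite I \<and> finite J \<and> dom \<phi> \<subseteq> I \<and> ran \<phi> \<subseteq> J"

definition FinSetPt :: "(nat set, nat set \<times> (nat \<rightharpoonup> nat) \<times> nat set) cat" where
  "FinSetPt =
     \<lparr>Obj = {I. finite I},
      Arr = {(I, \<phi>, J). pointed_map I \<phi> J},
      Dom = (\<lambda>(I, \<phi>, J). I),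
      Cod = (\<lambda>(I, \<phi>, J). J),
      Idn = (\<lambda>I. (I, (\<lambda>i. if i \<in> I then Some i else None), I)),
      Cmp = (\<lambda>(J', \<psi>, K) (I, \<phi>, J). (I, \<psi> \<circ>\<^sub>m \<phi>, K))\<rparr>"

definition fibre :: "(nat \<rightharpoonup> nat) \<Rightarrow> nat \<Rightarrow> nat set" where
  "fibre \<phi> j = {i. \<phi> i = Some j}"

record ('x, 'c) coll_arr =
  src :: "nat set \<times> (nat \<Rightarrow> 'x)"
  tgt :: "nat set \<times> (nat \<Rightarrow> 'x)"
  base :: "nat \<rightharpoonup> nat"
  cmps :: "nat \<Rightarrow> 'c"

definition proj0 :: "nat set \<times> (nat \<Rightarrow> 'x) \<Rightarrow> nat set" where
  "proj0 X = fst X"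

definition proj1 :: "('x, 'c) coll_arr \<Rightarrow> nat set \<times> (nat \<rightharpoonup> nat) \<times> nat set" where
  "proj1 F = (fst (src F), base F, fst (tgt F))"

subsection \<open>Finite sets\<close>

type_synonym fobj = "nat set \<times> (nat \<Rightarrow> nat set)"
type_synonym farr = "(nat set, nat \<Rightarrow> nat) coll_arr"

definition FinSetCop :: "(fobj, farr) cat" where
  "FinSetCop =
     (let Ob = {(I, S). finite I \<and> S \<in> (\<Pi>\<^sub>E i \<in> I. {T. finite T})} in
      \<lparr>Obj = Ob,
       Arr = {s. src s \<in> Ob \<and> tgt s \<in> Ob \<and>
                 pointed_map (fst (src s)) (base s) (fst (tgt s)) \<and>
                 cmps s \<in> (\<Pi>\<^sub>E i \<in> dom (base s). snd (src s) i \<rightarrow>\<^sub>E snd (tgt s) (the (base s i)))},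
       Dom = src,
       Cod = tgt,
       Idn = (\<lambda>(I, S). \<lparr>src = (I, S), tgt = (I, S), base = (\<lambda>i. if i \<in> I then Some i else None),
                        cmps = (\<lambda>i \<in> I. \<lambda>x \<in> S i. x)\<rparr>),
       Cmp = (\<lambda>t s. \<lparr>src = src s, tgt = tgt t, base = base t \<circ>\<^sub>m base s,
                     cmps = (\<lambda>i \<in> dom (base t \<circ>\<^sub>m base s).
                        \<lambda>x \<in> snd (src s) i. cmps t (the (base s i)) (cmps s i x))\<rparr>)\<rparr>)"

subsection \<open>Graded 2-vector spaces\<close>

type_synonym ('o, 'a, 'k) vobj = "nat set \<times> (nat \<Rightarrow> ('o, 'a, 'k) grcat)"
type_synonym ('o, 'a, 'k) varr = "(('o, 'a, 'k) grcat, ('o, 'a) multifunctor) coll_arr"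

record ('o, 'a, 'k) vcell =
  tsrc :: "('o, 'a, 'k) varr"
  ttgt :: "('o, 'a, 'k) varr"
  tcmps :: "nat \<Rightarrow> (nat \<Rightarrow> nat \<Rightarrow> 'o) \<Rightarrow> nat \<Rightarrow> 'a"

abbreviation vdom :: "('o, 'a, 'k) varr \<Rightarrow> nat \<Rightarrow> (nat \<Rightarrow> nat \<Rightarrow> 'o, nat \<Rightarrow> nat \<Rightarrow> 'a, 'k) lincat" where
  "vdom F j \<equiv> Prod (fibre (base F) j) (\<lambda>i. tot (snd (src F) i))"

abbreviation vcod :: "('o, 'a, 'k) varr \<Rightarrow> nat \<Rightarrow> (nat \<Rightarrow> 'o, nat \<Rightarrow> 'a, 'k) lincat" where
  "vcod F j \<equiv> tot (snd (tgt F) j)"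

definition vobjs :: "('o, 'a, 'k :: field) vobj set" where
  "vobjs = {(I, C). finite I \<and> C \<in> (\<Pi>\<^sub>E i \<in> I. {D. graded_two_vector_space D})}"

definition varrs :: "int set \<Rightarrow> ('o, 'a, 'k :: field) varr set" where
  "varrs L = {F. src F \<in> vobjs \<and> tgt F \<in> vobjs \<and>
     pointed_map (fst (src F)) (base F) (fst (tgt F)) \<and>
     cmps F \<in> (\<Pi>\<^sub>E j \<in> fst (tgt F).
       {f. bounded_multi_exact L (fibre (base F) j) (snd (src F)) (snd (tgt F) j) f})}"

definition vcells :: "int set \<Rightarrow> ('o, 'a, 'k :: field) vcell set" where
  "vcells L = {t. tsrc t \<in> varrs L \<and> ttgt t \<in> varrs L \<and>
     src (tsrc t) = src (ttgt t) \<and> tgt (tsrc t) = tgt (ttgt t) \<and> base (tsrc t) = base (ttgt t) \<and>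
     tcmps t \<in> (\<Pi>\<^sub>E j \<in> fst (tgt (tsrc t)).
       {u. nat_trans (vdom (tsrc t) j) (vcod (tsrc t) j) (cmps (tsrc t) j) (cmps (ttgt t) j) u})}"

definition vid :: "('o, 'a, 'k) vobj \<Rightarrow> ('o, 'a, 'k) varr" where
  "vid X = \<lparr>src = X, tgt = X, base = (\<lambda>i. if i \<in> fst X then Some i else None),
     cmps = (\<lambda>i \<in> fst X.
       \<lparr>fo = (\<lambda>A \<in> Obj (Prod {i} (\<lambda>i. tot (snd X i))). A i),
        fa = (\<lambda>u \<in> Arr (Prod {i} (\<lambda>i. tot (snd X i))). u i)\<rparr>)\<rparr>"

definition vcomp :: "('o, 'a, 'k) varr \<Rightarrow> ('o, 'a, 'k) varr \<Rightarrow> ('o, 'a, 'k) varr" where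
  "vcomp G F = \<lparr>src = src F, tgt = tgt G, base = base G \<circ>\<^sub>m base F,
     cmps = (\<lambda>k \<in> fst (tgt G).
       (let P = Prod (fibre (base G \<circ>\<^sub>m base F) k) (\<lambda>i. tot (snd (src F) i)) in
        \<lparr>fo = (\<lambda>A \<in> Obj P. fo (cmps G k)
                 (\<lambda>j \<in> fibre (base G) k. fo (cmps F j) (restrict A (fibre (base F) j)))),
         fa = (\<lambda>u \<in> Arr P. fa (cmps G k)
                 (\<lambda>j \<in> fibre (base G) k. fa (cmps F j) (restrict u (fibre (base F) j))))\<rparr>))\<rparr>"

definition vtid :: "('o, 'a, 'k) varr \<Rightarrow> ('o, 'a, 'k) vcell" where
  "vtid F = \<lparr>tsrc = F, ttgt = F,
     tcmps = (\<lambda>j \<in> fst (tgt F). \<lambda>A \<in> Obj (vdom F j). Idn (vcod F j) (fo (cmps F j) A))\<rparr>"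

definition vtvert :: "('o, 'a, 'k) vcell \<Rightarrow> ('o, 'a, 'k) vcell \<Rightarrow> ('o, 'a, 'k) vcell" where
  "vtvert s t = \<lparr>tsrc = tsrc t, ttgt = ttgt s,
     tcmps = (\<lambda>j \<in> fst (tgt (tsrc t)). \<lambda>A \<in> Obj (vdom (tsrc t) j).
       Cmp (vcod (tsrc t) j) (tcmps s j A) (tcmps t j A))\<rparr>"

definition vthoriz :: "('o, 'a, 'k) vcell \<Rightarrow> ('o, 'a, 'k) vcell \<Rightarrow> ('o, 'a, 'k) vcell" where
  "vthoriz s t =
     (let G = tsrc s; F = tsrc t; F' = ttgt t in
      \<lparr>tsrc = vcomp G F, ttgt = vcomp (ttgt s) F',
       tcmps = (\<lambda>k \<in> fst (tgt G). \<lambda>A \<in> Obj (vdom (vcomp G F) k).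
         Cmp (vcod G k)
           (tcmps s k (\<lambda>j \<in> fibre (base G) k. fo (cmps F' j) (restrict A (fibre (base F) j))))
           (fa (cmps G k)
             (\<lambda>j \<in> fibre (base G) k. tcmps t j (restrict A (fibre (base F) j)))))\<rparr>)"

definition GrVect :: "int set \<Rightarrow> (('o, 'a, 'k :: field) vobj, ('o, 'a, 'k) varr, ('o, 'a, 'k) vcell) bicat" where
  "GrVect L =
     \<lparr>Ob0 = vobjs, Ar1 = varrs L, dom1 = src, cod1 = tgt, id1 = vid, cmp1 = vcomp,
      Ar2 = vcells L, dom2 = tsrc, cod2 = ttgt, id2 = vtid, vcmp = vtvert, hcmp = vthoriz\<rparr>"

text \<open>The multi-exact functors of the tensor version have degrees bounded below by zero.\<close>

definition TwoVectGrTensor ::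
  "(('o, 'a, 'k :: field) vobj, ('o, 'a, 'k) varr, ('o, 'a, 'k) vcell) bicat" where
  "TwoVectGrTensor = GrVect {0..}"

text \<open>
  Graded 2-vector spaces, with functors of arbitrary bounded degree, so that adjoints exist. A graded
  2-vector space is regarded as a collection indexed by the set \<open>{1}\<close>.
\<close>

definition TwoVectGr ::
  "(('o, 'a, 'k :: field) vobj, ('o, 'a, 'k) varr, ('o, 'a, 'k) vcell) bicat" where
  "TwoVectGr = fibre_bicat (GrVect UNIV) FinSetPt proj0 proj1 {1}"

definition degree_zero :: "('o, 'a, 'k) varr \<Rightarrow> bool" where
  "degree_zero F \<longleftrightarrow>
     (\<forall>j \<in> fst (tgt F). of_degree 0 (fibre (base F) j) (snd (src F)) (snd (tgt F) j) (cmps F j))"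

section \<open>SSH categories\<close>

type_synonym ('o, 'a, 'k) ssh_data =
  "(fobj, farr, ('o, 'a, 'k) vobj, ('o, 'a, 'k) varr, ('o, 'a, 'k) vcell) psfun"

definition ssh_category :: "('o, 'a, 'k :: field_char_0) ssh_data \<Rightarrow> bool" where
  "ssh_category H \<longleftrightarrow>
     pseudofunctor FinSetCop TwoVectGrTensor H \<and>
     (\<forall>X \<in> Obj FinSetCop. proj0 (pob H X) = proj0 X) \<and>
     (\<forall>s \<in> Arr FinSetCop. proj1 (par H s) = proj1 s) \<and>
     (\<forall>s \<in> Arr FinSetCop. degree_zero (par H s)) \<and>
     (\<forall>s. cocartesian (discrete_bicat FinSetCop) FinSetPt proj0 proj1 s \<longrightarrow>
          cocartesian TwoVectGrTensor FinSetPt proj0 proj1 (par H s)) \<and>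
     (\<forall>g f h i. pullback_square (fibre_cat FinSetCop FinSetPt proj0 proj1 {1}) g f h i \<longrightarrow>
        beck_chevalley TwoVectGr (par H g) (par H f) (par H h) (par H i)
          (vcmp TwoVectGrTensor (inv2 TwoVectGrTensor (pmu H i f)) (pmu H h g)))"

text \<open>The object \<open>([1])\<^sub>i\<^sub>\<in>\<^sub>I\<close>, and the arrow consisting of copies of the identity of \<open>[1]\<close>.\<close>

definition ones :: "nat set \<Rightarrow> fobj" where
  "ones I = (I, \<lambda>i \<in> I. {1})"

definition ids :: "nat set \<Rightarrow> (nat \<rightharpoonup> nat) \<Rightarrow> nat set \<Rightarrow> farr" where
  "ids I \<phi> J = \<lparr>src = ones I, tgt = ones J, base = \<phi>, cmps = (\<lambda>i \<in> dom \<phi>. \<lambda>x \<in> {1}. x)\<rparr>"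

definition ssh_structure :: "('o, 'a, 'k :: field_char_0) ssh_data \<Rightarrow> ('o, 'a, 'k) grcat \<Rightarrow> bool" where
  "ssh_structure H C \<longleftrightarrow> ssh_category H \<and> pob H (ones {1}) = ({1}, \<lambda>i \<in> {1}. C)"

section \<open>The symmetric monoidal structure defined by an SSH structure\<close>

text \<open>
  The arrow \<open>collapse I S\<close> consists of identities of \<open>[1]\<close> and lies over the pointed map from \<open>I\<close> to
  \<open>{1}\<close> that sends \<open>S\<close> to \<open>1\<close> and everything else to the base point.
\<close>

definition collapse :: "nat set \<Rightarrow> nat set \<Rightarrow> farr" where
  "collapse I S = ids I (\<lambda>i. if i \<in> S then Some 1 else None) {1}"

definition split_map :: "nat set \<Rightarrow> nat set \<Rightarrow> nat set \<Rightarrow> farr" where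
  "split_map I S S' =
     ids I (\<lambda>i. if i \<in> S then Some 1 else if i \<in> S' then Some 2 else None) {1, 2}"

text \<open>The arrow from \<open>([1], [1])\<close> to \<open>[1]\<close> over the active map.\<close>

definition fold_map :: farr where
  "fold_map = collapse {1, 2} {1, 2}"

text \<open>
  The comparison of \<open>H ([1], [1])\<close> with \<open>(C, C)\<close>; its two components are the images under \<open>H\<close> of the
  two inert projections \<open>([1], [1]) \<rightarrow> [1]\<close>.
\<close>

definition segal :: "('o, 'a, 'k) ssh_data \<Rightarrow> ('o, 'a, 'k) grcat \<Rightarrow> ('o, 'a, 'k) varr" where
  "segal H C = \<lparr>src = pob H (ones {1, 2}), tgt = ({1, 2}, \<lambda>i \<in> {1, 2}. C),
     base = (\<lambda>i. if i \<in> {1, 2} then Some i else None),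
     cmps = (\<lambda>i \<in> {1, 2}. cmps (par H (collapse {1, 2} {i})) 1)\<rparr>"

text \<open>The tensor product as an arrow from \<open>(C, C)\<close> to \<open>C\<close> over the active map.\<close>

definition tensor_arr ::
  "('o, 'a, 'k) grcat \<Rightarrow> (nat \<Rightarrow> 'o, nat \<Rightarrow> 'a) monoidal_data \<Rightarrow> ('o, 'a, 'k) varr" where
  "tensor_arr C M = \<lparr>src = ({1, 2}, \<lambda>i \<in> {1, 2}. C), tgt = ({1}, \<lambda>i \<in> {1}. C),
     base = (\<lambda>i. if i \<in> {1, 2} then Some 1 else None),
     cmps = (\<lambda>j \<in> {1}.
       \<lparr>fo = (\<lambda>A \<in> Obj (Prod {1, 2} (\<lambda>i. tot C)). tenO M (A 1) (A 2)),
        fa = (\<lambda>u \<in> Arr (Prod {1, 2} (\<lambda>i. tot C)). tenA M (u 1) (u 2))\<rparr>)\<rparr>"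

text \<open>
  Let \<open>H ([1])\<^sub>i\<^sub>\<in>\<^sub>I = (C\<^sub>i)\<^sub>i\<^sub>\<in>\<^sub>I\<close>. For \<open>S \<subseteq> I\<close> and objects \<open>A i\<close> of \<open>C\<^sub>i\<close>, \<open>mprod H I S A\<close> is the
  product in \<open>C\<close> of the \<open>A i\<close> with \<open>i \<in> S\<close>, formed by the image of \<open>collapse I S\<close> under \<open>H\<close>.
\<close>

definition mprod :: "('o, 'a, 'k) ssh_data \<Rightarrow> nat set \<Rightarrow> nat set \<Rightarrow> (nat \<Rightarrow> nat \<Rightarrow> 'o) \<Rightarrow> nat \<Rightarrow> 'o" where
  "mprod H I S A = fo (cmps (par H (collapse I S)) 1) (restrict A S)"

text \<open>
  Given an isomorphism \<open>\<Theta>\<close> from \<open>tensor_arr C M \<circ> segal H C\<close> to \<open>H fold_map\<close>, the compositors of \<open>H\<close>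
  for the factorizations
  \<open>collapse I (S \<union> S') = fold_map \<circ> split_map I S S'\<close>,
  \<open>collapse I S = collapse {1, 2} {1} \<circ> split_map I S S'\<close> and
  \<open>collapse I S' = collapse {1, 2} {2} \<circ> split_map I S S'\<close>
  turn \<open>\<Theta>\<close> into isomorphisms
  \<open>mprod H I S A \<otimes> mprod H I S' A \<rightarrow> mprod H I (S \<union> S') A\<close> for disjoint \<open>S\<close> and \<open>S'\<close>.
\<close>

definition mult_iso ::
  "('o, 'a, 'k) ssh_data \<Rightarrow> ('o, 'a, 'k) grcat \<Rightarrow> (nat \<Rightarrow> 'o, nat \<Rightarrow> 'a) monoidal_data \<Rightarrow>
   ('o, 'a, 'k) vcell \<Rightarrow> nat set \<Rightarrow> nat set \<Rightarrow> nat set \<Rightarrow> (nat \<Rightarrow> nat \<Rightarrow> 'o) \<Rightarrow> nat \<Rightarrow> 'a" where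
  "mult_iso H C M \<Theta> I S S' A =
     (let s = split_map I S S';
          A' = (\<lambda>j \<in> {1, 2}. fo (cmps (par H s) j) (restrict A (fibre (base s) j)));
          k1 = tcmps (pmu H (collapse {1, 2} {1}) s) 1 (restrict A S);
          k2 = tcmps (pmu H (collapse {1, 2} {2}) s) 1 (restrict A S')
      in Cmp (tot C) (tcmps (pmu H fold_map s) 1 (restrict A (S \<union> S')))
           (Cmp (tot C) (tcmps \<Theta> 1 A') (inv_arr (tot C) (tenA M k1 k2))))"

text \<open>
  Likewise \<open>\<upsilon> : 1 \<rightarrow> mprod H {} {} (\<lambda>_. undefined)\<close> yields an isomorphism from the unit to the empty
  product \<open>mprod H I {} A\<close>.
\<close>

definition unit_iso ::
  "('o, 'a, 'k) ssh_data \<Rightarrow> ('o, 'a, 'k) grcat \<Rightarrow> (nat \<Rightarrow> 'a) \<Rightarrow> nat set \<Rightarrow> nat \<Rightarrow> 'a" where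
  "unit_iso H C \<upsilon> I =
     Cmp (tot C) (tcmps (pmu H (collapse {} {}) (ids I Map.empty {})) 1 (\<lambda>_. undefined)) \<upsilon>"

text \<open>
  The constraints of \<open>M\<close> are those coming from the coherence isomorphisms of \<open>H\<close>.
\<close>

definition constraints_from ::
  "('o, 'a, 'k) ssh_data \<Rightarrow> ('o, 'a, 'k) grcat \<Rightarrow> (nat \<Rightarrow> 'o, nat \<Rightarrow> 'a) monoidal_data \<Rightarrow>
   ('o, 'a, 'k) vcell \<Rightarrow> (nat \<Rightarrow> 'a) \<Rightarrow> bool" where
  "constraints_from H C M \<Theta> \<upsilon> \<longleftrightarrow>
     (\<forall>I A. finite I \<and> A \<in> Obj (Prod I (\<lambda>i. tot (snd (pob H (ones I)) i))) \<longrightarrow>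
       (let N = (\<lambda>S. mprod H I S A);
            m = (\<lambda>S S'. mult_iso H C M \<Theta> I S S' A);
            e = unit_iso H C \<upsilon> I;
            D = tot C
        in
        (\<forall>S S' S''. S \<subseteq> I \<and> S' \<subseteq> I \<and> S'' \<subseteq> I \<and> S \<inter> S' = {} \<and> S \<inter> S'' = {} \<and> S' \<inter> S'' = {} \<longrightarrow>
           Cmp D (m (S \<union> S') S'') (tenA M (m S S') (Idn D (N S''))) =
           Cmp D (m S (S' \<union> S''))
             (Cmp D (tenA M (Idn D (N S)) (m S' S'')) (assoc M (N S) (N S') (N S'')))) \<and>
        (\<forall>S S'. S \<subseteq> I \<and> S' \<subseteq> I \<and> S \<inter> S' = {} \<longrightarrow>
           Cmp D (m S' S) (braid M (N S) (N S')) = m S S') \<and>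
        (\<forall>S \<subseteq> I.
           Cmp D (m {} S) (tenA M e (Idn D (N S))) = lunit M (N S) \<and>
           Cmp D (m S {}) (tenA M (Idn D (N S)) e) = runit M (N S))))"

end

theory Submission
  imports Defs
begin

text \<open>
  The arrow \<open>collapse I {i}\<close> is coCartesian and split by the arrow over \<open>1 \<mapsto> i\<close>, so under \<open>H\<close> its
  component \<open>H ([1])\<^sub>i \<rightarrow> C\<close> has a left and a right inverse; it is an equivalence of degree zero.
  Hence tuples of objects and maps of \<open>C\<close> lift along the Segal functors, and the tensor product is
  \<open>H fold_map\<close> composed with the inverse of the Segal functor for \<open>{1, 2}\<close>.

  For a lift \<open>A\<close> of a tuple, \<open>H\<close> supplies unbiased products \<open>mprod H I S A\<close> and isomorphisms
  \<open>mprod H I S A \<otimes> mprod H I S' A \<rightarrow> mprod H I (S \<union> S') A\<close>, compatible with maps of tuples and with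
  maps of index sets. The constraints of the monoidal structure are the unique maps compatible with
  these isomorphisms, and the coherence laws hold because both sides agree after composition with
  the isomorphism to an unbiased product.
\<close>

section \<open>Isomorphisms and functors\<close>

text \<open>The categories \<open>K I i\<close> agree with \<open>C\<close> literally only for
  \<open>I = {1}\<close>; otherwise they are tied to \<open>C\<close> by the Segal functors. Objects
  of \<open>C\<close> are thus merely isomorphic to members of a family, and the laws are phrased
  with maps from arbitrary objects into unbiased products instead of with the members themselves.

  CoCartesianness is used to obtain a left inverse of a Segal functor as a bare functor, without
  control of its degree. The image of the section is exact and of degree zero because it is a value
  of \<open>H\<close>. Once a left inverse exists, this right inverse is two-sided up to
  isomorphism, and it is the one that enters the tensor product.

  A constraint is computed on a single lift of the objects; the substance is its independence of the
  lift and of the index set. This rests on fullness of the Segal functors (maps between members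
  extend to maps of tuples), on naturality of the multiplication maps (\<open>mult_nat\<close>), and
  on associativity of the compositors, which makes multiplication commute with pushing a tuple along
  a map of index sets (\<open>mult_push\<close>).\<close>

lemma hom_arr: "f \<in> hom C X Y \<Longrightarrow> f \<in> Arr C"
  and hom_dom: "f \<in> hom C X Y \<Longrightarrow> Dom C f = X"
  and hom_cod: "f \<in> hom C X Y \<Longrightarrow> Cod C f = Y"
  and arr_hom: "f \<in> Arr C \<Longrightarrow> f \<in> hom C (Dom C f) (Cod C f)"
  by (auto simp: hom_def)

context category
begin

lemma hom_obj: "f \<in> hom C X Y \<Longrightarrow> X \<in> Obj C" "f \<in> hom C X Y \<Longrightarrow> Y \<in> Obj C"
  using dom_obj cod_obj by (auto simp: hom_def)

lemma isoI:
  assumes "f \<in> hom C X Y" "g \<in> hom C Y X" "Cmp C g f = Idn C X" "Cmp C f g = Idn C Y"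
  shows "iso_arr C f"
  using assms by (auto simp: iso_arr_def inverse_arrows_def hom_def)

lemma inverse_arrows_unique:
  assumes "inverse_arrows C f g" "inverse_arrows C f h"
  shows "g = h"
proof -
  have f: "f \<in> hom C (Dom C f) (Cod C f)"
    using assms by (auto simp: inverse_arrows_def hom_def)
  have g: "g \<in> hom C (Cod C f) (Dom C f)" and h: "h \<in> hom C (Cod C f) (Dom C f)"
    using assms by (auto simp: inverse_arrows_def)
  have "g = Cmp C g (Cmp C f h)"
    using assms idn_right[OF g] by (simp add: inverse_arrows_def)
  also have "\<dots> = Cmp C (Cmp C g f) h" by (rule cmp_assoc[OF h f g])
  also have "\<dots> = h"
    using assms idn_left[OF h] by (simp add: inverse_arrows_def)
  finally show ?thesis .
qed

lemma inv_arr: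
  assumes "iso_arr C f" "f \<in> hom C X Y"
  shows inv_hom: "inv_arr C f \<in> hom C Y X"
    and inv_left: "Cmp C (inv_arr C f) f = Idn C X"
    and inv_right: "Cmp C f (inv_arr C f) = Idn C Y"
proof -
  obtain g where g: "inverse_arrows C f g" using assms by (auto simp: iso_arr_def)
  then have "inv_arr C f = g"
    unfolding inv_arr_def using inverse_arrows_unique by blast
  then show "inv_arr C f \<in> hom C Y X" "Cmp C (inv_arr C f) f = Idn C X"
    "Cmp C f (inv_arr C f) = Idn C Y"
    using g assms(2) by (auto simp: inverse_arrows_def hom_def)
qed

lemma iso_inv: "iso_arr C f \<Longrightarrow> f \<in> hom C X Y \<Longrightarrow> iso_arr C (inv_arr C f)"
  using isoI[OF inv_hom _ inv_right inv_left] by blast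

lemma iso_idn: "X \<in> Obj C \<Longrightarrow> iso_arr C (Idn C X)"
  using isoI[OF idn_hom idn_hom] idn_left[OF idn_hom] by blast

lemma cancel_left:
  assumes "iso_arr C k" "k \<in> hom C Y Z" "f \<in> hom C X Y"
  shows "Cmp C (inv_arr C k) (Cmp C k f) = f" 
  using cmp_assoc[OF assms(3,2) inv_hom[OF assms(1,2)]] inv_left[OF assms(1,2)]
    idn_left[OF assms(3)] by simp

lemma cancel_left':
  assumes "iso_arr C k" "k \<in> hom C Y Z" "f \<in> hom C X Z"
  shows "Cmp C k (Cmp C (inv_arr C k) f) = f"
  using cmp_assoc[OF assms(3) inv_hom[OF assms(1,2)] assms(2)] inv_right[OF assms(1,2)]
    idn_left[OF assms(3)] by simp

lemma cancel_right:
  assumes "iso_arr C k" "k \<in> hom C X Y" "f \<in> hom C Y Z"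
  shows "Cmp C (Cmp C f k) (inv_arr C k) = f"
  using cmp_assoc[OF inv_hom[OF assms(1,2)] assms(2,3)] inv_right[OF assms(1,2)]
    idn_right[OF assms(3)] by simp

lemma cancel_right':
  assumes "iso_arr C k" "k \<in> hom C X Y" "f \<in> hom C X Z"
  shows "Cmp C (Cmp C f (inv_arr C k)) k = f"
  using cmp_assoc[OF assms(2) inv_hom[OF assms(1,2)] assms(3)] inv_left[OF assms(1,2)]
    idn_right[OF assms(3)] by simp

lemma iso_monic:
  assumes "iso_arr C k" "k \<in> hom C Y Z" "f \<in> hom C X Y" "g \<in> hom C X Y" "Cmp C k f = Cmp C k g"
  shows "f = g"
  using cancel_left[OF assms(1,2,3)] cancel_left[OF assms(1,2,4)] assms(5) by metis

lemma iso_epic: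
  assumes "iso_arr C k" "k \<in> hom C X Y" "f \<in> hom C Y Z" "g \<in> hom C Y Z" "Cmp C f k = Cmp C g k"
  shows "f = g"
  using cancel_right[OF assms(1,2,3)] cancel_right[OF assms(1,2,4)] assms(5) by metis

lemma iso_cmp:
  assumes "iso_arr C f" "f \<in> hom C X Y" "iso_arr C g" "g \<in> hom C Y Z"
  shows "iso_arr C (Cmp C g f)"
proof (rule isoI)
  note f' = inv_hom[OF assms(1,2)] and g' = inv_hom[OF assms(3,4)]
  show "Cmp C g f \<in> hom C X Z" using assms cmp_hom by blast
  show "Cmp C (inv_arr C f) (inv_arr C g) \<in> hom C Z X" using f' g' cmp_hom by blast
  show "Cmp C (Cmp C (inv_arr C f) (inv_arr C g)) (Cmp C g f) = Idn C X"
    using cmp_assoc[OF cmp_hom[OF assms(2,4)] g' f'] cancel_left[OF assms(3,4,2)]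
      inv_left[OF assms(1,2)] by simp
  show "Cmp C (Cmp C g f) (Cmp C (inv_arr C f) (inv_arr C g)) = Idn C Z"
    using cmp_assoc[OF cmp_hom[OF g' f'] assms(2,4)] cancel_left'[OF assms(1,2) g']
      inv_right[OF assms(3,4)] by simp
qed

end

section \<open>Functors, natural isomorphisms and inverses up to isomorphism\<close>

lemma functor_obj: "is_functor C D F \<Longrightarrow> X \<in> Obj C \<Longrightarrow> fo F X \<in> Obj D"
  by (auto simp: is_functor_def)

lemma functor_hom: "is_functor C D F \<Longrightarrow> f \<in> hom C X Y \<Longrightarrow> fa F f \<in> hom D (fo F X) (fo F Y)"
  by (auto simp: is_functor_def hom_def)

lemma functor_idn: "is_functor C D F \<Longrightarrow> X \<in> Obj C \<Longrightarrow> fa F (Idn C X) = Idn D (fo F X)"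
  by (auto simp: is_functor_def)

lemma functor_cmp: "is_functor C D F \<Longrightarrow> f \<in> hom C X Y \<Longrightarrow> g \<in> hom C Y Z \<Longrightarrow>
    fa F (Cmp C g f) = Cmp D (fa F g) (fa F f)"
  by (auto simp: is_functor_def hom_def)

lemma is_functorI:
  assumes "category C"
    and "fo F \<in> extensional (Obj C)" "fa F \<in> extensional (Arr C)"
    and "\<And>X. X \<in> Obj C \<Longrightarrow> fo F X \<in> Obj D"
    and "\<And>f X Y. f \<in> hom C X Y \<Longrightarrow> fa F f \<in> hom D (fo F X) (fo F Y)"
    and "\<And>X. X \<in> Obj C \<Longrightarrow> fa F (Idn C X) = Idn D (fo F X)"
    and "\<And>f g X Y Z. f \<in> hom C X Y \<Longrightarrow> g \<in> hom C Y Z \<Longrightarrow>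
      fa F (Cmp C g f) = Cmp D (fa F g) (fa F f)"
  shows "is_functor C D F"
  unfolding is_functor_def
proof (intro conjI ballI impI)
  show "fo F \<in> Obj C \<rightarrow>\<^sub>E Obj D" using assms(2,4) by (auto simp: PiE_def)
  show "fa F \<in> Arr C \<rightarrow>\<^sub>E Arr D"
    using assms(3,5) by (auto simp: PiE_def hom_def)
  show "Dom D (fa F f) = fo F (Dom C f)" "Cod D (fa F f) = fo F (Cod C f)" if "f \<in> Arr C" for f
    using assms(5)[OF arr_hom[OF that]] by (auto simp: hom_def)
  show "fa F (Cmp C g f) = Cmp D (fa F g) (fa F f)"
    if "f \<in> Arr C" "g \<in> Arr C" "Cod C f = Dom C g" for f g
    using assms(7)[OF arr_hom[OF that(1)], of g] that by (auto simp: hom_def)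
qed (rule assms(6))

lemma functor_iso:
  assumes "category C" "category D" "is_functor C D F" "f \<in> hom C X Y" "iso_arr C f"
  shows "iso_arr D (fa F f)"
proof -
  interpret C: category C by fact
  interpret D: category D by fact
  note i = C.inv_hom[OF assms(5,4)]
  note XY = C.hom_obj[OF assms(4)]
  have *: "Cmp D (fa F (inv_arr C f)) (fa F f) = Idn D (fo F X)"
    "Cmp D (fa F f) (fa F (inv_arr C f)) = Idn D (fo F Y)"
    using functor_cmp[OF assms(3,4) i] functor_cmp[OF assms(3) i assms(4)]
      C.inv_left[OF assms(5,4)] C.inv_right[OF assms(5,4)] functor_idn[OF assms(3)] XY
    by simp_all
  note h = functor_hom[OF assms(3,4)] functor_hom[OF assms(3) i]
  show "iso_arr D (fa F f)" by (rule D.isoI[OF h *])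
qed

lemma nat_isoD:
  assumes "nat_iso C D F G t"
  shows nat_iso_hom: "X \<in> Obj C \<Longrightarrow> t X \<in> hom D (fo F X) (fo G X)"
    and nat_iso_iso: "X \<in> Obj C \<Longrightarrow> iso_arr D (t X)"
    and nat_iso_nat: "f \<in> hom C X Y \<Longrightarrow> Cmp D (t Y) (fa F f) = Cmp D (fa G f) (t X)"
  using assms by (auto simp: nat_iso_def nat_trans_def hom_def)

lemma nat_isoI:
  assumes "t \<in> extensional (Obj C)"
    and "\<And>X. X \<in> Obj C \<Longrightarrow> t X \<in> hom D (fo F X) (fo G X)"
    and "\<And>X. X \<in> Obj C \<Longrightarrow> iso_arr D (t X)"
    and "\<And>f X Y. f \<in> hom C X Y \<Longrightarrow> Cmp D (t Y) (fa F f) = Cmp D (fa G f) (t X)"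
  shows "nat_iso C D F G t"
  unfolding nat_iso_def nat_trans_def
proof (intro conjI ballI)
  show "t \<in> (\<Pi>\<^sub>E X\<in>Obj C. hom D (fo F X) (fo G X))"
    using assms(1,2) by (auto simp: PiE_def)
  show "Cmp D (t (Cod C f)) (fa F f) = Cmp D (fa G f) (t (Dom C f))" if "f \<in> Arr C" for f
    by (rule assms(4)[OF arr_hom[OF that]])
qed (rule assms(3))

lemma nat_iso_inverse:
  assumes "category C" "category D" "is_functor C D F" "is_functor C D G" "nat_iso C D F G t"
  shows "nat_iso C D G F (\<lambda>X \<in> Obj C. inv_arr D (t X))"
proof (rule nat_isoI)
  interpret C: category C by fact
  interpret D: category D by fact
  note t = nat_isoD[OF assms(5)]
  show "(\<lambda>X\<in>Obj C. inv_arr D (t X)) X \<in> hom D (fo G X) (fo F X)" if "X \<in> Obj C" for X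
    using D.inv_hom[OF t(2,1)] that by simp
  show "iso_arr D ((\<lambda>X\<in>Obj C. inv_arr D (t X)) X)" if "X \<in> Obj C" for X
    using D.iso_inv[OF t(2,1)] that by simp
  fix f X Y assume f: "f \<in> hom C X Y"
  then have XY: "X \<in> Obj C" "Y \<in> Obj C" using C.hom_obj by auto
  note Ff = functor_hom[OF assms(3) f] and Gf = functor_hom[OF assms(4) f]
  note tX = t(1)[OF XY(1)] t(2)[OF XY(1)] and tY = t(1)[OF XY(2)] t(2)[OF XY(2)]
  have "Cmp D (inv_arr D (t Y)) (fa G f) =
      Cmp D (inv_arr D (t Y)) (Cmp D (Cmp D (fa G f) (t X)) (inv_arr D (t X)))"
    using D.cancel_right[OF tX(2,1) Gf] by simp
  also have "\<dots> = Cmp D (inv_arr D (t Y)) (Cmp D (t Y) (Cmp D (fa F f) (inv_arr D (t X))))"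
    using t(3)[OF f] D.cmp_assoc[OF D.inv_hom[OF tX(2,1)] Ff tY(1)] by simp
  also have "\<dots> = Cmp D (fa F f) (inv_arr D (t X))"
    by (rule D.cancel_left[OF tY(2,1) D.cmp_hom[OF D.inv_hom[OF tX(2,1)] Ff]])
  finally show "Cmp D ((\<lambda>X\<in>Obj C. inv_arr D (t X)) Y) (fa G f) =
      Cmp D (fa F f) ((\<lambda>X\<in>Obj C. inv_arr D (t X)) X)"
    using XY by simp
qed simp

lemma id_functor_simps [simp]:
  "X \<in> Obj C \<Longrightarrow> fo (id_functor C) X = X" "f \<in> Arr C \<Longrightarrow> fa (id_functor C) f = f"
  by (simp_all add: id_functor_def)

lemma cmp_functor_simps [simp]:
  "X \<in> Obj C \<Longrightarrow> fo (cmp_functor C G F) X = fo G (fo F X)"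
  "f \<in> Arr C \<Longrightarrow> fa (cmp_functor C G F) f = fa G (fa F f)"
  by (simp_all add: cmp_functor_def)

lemma id_is_functor: "category C \<Longrightarrow> is_functor C C (id_functor C)"
  unfolding is_functor_def id_functor_def
  by (auto simp: category.dom_obj category.cod_obj category.idn_hom[THEN hom_arr]
      category.cmp_hom[THEN hom_arr] hom_def)

lemma cmp_is_functor:
  assumes "category A" "is_functor A B F" "is_functor B C G"
  shows "is_functor A C (cmp_functor A G F)"
proof -
  interpret A: category A by fact
  show ?thesis
  proof (rule is_functorI)
    show "fo (cmp_functor A G F) X \<in> Obj C" if "X \<in> Obj A" for X
      using that by (simp add: functor_obj[OF assms(3)] functor_obj[OF assms(2)])
    show "fa (cmp_functor A G F) f \<in> hom C (fo (cmp_functor A G F) X) (fo (cmp_functor A G F) Y)"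
      if f: "f \<in> hom A X Y" for f X Y
      using functor_hom[OF assms(3) functor_hom[OF assms(2) f]] A.hom_obj[OF f] hom_arr[OF f]
      by simp
    show "fa (cmp_functor A G F) (Idn A X) = Idn C (fo (cmp_functor A G F) X)" if "X \<in> Obj A" for X
      using that A.idn_hom[THEN hom_arr] functor_idn[OF assms(2)] functor_idn[OF assms(3)]
        functor_obj[OF assms(2)] by simp
    show "fa (cmp_functor A G F) (Cmp A g f) =
        Cmp C (fa (cmp_functor A G F) g) (fa (cmp_functor A G F) f)"
      if f: "f \<in> hom A X Y" and g: "g \<in> hom A Y Z" for f g X Y Z
      using functor_cmp[OF assms(2) f g] hom_arr[OF f] hom_arr[OF g] hom_arr[OF A.cmp_hom[OF f g]]
        functor_cmp[OF assms(3) functor_hom[OF assms(2) f] functor_hom[OF assms(2) g]] by simp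
  qed (fact, simp_all add: cmp_functor_def)
qed

text \<open>Naturality of \<open>t\<close> gives \<open>u t_X = t_Y (G F u)\<close>, so
  \<open>u\<close> is recovered from \<open>F u\<close> once the isomorphism \<open>t_X\<close> is
  cancelled.\<close>

lemma faithful_of_left_inverse:
  assumes "category A" "category B" "is_functor A B F" "is_functor B A G"
    and t: "nat_iso A A (cmp_functor A G F) (id_functor A) t"
    and uv: "u \<in> hom A X Y" "v \<in> hom A X Y" "fa F u = fa F v"
  shows "u = v"
proof -
  interpret A: category A by fact
  note XY = A.hom_obj[OF uv(1)]
  have "Cmp A u (t X) = Cmp A v (t X)"
    using nat_iso_nat[OF t uv(1)] nat_iso_nat[OF t uv(2)] uv(3)
      hom_arr[OF uv(1)] hom_arr[OF uv(2)] by simp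
  moreover have "t X \<in> hom A (fo G (fo F X)) X" using nat_iso_hom[OF t XY(1)] XY by simp
  ultimately show ?thesis using A.iso_epic[OF nat_iso_iso[OF t XY(1)]] uv by blast
qed

text \<open>
  The isomorphism is the composite \<open>GF \<cong> G'FGF \<cong> G'F \<cong> 1\<close>.
\<close>

lemma left_inverse_of_right_inverse:
  assumes "category A" "category B" "is_functor A B F" "is_functor B A G" "is_functor B A G'"
    and a: "nat_iso A A (cmp_functor A G' F) (id_functor A) a"
    and b: "nat_iso B B (cmp_functor B F G) (id_functor B) b"
  shows "\<exists>t. nat_iso A A (cmp_functor A G F) (id_functor A) t"
proof
  interpret A: category A by fact
  interpret B: category B by fact
  \<comment> \<open>\<open>d\<close> enters \<open>G' F G F X\<close> by the inverse of
    \<open>a\<close> at \<open>G F X\<close>, \<open>c\<close> removes \<open>F G\<close> by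
    \<open>b\<close>, and \<open>a\<close> at \<open>X\<close> removes \<open>G' F\<close>.\<close>
  define c where "c X = fa G' (b (fo F X))" for X
  define d where "d X = inv_arr A (a (fo G (fo F X)))" for X
  define t where "t = (\<lambda>X \<in> Obj A. Cmp A (a X) (Cmp A (c X) (d X)))"
  have FX: "fo F X \<in> Obj B" and GFX: "fo G (fo F X) \<in> Obj A" if "X \<in> Obj A" for X
    using that functor_obj[OF assms(3)] functor_obj[OF assms(4)] by auto
  have a1: "a X \<in> hom A (fo G' (fo F X)) X" "iso_arr A (a X)" if "X \<in> Obj A" for X
    using nat_isoD(1,2)[OF a that] that by simp_all
  have b1: "b X \<in> hom B (fo F (fo G X)) X" "iso_arr B (b X)" if "X \<in> Obj B" for X
    using nat_isoD(1,2)[OF b that] that by simp_all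
  have c1: "c X \<in> hom A (fo G' (fo F (fo G (fo F X)))) (fo G' (fo F X))" "iso_arr A (c X)"
    if "X \<in> Obj A" for X
    unfolding c_def using functor_hom[OF assms(5) b1(1)] functor_iso[OF assms(2,1,5) b1] FX that
    by auto
  have d1: "d X \<in> hom A (fo G (fo F X)) (fo G' (fo F (fo G (fo F X))))" "iso_arr A (d X)"
    if "X \<in> Obj A" for X
    unfolding d_def using A.inv_hom A.iso_inv a1 GFX that by blast+
  have cd: "Cmp A (c X) (d X) \<in> hom A (fo G (fo F X)) (fo G' (fo F X))" "iso_arr A (Cmp A (c X) (d X))"
    if "X \<in> Obj A" for X
    using A.cmp_hom[OF d1(1) c1(1)] A.iso_cmp[OF d1(2,1) c1(2,1)] that by auto
  show "nat_iso A A (cmp_functor A G F) (id_functor A) t"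
  proof (rule nat_isoI)
    show "t X \<in> hom A (fo (cmp_functor A G F) X) (fo (id_functor A) X)" if "X \<in> Obj A" for X
      using that A.cmp_hom[OF cd(1) a1(1)] by (simp add: t_def)
    show "iso_arr A (t X)" if "X \<in> Obj A" for X
      using that A.iso_cmp[OF cd(2,1) a1(2,1)] by (simp add: t_def)
    fix f X Y assume f: "f \<in> hom A X Y"
    then have XY: "X \<in> Obj A" "Y \<in> Obj A" using A.hom_obj by auto
    define f1 where "f1 = fa G (fa F f)"
    define f2 where "f2 = fa G' (fa F f1)"
    define f3 where "f3 = fa G' (fa F f)"
    note Ff = functor_hom[OF assms(3) f]
    have f1: "f1 \<in> hom A (fo G (fo F X)) (fo G (fo F Y))"
      unfolding f1_def by (rule functor_hom[OF assms(4) Ff])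
    have f2: "f2 \<in> hom A (fo G' (fo F (fo G (fo F X)))) (fo G' (fo F (fo G (fo F Y))))"
      unfolding f2_def by (rule functor_hom[OF assms(5) functor_hom[OF assms(3) f1]])
    have f3: "f3 \<in> hom A (fo G' (fo F X)) (fo G' (fo F Y))"
      unfolding f3_def by (rule functor_hom[OF assms(5) Ff])
    have 1: "Cmp A (a Y) f3 = Cmp A f (a X)"
      using nat_iso_nat[OF a f] hom_arr[OF f] by (simp add: f3_def)
    have "Cmp B (b (fo F Y)) (fa F f1) = Cmp B (fa F f) (b (fo F X))"
      using nat_iso_nat[OF b Ff] hom_arr[OF Ff] by (simp add: f1_def)
    then have 2: "Cmp A (c Y) f2 = Cmp A f3 (c X)"
      using functor_cmp[OF assms(5) functor_hom[OF assms(3) f1] b1(1)[OF FX[OF XY(2)]]]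
        functor_cmp[OF assms(5) b1(1)[OF FX[OF XY(1)]] Ff]
      by (simp add: c_def f2_def f3_def)
    have "nat_iso A A (id_functor A) (cmp_functor A G' F) (\<lambda>X \<in> Obj A. inv_arr A (a X))"
      by (rule nat_iso_inverse[OF assms(1,1) cmp_is_functor id_is_functor a]) fact+
    from nat_iso_nat[OF this f1]
    have 3: "Cmp A (d Y) f1 = Cmp A f2 (d X)"
      using hom_arr[OF f1] GFX XY by (simp add: d_def f2_def)
    have "Cmp A (Cmp A (a Y) (Cmp A (c Y) (d Y))) f1 = Cmp A (a Y) (Cmp A (c Y) (Cmp A (d Y) f1))"
      using A.cmp_assoc[OF f1 cd(1)[OF XY(2)] a1(1)[OF XY(2)]]
        A.cmp_assoc[OF f1 d1(1)[OF XY(2)] c1(1)[OF XY(2)]] by simp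
    also have "\<dots> = Cmp A (a Y) (Cmp A f3 (Cmp A (c X) (d X)))"
      using 3 2 A.cmp_assoc[OF d1(1)[OF XY(1)] f2 c1(1)[OF XY(2)]]
        A.cmp_assoc[OF d1(1)[OF XY(1)] c1(1)[OF XY(1)] f3] by simp
    also have "\<dots> = Cmp A f (Cmp A (a X) (Cmp A (c X) (d X)))"
      using 1 A.cmp_assoc[OF cd(1)[OF XY(1)] f3 a1(1)[OF XY(2)]]
        A.cmp_assoc[OF cd(1)[OF XY(1)] a1(1)[OF XY(1)] f] by simp
    finally show "Cmp A (t Y) (fa (cmp_functor A G F) f) = Cmp A (fa (id_functor A) f) (t X)"
      using XY hom_arr[OF f] by (simp add: t_def f1_def)
  qed (simp add: t_def)
qed

text \<open>The preimage is \<open>G v\<close> conjugated by \<open>t\<close>. By construction it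
  satisfies \<open>G F u = G v\<close>, and the isomorphism \<open>b\<close> makes \<open>G\<close>
  faithful, which gives \<open>F u = v\<close>.\<close>

lemma full_of_inverse:
  assumes "category A" "category B" "is_functor A B F" "is_functor B A G"
    and t: "nat_iso A A (cmp_functor A G F) (id_functor A) t"
    and b: "nat_iso B B (cmp_functor B F G) (id_functor B) b"
    and XY: "X \<in> Obj A" "Y \<in> Obj A" and v: "v \<in> hom B (fo F X) (fo F Y)"
  shows "\<exists>u \<in> hom A X Y. fa F u = v"
proof
  interpret A: category A by fact
  have tX: "t X \<in> hom A (fo G (fo F X)) X" "iso_arr A (t X)" if "X \<in> Obj A" for X
    using nat_isoD(1,2)[OF t that] that by simp_all
  note Gv = functor_hom[OF assms(4) v] and t' = A.inv_hom[OF tX(2,1)]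
  note c = A.cmp_hom[OF Gv tX(1)[OF XY(2)]]
  define u where "u = Cmp A (Cmp A (t Y) (fa G v)) (inv_arr A (t X))"
  show u: "u \<in> hom A X Y" unfolding u_def by (rule A.cmp_hom[OF t'[OF XY(1,1)] c])
  have "Cmp A (t Y) (fa G (fa F u)) = Cmp A u (t X)"
    using nat_iso_nat[OF t u] hom_arr[OF u] by simp
  also have "\<dots> = Cmp A (t Y) (fa G v)"
    unfolding u_def by (rule A.cancel_right'[OF tX(2,1)[OF XY(1)] c])
  finally have "fa G (fa F u) = fa G v"
    by (rule A.iso_monic[OF tX(2)[OF XY(2)] tX(1)[OF XY(2)]
          functor_hom[OF assms(4) functor_hom[OF assms(3) u]] Gv])
  with faithful_of_left_inverse[OF assms(2,1,4,3) b functor_hom[OF assms(3) u] v]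
  show "fa F u = v" by blast
qed

section \<open>Symmetric monoidal structures from unbiased products\<close>

text \<open>
  A family \<open>x\<close> is a tuple of objects indexed by \<open>ix x\<close>; \<open>N x S\<close> is the product of its members in
  \<open>S\<close>. The maps \<open>m\<close> and \<open>e\<close> compare binary products and the unit with these unbiased products.
\<close>

locale tensor_families = category C
  for C :: "('o, 'a, 'm) cat_scheme" +
  fixes tO :: "'o \<Rightarrow> 'o \<Rightarrow> 'o" and tA :: "'a \<Rightarrow> 'a \<Rightarrow> 'a" and U :: 'o
    and Fam :: "'f set" and ix :: "'f \<Rightarrow> nat set"
    and N :: "'f \<Rightarrow> nat set \<Rightarrow> 'o" and m :: "'f \<Rightarrow> nat set \<Rightarrow> nat set \<Rightarrow> 'a" and e :: "'f \<Rightarrow> 'a"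
  assumes tO_obj: "X \<in> Obj C \<Longrightarrow> Y \<in> Obj C \<Longrightarrow> tO X Y \<in> Obj C"
    and tA_hom: "f \<in> hom C X X' \<Longrightarrow> g \<in> hom C Y Y' \<Longrightarrow> tA f g \<in> hom C (tO X Y) (tO X' Y')"
    and tA_idn: "X \<in> Obj C \<Longrightarrow> Y \<in> Obj C \<Longrightarrow> tA (Idn C X) (Idn C Y) = Idn C (tO X Y)"
    and tA_cmp: "f \<in> hom C X X' \<Longrightarrow> f' \<in> hom C X' X'' \<Longrightarrow> g \<in> hom C Y Y' \<Longrightarrow> g' \<in> hom C Y' Y'' \<Longrightarrow>
      tA (Cmp C f' f) (Cmp C g' g) = Cmp C (tA f' g') (tA f g)"
    and U_obj: "U \<in> Obj C"
    and N_obj: "x \<in> Fam \<Longrightarrow> S \<subseteq> ix x \<Longrightarrow> N x S \<in> Obj C"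
    and m_hom: "x \<in> Fam \<Longrightarrow> S \<subseteq> ix x \<Longrightarrow> S' \<subseteq> ix x \<Longrightarrow> S \<inter> S' = {} \<Longrightarrow>
      m x S S' \<in> hom C (tO (N x S) (N x S')) (N x (S \<union> S'))"
    and m_iso: "x \<in> Fam \<Longrightarrow> S \<subseteq> ix x \<Longrightarrow> S' \<subseteq> ix x \<Longrightarrow> S \<inter> S' = {} \<Longrightarrow> iso_arr C (m x S S')"
    and e_hom: "x \<in> Fam \<Longrightarrow> e x \<in> hom C U (N x {})"
    and e_iso: "x \<in> Fam \<Longrightarrow> iso_arr C (e x)"
    and realize: "finite J \<Longrightarrow> (\<And>j. j \<in> J \<Longrightarrow> V j \<in> Obj C) \<Longrightarrow>
      \<exists>y \<in> Fam. ix y = J \<and> (\<exists>v. \<forall>j \<in> J. v j \<in> hom C (V j) (N y {j}) \<and> iso_arr C (v j))"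
    and extend: "x \<in> Fam \<Longrightarrow> y \<in> Fam \<Longrightarrow> (\<And>j. j \<in> ix y \<Longrightarrow> Q j \<subseteq> ix x) \<Longrightarrow>
      (\<And>i j. i \<in> ix y \<Longrightarrow> j \<in> ix y \<Longrightarrow> i \<noteq> j \<Longrightarrow> Q i \<inter> Q j = {}) \<Longrightarrow>
      (\<And>j. j \<in> ix y \<Longrightarrow> h j \<in> hom C (N y {j}) (N x (Q j))) \<Longrightarrow>
      \<exists>h'. (\<forall>T \<subseteq> ix y. h' T \<in> hom C (N y T) (N x (\<Union>j \<in> T. Q j))) \<and>
        (\<forall>j \<in> ix y. h' {j} = h j) \<and>
        (\<forall>T \<subseteq> ix y. \<forall>T' \<subseteq> ix y. T \<inter> T' = {} \<longrightarrow>
           Cmp C (h' (T \<union> T')) (m y T T') =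
           Cmp C (m x (\<Union>j \<in> T. Q j) (\<Union>j \<in> T'. Q j)) (tA (h' T) (h' T'))) \<and>
        Cmp C (h' {}) (e y) = e x"
begin

section \<open>Maps into unbiased products\<close>

lemma tA_iso:
  assumes "f \<in> hom C X X'" "iso_arr C f" "g \<in> hom C Y Y'" "iso_arr C g"
  shows "iso_arr C (tA f g)"
proof (rule isoI)
  note f' = inv_hom[OF assms(2,1)] and g' = inv_hom[OF assms(4,3)]
  show "tA f g \<in> hom C (tO X Y) (tO X' Y')" using tA_hom assms by blast
  show "tA (inv_arr C f) (inv_arr C g) \<in> hom C (tO X' Y') (tO X Y)" using tA_hom f' g' by blast
  show "Cmp C (tA (inv_arr C f) (inv_arr C g)) (tA f g) = Idn C (tO X Y)"
    using tA_cmp[OF assms(1) f' assms(3) g'] inv_left[OF assms(2,1)] inv_left[OF assms(4,3)]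
      tA_idn hom_obj[OF assms(1)] hom_obj[OF assms(3)] by simp
  show "Cmp C (tA f g) (tA (inv_arr C f) (inv_arr C g)) = Idn C (tO X' Y')"
    using tA_cmp[OF f' assms(1) g' assms(3)] inv_right[OF assms(2,1)] inv_right[OF assms(4,3)]
      tA_idn hom_obj[OF assms(1)] hom_obj[OF assms(3)] by simp
qed

text \<open>Maps into members stand in for members: the sources of \<open>f\<close> and
  \<open>g\<close> are arbitrary objects, in the application only isomorphic to products of members.
  Iterated binary products become nested \<open>pr\<close> terms.\<close>

definition pr :: "'f \<Rightarrow> nat set \<Rightarrow> nat set \<Rightarrow> 'a \<Rightarrow> 'a \<Rightarrow> 'a" where
  "pr x S S' f g = Cmp C (m x S S') (tA f g)"

lemma pr_hom:
  assumes "x \<in> Fam" "S \<subseteq> ix x" "S' \<subseteq> ix x" "S \<inter> S' = {}" "f \<in> hom C X (N x S)" "g \<in> hom C Y (N x S')"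
  shows "pr x S S' f g \<in> hom C (tO X Y) (N x (S \<union> S'))"
  unfolding pr_def by (rule cmp_hom[OF tA_hom[OF assms(5,6)] m_hom[OF assms(1-4)]])

lemma pr_iso:
  assumes "x \<in> Fam" "S \<subseteq> ix x" "S' \<subseteq> ix x" "S \<inter> S' = {}" "f \<in> hom C X (N x S)" "g \<in> hom C Y (N x S')"
    "iso_arr C f" "iso_arr C g"
  shows "iso_arr C (pr x S S' f g)"
  unfolding pr_def
  by (rule iso_cmp[OF tA_iso[OF assms(5,7,6,8)] tA_hom[OF assms(5,6)] m_iso[OF assms(1-4)]
        m_hom[OF assms(1-4)]])

lemma pr_cmp:
  assumes "x \<in> Fam" "S \<subseteq> ix x" "S' \<subseteq> ix x" "S \<inter> S' = {}" "f \<in> hom C X (N x S)" "g \<in> hom C Y (N x S')"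
    "p \<in> hom C X' X" "q \<in> hom C Y' Y"
  shows "Cmp C (pr x S S' f g) (tA p q) = pr x S S' (Cmp C f p) (Cmp C g q)"
  unfolding pr_def
  using cmp_assoc[OF tA_hom[OF assms(7,8)] tA_hom[OF assms(5,6)] m_hom[OF assms(1-4)]]
    tA_cmp[OF assms(7,5,8,6)] by simp

lemma pr_idn:
  assumes "x \<in> Fam" "S \<subseteq> ix x" "S' \<subseteq> ix x" "S \<inter> S' = {}"
  shows "pr x S S' (Idn C (N x S)) (Idn C (N x S')) = m x S S'"
  unfolding pr_def using tA_idn N_obj assms idn_right[OF m_hom[OF assms]] by simp

text \<open>Composing with the inverses of the isomorphisms \<open>v\<close> turns maps out of the
  \<open>X j\<close> into maps out of the members of \<open>y\<close>, to which
  \<open>extend\<close> applies. The resulting \<open>h'\<close> carries a \<open>pr\<close> term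
  over \<open>y\<close> to the \<open>pr\<close> term over \<open>x\<close> with the same
  bracketing, so an identity checked on \<open>y\<close> transfers to \<open>x\<close>.\<close>

lemma extend_pr:
  assumes x: "x \<in> Fam" and y: "y \<in> Fam" "ix y = J"
    and v: "\<And>j. j \<in> J \<Longrightarrow> v j \<in> hom C (X j) (N y {j})" "\<And>j. j \<in> J \<Longrightarrow> iso_arr C (v j)"
    and S: "\<And>j. j \<in> J \<Longrightarrow> S j \<subseteq> ix x"
      "\<And>i j. i \<in> J \<Longrightarrow> j \<in> J \<Longrightarrow> i \<noteq> j \<Longrightarrow> S i \<inter> S j = {}"
    and h: "\<And>j. j \<in> J \<Longrightarrow> h j \<in> hom C (X j) (N x (S j))"
  obtains h' where "\<And>T. T \<subseteq> J \<Longrightarrow> h' T \<in> hom C (N y T) (N x (\<Union>j \<in> T. S j))"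
    "\<And>j. j \<in> J \<Longrightarrow> Cmp C (h' {j}) (v j) = h j"
    "\<And>T T' X Y f g. T \<subseteq> J \<Longrightarrow> T' \<subseteq> J \<Longrightarrow> T \<inter> T' = {} \<Longrightarrow> f \<in> hom C X (N y T) \<Longrightarrow> g \<in> hom C Y (N y T') \<Longrightarrow>
       Cmp C (h' (T \<union> T')) (pr y T T' f g) =
       pr x (\<Union>j \<in> T. S j) (\<Union>j \<in> T'. S j) (Cmp C (h' T) f) (Cmp C (h' T') g)"
    "Cmp C (h' {}) (e y) = e x"
proof -
  have "Cmp C (h j) (inv_arr C (v j)) \<in> hom C (N y {j}) (N x (S j))" if "j \<in> ix y" for j
    using that y cmp_hom[OF inv_hom[OF v(2,1)] h] by simp
  from extend[OF x y(1), of S "\<lambda>j. Cmp C (h j) (inv_arr C (v j))", OF _ _ this]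
  obtain h' where h': "\<forall>T \<subseteq> J. h' T \<in> hom C (N y T) (N x (\<Union>j \<in> T. S j))"
      "\<forall>j \<in> J. h' {j} = Cmp C (h j) (inv_arr C (v j))"
      "\<forall>T \<subseteq> J. \<forall>T' \<subseteq> J. T \<inter> T' = {} \<longrightarrow> Cmp C (h' (T \<union> T')) (m y T T') =
           Cmp C (m x (\<Union>j \<in> T. S j) (\<Union>j \<in> T'. S j)) (tA (h' T) (h' T'))"
    and h4: "Cmp C (h' {}) (e y) = e x"
    using S unfolding y(2) by blast
  note h1 = h'(1)[rule_format] and h2 = h'(2)[rule_format] and h3 = h'(3)[rule_format]
  have sub: "(\<Union>j \<in> T. S j) \<subseteq> ix x" if "T \<subseteq> J" for T using S that by blast
  have dis: "(\<Union>j \<in> T. S j) \<inter> (\<Union>j \<in> T'. S j) = {}" if "T \<subseteq> J" "T' \<subseteq> J" "T \<inter> T' = {}" for T T'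
    using S(2) that by blast
  show thesis
  proof (rule that[OF h1])
    show "Cmp C (h' {j}) (v j) = h j" if "j \<in> J" for j
      using that h2 cancel_right'[OF v(2,1) h] by simp
    fix T T' X Y f g
    assume T: "T \<subseteq> J" "T' \<subseteq> J" "T \<inter> T' = {}" and f: "f \<in> hom C X (N y T)" and g: "g \<in> hom C Y (N y T')"
    have Ty: "T \<subseteq> ix y" "T' \<subseteq> ix y" using T y by auto
    note TT = h1[OF Un_least[OF T(1,2)]]
    have "Cmp C (h' (T \<union> T')) (pr y T T' f g) = Cmp C (Cmp C (h' (T \<union> T')) (m y T T')) (tA f g)"
      unfolding pr_def by (rule cmp_assoc[OF tA_hom[OF f g] m_hom[OF y(1) Ty T(3)] TT])
    also have "\<dots> = Cmp C (m x (\<Union>j \<in> T. S j) (\<Union>j \<in> T'. S j)) (Cmp C (tA (h' T) (h' T')) (tA f g))"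
      using h3[OF T] cmp_assoc[OF tA_hom[OF f g] tA_hom[OF h1[OF T(1)] h1[OF T(2)]]
          m_hom[OF x sub[OF T(1)] sub[OF T(2)] dis[OF T]]] by simp
    finally show "Cmp C (h' (T \<union> T')) (pr y T T' f g) =
       pr x (\<Union>j \<in> T. S j) (\<Union>j \<in> T'. S j) (Cmp C (h' T) f) (Cmp C (h' T') g)"
      using tA_cmp[OF f h1[OF T(1)] g h1[OF T(2)]] by (simp add: pr_def)
  qed (use h4 in auto)
qed

text \<open>The condition ranges over all families, index sets and maps at once. One realizing
  family already determines \<open>a\<close>, since the \<open>pr\<close> terms there are
  invertible; the other instances are what the coherence proofs use.\<close>

definition is_assoc :: "'o \<Rightarrow> 'o \<Rightarrow> 'o \<Rightarrow> 'a \<Rightarrow> bool" where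
  "is_assoc X Y Z a \<longleftrightarrow> a \<in> hom C (tO (tO X Y) Z) (tO X (tO Y Z)) \<and> iso_arr C a \<and>
     (\<forall>x R S T f g h. x \<in> Fam \<and> R \<subseteq> ix x \<and> S \<subseteq> ix x \<and> T \<subseteq> ix x \<and> R \<inter> S = {} \<and> R \<inter> T = {} \<and> S \<inter> T = {} \<and>
        f \<in> hom C X (N x R) \<and> g \<in> hom C Y (N x S) \<and> h \<in> hom C Z (N x T) \<longrightarrow>
        Cmp C (pr x R (S \<union> T) f (pr x S T g h)) a = pr x (R \<union> S) T (pr x R S f g) h)"

definition is_braid :: "'o \<Rightarrow> 'o \<Rightarrow> 'a \<Rightarrow> bool" where
  "is_braid X Y b \<longleftrightarrow> b \<in> hom C (tO X Y) (tO Y X) \<and> iso_arr C b \<and>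
     (\<forall>x R S f g. x \<in> Fam \<and> R \<subseteq> ix x \<and> S \<subseteq> ix x \<and> R \<inter> S = {} \<and>
        f \<in> hom C X (N x R) \<and> g \<in> hom C Y (N x S) \<longrightarrow>
        Cmp C (pr x S R g f) b = pr x R S f g)"

definition is_lunit :: "'o \<Rightarrow> 'a \<Rightarrow> bool" where
  "is_lunit X l \<longleftrightarrow> l \<in> hom C (tO U X) X \<and> iso_arr C l \<and>
     (\<forall>x S f. x \<in> Fam \<and> S \<subseteq> ix x \<and> f \<in> hom C X (N x S) \<longrightarrow> pr x {} S (e x) f = Cmp C f l)"

definition is_runit :: "'o \<Rightarrow> 'a \<Rightarrow> bool" where
  "is_runit X r \<longleftrightarrow> r \<in> hom C (tO X U) X \<and> iso_arr C r \<and>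
     (\<forall>x S f. x \<in> Fam \<and> S \<subseteq> ix x \<and> f \<in> hom C X (N x S) \<longrightarrow> pr x S {} f (e x) = Cmp C f r)"

section \<open>Existence of the constraint maps\<close>

lemma solve_left:
  assumes "iso_arr C k" "k \<in> hom C Y Z" "iso_arr C l" "l \<in> hom C X Z"
  shows "Cmp C (inv_arr C k) l \<in> hom C X Y" "iso_arr C (Cmp C (inv_arr C k) l)"
    "Cmp C k (Cmp C (inv_arr C k) l) = l"
  using cmp_hom[OF assms(4) inv_hom[OF assms(1,2)]]
    iso_cmp[OF assms(3,4) iso_inv[OF assms(1,2)] inv_hom[OF assms(1,2)]]
    cancel_left'[OF assms(1,2,4)] by auto

lemma realize2:
  assumes "X \<in> Obj C" "Y \<in> Obj C"
  obtains y and v :: "nat \<Rightarrow> 'a" where "y \<in> Fam" "ix y = {1, 2}" "v 1 \<in> hom C X (N y {1})" "iso_arr C (v 1)"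
    "v 2 \<in> hom C Y (N y {2})" "iso_arr C (v 2)"
proof -
  let ?V = "\<lambda>j. if j = 1 then X else Y"
  have "\<exists>y \<in> Fam. ix y = {1, 2} \<and>
      (\<exists>v. \<forall>j \<in> {1, 2}. v j \<in> hom C (?V j) (N y {j}) \<and> iso_arr C (v j))"
    by (rule realize) (use assms in auto)
  then show ?thesis using that by (auto simp del: One_nat_def)
qed

lemma realize3:
  assumes "X \<in> Obj C" "Y \<in> Obj C" "Z \<in> Obj C"
  obtains y and v :: "nat \<Rightarrow> 'a" where "y \<in> Fam" "ix y = {1, 2, 3}" "v 1 \<in> hom C X (N y {1})" "iso_arr C (v 1)"
    "v 2 \<in> hom C Y (N y {2})" "iso_arr C (v 2)" "v 3 \<in> hom C Z (N y {3})" "iso_arr C (v 3)"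
proof -
  let ?V = "\<lambda>j. if j = 1 then X else if j = 2 then Y else Z"
  have "\<exists>y \<in> Fam. ix y = {1, 2, 3} \<and>
      (\<exists>v. \<forall>j \<in> {1, 2, 3}. v j \<in> hom C (?V j) (N y {j}) \<and> iso_arr C (v j))"
    by (rule realize) (use assms in auto)
  then show ?thesis using that by (auto simp del: One_nat_def)
qed

lemma realize4:
  assumes "W \<in> Obj C" "X \<in> Obj C" "Y \<in> Obj C" "Z \<in> Obj C"
  obtains y and v :: "nat \<Rightarrow> 'a" where "y \<in> Fam" "ix y = {0, 1, 2, 3}" "v 0 \<in> hom C W (N y {0})" "iso_arr C (v 0)"
    "v 1 \<in> hom C X (N y {1})" "iso_arr C (v 1)"
    "v 2 \<in> hom C Y (N y {2})" "iso_arr C (v 2)" "v 3 \<in> hom C Z (N y {3})" "iso_arr C (v 3)"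
proof -
  let ?V = "\<lambda>j. if j = 0 then W else if j = 1 then X else if j = 2 then Y else Z"
  have "\<exists>y \<in> Fam. ix y = {0, 1, 2, 3} \<and>
      (\<exists>v. \<forall>j \<in> {0, 1, 2, 3}. v j \<in> hom C (?V j) (N y {j}) \<and> iso_arr C (v j))"
    by (rule realize) (use assms in auto)
  then show ?thesis using that by (auto simp del: One_nat_def)
qed

text \<open>On one family \<open>y\<close> realizing the three objects, \<open>k\<close> and
  \<open>l\<close> are the two bracketings as isomorphisms onto the same
  \<open>N y {1, 2, 3}\<close>, and \<open>a\<close> solves \<open>k a = l\<close>. Any other family
  receives a comparison \<open>h'\<close> from \<open>y\<close>; applying \<open>h'\<close> to this
  equation gives the required one.\<close>

lemma assoc_exists:
  assumes XYZ: "X \<in> Obj C" "Y \<in> Obj C" "Z \<in> Obj C"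
  shows "\<exists>a. is_assoc X Y Z a"
proof -
  obtain y and v :: "nat \<Rightarrow> 'a" where y: "y \<in> Fam" "ix y = {1, 2, 3}"
    and v1: "v 1 \<in> hom C X (N y {1})" "iso_arr C (v 1)"
    and v2: "v 2 \<in> hom C Y (N y {2})" "iso_arr C (v 2)"
    and v3: "v 3 \<in> hom C Z (N y {3})" "iso_arr C (v 3)"
    using realize3[OF XYZ] .
  define q where "q = pr y {1} {2} (v 1) (v 2)"
  define r where "r = pr y {2} {3} (v 2) (v 3)"
  define k where "k = pr y {1} {2, 3} (v 1) r"
  define l where "l = pr y {1, 2} {3} q (v 3)"
  have q: "q \<in> hom C (tO X Y) (N y {1, 2})" "iso_arr C q"
    using pr_hom[of y "{1}" "{2}", OF y(1) _ _ _ v1(1) v2(1)] 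
      pr_iso[of y "{1}" "{2}", OF y(1) _ _ _ v1(1) v2(1) v1(2) v2(2)] y by (auto simp: q_def insert_commute)
  have r: "r \<in> hom C (tO Y Z) (N y {2, 3})" "iso_arr C r"
    using pr_hom[of y "{2}" "{3}", OF y(1) _ _ _ v2(1) v3(1)] 
      pr_iso[of y "{2}" "{3}", OF y(1) _ _ _ v2(1) v3(1) v2(2) v3(2)] y by (auto simp: r_def insert_commute)
  have k: "k \<in> hom C (tO X (tO Y Z)) (N y {1, 2, 3})" "iso_arr C k"
    using pr_hom[of y "{1}" "{2, 3}", OF y(1) _ _ _ v1(1) r(1)] 
      pr_iso[of y "{1}" "{2, 3}", OF y(1) _ _ _ v1(1) r(1) v1(2) r(2)] y by (auto simp: k_def insert_commute)
  have l: "l \<in> hom C (tO (tO X Y) Z) (N y {1, 2, 3})" "iso_arr C l"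
    using pr_hom[of y "{1, 2}" "{3}", OF y(1) _ _ _ q(1) v3(1)] 
      pr_iso[of y "{1, 2}" "{3}", OF y(1) _ _ _ q(1) v3(1) q(2) v3(2)] y
    by (auto simp: l_def insert_commute)
  define a where "a = Cmp C (inv_arr C k) l"
  note a = solve_left[OF k(2,1) l(2,1), folded a_def]
  have "Cmp C (pr x R (S \<union> T) f (pr x S T g h)) a = pr x (R \<union> S) T (pr x R S f g) h"
    if x: "x \<in> Fam" and R: "R \<subseteq> ix x" and S: "S \<subseteq> ix x" and T: "T \<subseteq> ix x"
      and RS: "R \<inter> S = {}" and RT: "R \<inter> T = {}" and ST: "S \<inter> T = {}"
      and f: "f \<in> hom C X (N x R)" and g: "g \<in> hom C Y (N x S)" and h: "h \<in> hom C Z (N x T)"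
    for x R S T f g h
  proof -
    \<comment> \<open>\<open>Q\<close> sends the three indices of \<open>y\<close> to the three
      disjoint subsets of \<open>ix x\<close>, so \<open>h' {1, 2, 3}\<close> lands in the product
      over their union; \<open>w\<close> lists the prescribed maps and \<open>V\<close> their
      sources.\<close>
    define Q where "Q j = (if j = 1 then R else if j = 2 then S else T)" for j :: nat
    define w where "w j = (if j = 1 then f else if j = 2 then g else h)" for j :: nat
    define V where "V j = (if j = 1 then X else if j = 2 then Y else Z)" for j :: nat
    obtain h' where
      h1: "\<And>T. T \<subseteq> {1, 2, 3} \<Longrightarrow> h' T \<in> hom C (N y T) (N x (\<Union>j \<in> T. Q j))"
      and h2: "\<And>j. j \<in> {1, 2, 3} \<Longrightarrow> Cmp C (h' {j}) (v j) = w j"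
      and h3: "\<And>T T' X Y f g. T \<subseteq> {1, 2, 3} \<Longrightarrow> T' \<subseteq> {1, 2, 3} \<Longrightarrow> T \<inter> T' = {} \<Longrightarrow>
         f \<in> hom C X (N y T) \<Longrightarrow> g \<in> hom C Y (N y T') \<Longrightarrow>
         Cmp C (h' (T \<union> T')) (pr y T T' f g) =
         pr x (\<Union>j \<in> T. Q j) (\<Union>j \<in> T'. Q j) (Cmp C (h' T) f) (Cmp C (h' T') g)"
      by (rule extend_pr[OF x y, of v V Q w])
        (use R S T RS RT ST f g h v1 v2 v3 in \<open>auto simp: Q_def w_def V_def\<close>)
    have "h' {1, 2, 3} \<in> hom C (N y {1, 2, 3}) (N x (R \<union> (S \<union> T)))"
      using h1[of "{1, 2, 3}"] by (simp add: Q_def Un_ac)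
    then have "Cmp C (Cmp C (h' {1, 2, 3}) k) a = Cmp C (h' {1, 2, 3}) l"
      using cmp_assoc[OF a(1) k(1)] a(3) by metis
    moreover have "Cmp C (h' {1, 2, 3}) k = pr x R (S \<union> T) f (pr x S T g h)"
      using h3[of "{1}" "{2, 3}", OF _ _ _ v1(1) r(1)] h3[of "{2}" "{3}", OF _ _ _ v2(1) v3(1)]
        h2[of 1] h2[of 2] h2[of 3]
      by (simp add: k_def r_def Q_def w_def insert_commute Un_ac)
    moreover have "Cmp C (h' {1, 2, 3}) l = pr x (R \<union> S) T (pr x R S f g) h"
      using h3[of "{1, 2}" "{3}", OF _ _ _ q(1) v3(1)] h3[of "{1}" "{2}", OF _ _ _ v1(1) v2(1)]
        h2[of 1] h2[of 2] h2[of 3]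
      by (simp add: l_def q_def Q_def w_def insert_commute Un_ac)
    ultimately show ?thesis by simp
  qed
  then show ?thesis using a(1,2) unfolding is_assoc_def by blast
qed

text \<open>Unbiased products are indexed by sets, and
  \<open>{1} \<union> {2} = {2} \<union> {1}\<close>: both orders of multiplication have the same
  target, and the braiding is the comparison between them.\<close>

lemma braid_exists:
  assumes XY: "X \<in> Obj C" "Y \<in> Obj C"
  shows "\<exists>b. is_braid X Y b"
proof -
  obtain y and v :: "nat \<Rightarrow> 'a" where y: "y \<in> Fam" "ix y = {1, 2}"
    and v1: "v 1 \<in> hom C X (N y {1})" "iso_arr C (v 1)"
    and v2: "v 2 \<in> hom C Y (N y {2})" "iso_arr C (v 2)"
    using realize2[OF XY] .
  define k where "k = pr y {2} {1} (v 2) (v 1)"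
  define l where "l = pr y {1} {2} (v 1) (v 2)"
  have k: "k \<in> hom C (tO Y X) (N y {1, 2})" "iso_arr C k"
    using pr_hom[of y "{2}" "{1}", OF y(1) _ _ _ v2(1) v1(1)] 
      pr_iso[of y "{2}" "{1}", OF y(1) _ _ _ v2(1) v1(1) v2(2) v1(2)] y by (auto simp: k_def insert_commute)
  have l: "l \<in> hom C (tO X Y) (N y {1, 2})" "iso_arr C l"
    using pr_hom[of y "{1}" "{2}", OF y(1) _ _ _ v1(1) v2(1)] 
      pr_iso[of y "{1}" "{2}", OF y(1) _ _ _ v1(1) v2(1) v1(2) v2(2)] y
    by (auto simp: l_def insert_commute)
  define b where "b = Cmp C (inv_arr C k) l"
  note b = solve_left[OF k(2,1) l(2,1), folded b_def]
  have "Cmp C (pr x S R g f) b = pr x R S f g"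
    if x: "x \<in> Fam" and R: "R \<subseteq> ix x" and S: "S \<subseteq> ix x" and RS: "R \<inter> S = {}"
      and f: "f \<in> hom C X (N x R)" and g: "g \<in> hom C Y (N x S)"
    for x R S f g
  proof -
    define Q where "Q j = (if j = 1 then R else S)" for j :: nat
    define w where "w j = (if j = 1 then f else g)" for j :: nat
    define V where "V j = (if j = 1 then X else Y)" for j :: nat
    obtain h' where
      h1: "\<And>T. T \<subseteq> {1, 2} \<Longrightarrow> h' T \<in> hom C (N y T) (N x (\<Union>j \<in> T. Q j))"
      and h2: "\<And>j. j \<in> {1, 2} \<Longrightarrow> Cmp C (h' {j}) (v j) = w j"
      and h3: "\<And>T T' X Y f g. T \<subseteq> {1, 2} \<Longrightarrow> T' \<subseteq> {1, 2} \<Longrightarrow> T \<inter> T' = {} \<Longrightarrow>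
         f \<in> hom C X (N y T) \<Longrightarrow> g \<in> hom C Y (N y T') \<Longrightarrow>
         Cmp C (h' (T \<union> T')) (pr y T T' f g) =
         pr x (\<Union>j \<in> T. Q j) (\<Union>j \<in> T'. Q j) (Cmp C (h' T) f) (Cmp C (h' T') g)"
      by (rule extend_pr[OF x y, of v V Q w])
        (use R S RS f g v1 v2 in \<open>auto simp: Q_def w_def V_def\<close>)
    have "h' {1, 2} \<in> hom C (N y {1, 2}) (N x (R \<union> S))"
      using h1[of "{1, 2}"] by (simp add: Q_def Un_ac)
    then have "Cmp C (Cmp C (h' {1, 2}) k) b = Cmp C (h' {1, 2}) l"
      using cmp_assoc[OF b(1) k(1)] b(3) by metis
    moreover have "Cmp C (h' {1, 2}) k = pr x S R g f"
      using h3[of "{2}" "{1}", OF _ _ _ v2(1) v1(1)] h2[of 1] h2[of 2]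
      by (simp add: k_def Q_def w_def insert_commute Un_ac)
    moreover have "Cmp C (h' {1, 2}) l = pr x R S f g"
      using h3[of "{1}" "{2}", OF _ _ _ v1(1) v2(1)] h2[of 1] h2[of 2]
      by (simp add: l_def Q_def w_def insert_commute Un_ac)
    ultimately show ?thesis by simp
  qed
  then show ?thesis using b(1,2) unfolding is_braid_def by blast
qed

text \<open>Because \<open>{} \<union> {1} = {1}\<close>, multiplying \<open>e y\<close> with
  \<open>v 1\<close> gives an isomorphism onto the same object as \<open>v 1\<close> itself, and
  comparing the two gives the unitors. The clause of \<open>extend\<close> about \<open>e\<close>
  makes them valid for every family.\<close>

lemma unit_exists:
  assumes X: "X \<in> Obj C"
  shows "\<exists>l. is_lunit X l" "\<exists>r. is_runit X r"
proof -
  obtain y and v :: "nat \<Rightarrow> 'a" where y: "y \<in> Fam" "ix y = {1}"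
    and v: "v 1 \<in> hom C X (N y {1})" "iso_arr C (v 1)"
    using realize[of "{1}" "\<lambda>_. X"] X by auto
  note e = e_hom[OF y(1)] e_iso[OF y(1)]
  define k where "k = pr y {} {1} (e y) (v 1)"
  define k' where "k' = pr y {1} {} (v 1) (e y)"
  have k: "k \<in> hom C (tO U X) (N y {1})" "iso_arr C k"
    using pr_hom[of y "{}" "{1}", OF y(1) _ _ _ e(1) v(1)] 
      pr_iso[of y "{}" "{1}", OF y(1) _ _ _ e(1) v(1) e(2) v(2)] y by (auto simp: k_def insert_commute)
  have k': "k' \<in> hom C (tO X U) (N y {1})" "iso_arr C k'"
    using pr_hom[of y "{1}" "{}", OF y(1) _ _ _ v(1) e(1)] 
      pr_iso[of y "{1}" "{}", OF y(1) _ _ _ v(1) e(1) v(2) e(2)] y by (auto simp: k'_def)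
  define l where "l = Cmp C (inv_arr C (v 1)) k"
  define r where "r = Cmp C (inv_arr C (v 1)) k'"
  note l = solve_left[OF v(2,1) k(2,1), folded l_def]
  note r = solve_left[OF v(2,1) k'(2,1), folded r_def]
  have "pr x {} S (e x) f = Cmp C f l \<and> pr x S {} f (e x) = Cmp C f r"
    if x: "x \<in> Fam" and S: "S \<subseteq> ix x" and f: "f \<in> hom C X (N x S)" for x S f
  proof -
    obtain h' where
      h1: "\<And>T. T \<subseteq> {1} \<Longrightarrow> h' T \<in> hom C (N y T) (N x (\<Union>j \<in> T. S))"
      and h2: "\<And>j. j \<in> {1} \<Longrightarrow> Cmp C (h' {j}) (v j) = f"
      and h3: "\<And>T T' X Y f g. T \<subseteq> {1} \<Longrightarrow> T' \<subseteq> {1} \<Longrightarrow> T \<inter> T' = {} \<Longrightarrow>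
         f \<in> hom C X (N y T) \<Longrightarrow> g \<in> hom C Y (N y T') \<Longrightarrow>
         Cmp C (h' (T \<union> T')) (pr y T T' f g) =
         pr x (\<Union>j \<in> T. S) (\<Union>j \<in> T'. S) (Cmp C (h' T) f) (Cmp C (h' T') g)"
      and h4: "Cmp C (h' {}) (e y) = e x"
      by (rule extend_pr[OF x y, of v "\<lambda>_. X" "\<lambda>_. S" "\<lambda>_. f"]) (use S f v in auto)
    have h: "h' {1} \<in> hom C (N y {1}) (N x S)" using h1[of "{1}"] by simp
    have "Cmp C (h' {1}) k = Cmp C f l" "Cmp C (h' {1}) k' = Cmp C f r"
      using cmp_assoc[OF l(1) v(1) h] cmp_assoc[OF r(1) v(1) h] l(3) r(3) h2[of 1] by simp_all
    moreover have "Cmp C (h' {1}) k = pr x {} S (e x) f"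
      using h3[of "{}" "{1}", OF _ _ _ e(1) v(1)] h2[of 1] h4 by (simp add: k_def)
    moreover have "Cmp C (h' {1}) k' = pr x S {} f (e x)"
      using h3[of "{1}" "{}", OF _ _ _ v(1) e(1)] h2[of 1] h4 by (simp add: k'_def)
    ultimately show ?thesis by simp
  qed
  then show "\<exists>l. is_lunit X l" "\<exists>r. is_runit X r"
    using l(1,2) r(1,2) unfolding is_lunit_def is_runit_def by blast+
qed

section \<open>Assembling the symmetric monoidal structure\<close>

definition monoidal :: "('o, 'a) monoidal_data" where
  "monoidal = \<lparr>tenO = tO, tenA = tA, unit_ob = U,
     assoc = (\<lambda>X Y Z. SOME a. is_assoc X Y Z a),
     lunit = (\<lambda>X. SOME l. is_lunit X l), runit = (\<lambda>X. SOME r. is_runit X r),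
     braid = (\<lambda>X Y. SOME b. is_braid X Y b)\<rparr>"

lemma monoidal_simps [simp]:
  "tenO monoidal = tO" "tenA monoidal = tA" "unit_ob monoidal = U"
  by (simp_all add: monoidal_def)

lemma monoidal_assoc:
  assumes "X \<in> Obj C" "Y \<in> Obj C" "Z \<in> Obj C"
  shows assoc_hom: "assoc monoidal X Y Z \<in> hom C (tO (tO X Y) Z) (tO X (tO Y Z))"
    and iso_assoc: "iso_arr C (assoc monoidal X Y Z)"
  using someI_ex[OF assoc_exists[OF assms]] by (simp_all add: monoidal_def is_assoc_def)

lemma pr_assoc:
  assumes "x \<in> Fam" "R \<subseteq> ix x" "S \<subseteq> ix x" "T \<subseteq> ix x" "R \<inter> S = {}" "R \<inter> T = {}" "S \<inter> T = {}"
    "f \<in> hom C X (N x R)" "g \<in> hom C Y (N x S)" "h \<in> hom C Z (N x T)"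
  shows "Cmp C (pr x R (S \<union> T) f (pr x S T g h)) (assoc monoidal X Y Z) =
    pr x (R \<union> S) T (pr x R S f g) h"
  using someI_ex[OF assoc_exists[of X Y Z]] assms hom_obj(1)[OF assms(8)] hom_obj(1)[OF assms(9)]
    hom_obj(1)[OF assms(10)] by (simp add: monoidal_def is_assoc_def)

lemma monoidal_braid:
  assumes "X \<in> Obj C" "Y \<in> Obj C"
  shows braid_hom: "braid monoidal X Y \<in> hom C (tO X Y) (tO Y X)"
    and iso_braid: "iso_arr C (braid monoidal X Y)"
  using someI_ex[OF braid_exists[OF assms]] by (simp_all add: monoidal_def is_braid_def)

lemma pr_braid:
  assumes "x \<in> Fam" "R \<subseteq> ix x" "S \<subseteq> ix x" "R \<inter> S = {}" "f \<in> hom C X (N x R)" "g \<in> hom C Y (N x S)"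
  shows "Cmp C (pr x S R g f) (braid monoidal X Y) = pr x R S f g"
  using someI_ex[OF braid_exists[of X Y]] assms hom_obj(1)[OF assms(5)] hom_obj(1)[OF assms(6)]
  by (simp add: monoidal_def is_braid_def)

lemma is_unit_monoidal:
  assumes "X \<in> Obj C"
  shows "is_lunit X (lunit monoidal X)" "is_runit X (runit monoidal X)"
  using someI_ex[OF unit_exists(1)[OF assms]] someI_ex[OF unit_exists(2)[OF assms]]
  by (simp_all only: monoidal_def monoidal_data.simps)

lemma monoidal_unit:
  assumes "X \<in> Obj C"
  shows lunit_hom: "lunit monoidal X \<in> hom C (tO U X) X"
    and iso_lunit: "iso_arr C (lunit monoidal X)"
    and runit_hom: "runit monoidal X \<in> hom C (tO X U) X"
    and iso_runit: "iso_arr C (runit monoidal X)"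
  using is_unit_monoidal[OF assms] unfolding is_lunit_def is_runit_def by blast+

lemma pr_unit:
  assumes "x \<in> Fam" "S \<subseteq> ix x" "f \<in> hom C X (N x S)"
  shows "pr x {} S (e x) f = Cmp C f (lunit monoidal X)"
    and "pr x S {} f (e x) = Cmp C f (runit monoidal X)"
  using is_unit_monoidal[OF hom_obj(1)[OF assms(3)]] assms
  unfolding is_lunit_def is_runit_def by blast+

text \<open>
  Each coherence law is checked on a family realizing the objects involved, after composition with
  the isomorphism onto the unbiased product.
\<close>

lemma symmetric_monoidal: "symmetric_monoidal C monoidal"
proof (rule symmetric_monoidal.intro[OF category_axioms], unfold_locales, unfold monoidal_simps)
  fix X Y Z X' Y' Z' f g h
  assume f: "f \<in> hom C X X'" and g: "g \<in> hom C Y Y'" and h: "h \<in> hom C Z Z'"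
  note X = hom_obj[OF f] and Y = hom_obj[OF g] and Z = hom_obj[OF h]
  \<comment> \<open>The targets are realized rather than the sources: composing \<open>v 1\<close>,
    \<open>v 2\<close>, \<open>v 3\<close> with \<open>f\<close>, \<open>g\<close>, \<open>h\<close>
    then also maps the sources into the same members, and both sides reduce to one \<open>pr\<close>
    term.\<close>
  obtain y and v :: "nat \<Rightarrow> 'a" where y: "y \<in> Fam" "ix y = {1, 2, 3}"
    and v1: "v 1 \<in> hom C X' (N y {1})" "iso_arr C (v 1)"
    and v2: "v 2 \<in> hom C Y' (N y {2})" "iso_arr C (v 2)"
    and v3: "v 3 \<in> hom C Z' (N y {3})" "iso_arr C (v 3)"
    using realize3[OF X(2) Y(2) Z(2)] .
  have s: "{1} \<subseteq> ix y" "{2} \<subseteq> ix y" "{3} \<subseteq> ix y" "{1} \<inter> {2 :: nat} = {}" "{1} \<inter> {3 :: nat} = {}"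
    "{2} \<inter> {3 :: nat} = {}" "{2} \<union> {3} \<subseteq> ix y" "{1} \<inter> ({2} \<union> {3 :: nat}) = {}"
    "{1} \<union> {2} \<subseteq> ix y" "({1} \<union> {2}) \<inter> {3 :: nat} = {}"
    using y by auto
  note w1 = cmp_hom[OF f v1(1)] and w2 = cmp_hom[OF g v2(1)] and w3 = cmp_hom[OF h v3(1)]
  note fg = tA_hom[OF f g] and gh = tA_hom[OF g h]
  note p12 = pr_hom[OF y(1) s(1,2,4) v1(1) v2(1)]
    and p23 = pr_hom[OF y(1) s(2,3,6) v2(1) v3(1)] and i23 = pr_iso[OF y(1) s(2,3,6) v2(1) v3(1) v2(2) v3(2)]
  note p = pr_hom[OF y(1) s(1,7,8) v1(1) p23] and i = pr_iso[OF y(1) s(1,7,8) v1(1) p23 v1(2) i23]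
  let ?k = "pr y {1} ({2} \<union> {3}) (v 1) (pr y {2} {3} (v 2) (v 3))"
  have "Cmp C ?k (Cmp C (assoc monoidal X' Y' Z') (tA (tA f g) h)) =
      Cmp C (pr y ({1} \<union> {2}) {3} (pr y {1} {2} (v 1) (v 2)) (v 3)) (tA (tA f g) h)"
    using cmp_assoc[OF tA_hom[OF fg h] assoc_hom[OF X(2) Y(2) Z(2)] p]
      pr_assoc[OF y(1) s(1-6) v1(1) v2(1) v3(1)] by simp
  also have "\<dots> = pr y ({1} \<union> {2}) {3} (pr y {1} {2} (Cmp C (v 1) f) (Cmp C (v 2) g)) (Cmp C (v 3) h)"
    using pr_cmp[OF y(1) s(9,3,10) p12 v3(1) fg h] pr_cmp[OF y(1) s(1,2,4) v1(1) v2(1) f g] by simp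
  also have "\<dots> = Cmp C (pr y {1} ({2} \<union> {3}) (Cmp C (v 1) f) (pr y {2} {3} (Cmp C (v 2) g) (Cmp C (v 3) h)))
      (assoc monoidal X Y Z)"
    using pr_assoc[OF y(1) s(1-6) w1 w2 w3] by simp
  also have "\<dots> = Cmp C (Cmp C ?k (tA f (tA g h))) (assoc monoidal X Y Z)"
    using pr_cmp[OF y(1) s(1,7,8) v1(1) p23 f gh] pr_cmp[OF y(1) s(2,3,6) v2(1) v3(1) g h] by simp
  also have "\<dots> = Cmp C ?k (Cmp C (tA f (tA g h)) (assoc monoidal X Y Z))"
    using cmp_assoc[OF assoc_hom[OF X(1) Y(1) Z(1)] tA_hom[OF f gh] p] by simp
  finally show "Cmp C (assoc monoidal X' Y' Z') (tA (tA f g) h) =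
      Cmp C (tA f (tA g h)) (assoc monoidal X Y Z)"
    by (rule iso_monic[OF i p cmp_hom[OF tA_hom[OF fg h] assoc_hom[OF X(2) Y(2) Z(2)]]
          cmp_hom[OF assoc_hom[OF X(1) Y(1) Z(1)] tA_hom[OF f gh]]])
next
  fix X X' f assume f: "f \<in> hom C X X'"
  note X = hom_obj[OF f] and U = idn_hom[OF U_obj]
  obtain y and v :: "nat \<Rightarrow> 'a" where y: "y \<in> Fam" "ix y = {1}"
    and v: "v 1 \<in> hom C X' (N y {1})" "iso_arr C (v 1)"
    using realize[of "{1}" "\<lambda>_. X'"] X by auto
  have s: "{} \<subseteq> ix y" "{1} \<subseteq> ix y" "{} \<inter> {1 :: nat} = {}" "{1} \<inter> {} = ({} :: nat set)" using y by auto
  note e = e_hom[OF y(1)] and w = cmp_hom[OF f v(1)]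
  have "Cmp C (v 1) (Cmp C (lunit monoidal X') (tA (Idn C U) f)) =
      Cmp C (pr y {} {1} (e y) (v 1)) (tA (Idn C U) f)"
    using cmp_assoc[OF tA_hom[OF U f] lunit_hom[OF X(2)] v(1)] pr_unit[OF y(1) s(2) v(1)] by simp
  also have "\<dots> = Cmp C (Cmp C (v 1) f) (lunit monoidal X)"
    using pr_cmp[OF y(1) s(1-3) e v(1) U f] idn_right[OF e] pr_unit[OF y(1) s(2) w] by simp
  also have "\<dots> = Cmp C (v 1) (Cmp C f (lunit monoidal X))"
    using cmp_assoc[OF lunit_hom[OF X(1)] f v(1)] by simp
  finally show "Cmp C (lunit monoidal X') (tA (Idn C U) f) = Cmp C f (lunit monoidal X)"
    by (rule iso_monic[OF v(2,1) cmp_hom[OF tA_hom[OF U f] lunit_hom[OF X(2)]]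
          cmp_hom[OF lunit_hom[OF X(1)] f]])
  have "Cmp C (v 1) (Cmp C (runit monoidal X') (tA f (Idn C U))) =
      Cmp C (pr y {1} {} (v 1) (e y)) (tA f (Idn C U))"
    using cmp_assoc[OF tA_hom[OF f U] runit_hom[OF X(2)] v(1)] pr_unit[OF y(1) s(2) v(1)] by simp
  also have "\<dots> = Cmp C (Cmp C (v 1) f) (runit monoidal X)"
    using pr_cmp[OF y(1) s(2,1,4) v(1) e f U] idn_right[OF e] pr_unit[OF y(1) s(2) w] by simp
  also have "\<dots> = Cmp C (v 1) (Cmp C f (runit monoidal X))"
    using cmp_assoc[OF runit_hom[OF X(1)] f v(1)] by simp
  finally show "Cmp C (runit monoidal X') (tA f (Idn C U)) = Cmp C f (runit monoidal X)"
    by (rule iso_monic[OF v(2,1) cmp_hom[OF tA_hom[OF f U] runit_hom[OF X(2)]]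
          cmp_hom[OF runit_hom[OF X(1)] f]])
next
  fix X Y X' Y' f g
  assume f: "f \<in> hom C X X'" and g: "g \<in> hom C Y Y'"
  note X = hom_obj[OF f] and Y = hom_obj[OF g]
  obtain y and v :: "nat \<Rightarrow> 'a" where y: "y \<in> Fam" "ix y = {1, 2}"
    and v1: "v 1 \<in> hom C X' (N y {1})" "iso_arr C (v 1)"
    and v2: "v 2 \<in> hom C Y' (N y {2})" "iso_arr C (v 2)"
    using realize2[OF X(2) Y(2)] .
  have s: "{1} \<subseteq> ix y" "{2} \<subseteq> ix y" "{1} \<inter> {2 :: nat} = {}" "{2} \<inter> {1 :: nat} = {}"
    using y by auto
  note w1 = cmp_hom[OF f v1(1)] and w2 = cmp_hom[OF g v2(1)]
  note p = pr_hom[OF y(1) s(2,1,4) v2(1) v1(1)] and i = pr_iso[OF y(1) s(2,1,4) v2(1) v1(1) v2(2) v1(2)]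
  let ?k = "pr y {2} {1} (v 2) (v 1)"
  have "Cmp C ?k (Cmp C (braid monoidal X' Y') (tA f g)) = Cmp C (pr y {1} {2} (v 1) (v 2)) (tA f g)"
    using cmp_assoc[OF tA_hom[OF f g] braid_hom[OF X(2) Y(2)] p]
      pr_braid[OF y(1) s(1-3) v1(1) v2(1)] by simp
  also have "\<dots> = Cmp C (pr y {2} {1} (Cmp C (v 2) g) (Cmp C (v 1) f)) (braid monoidal X Y)"
    using pr_cmp[OF y(1) s(1-3) v1(1) v2(1) f g] pr_braid[OF y(1) s(1-3) w1 w2] by simp
  also have "\<dots> = Cmp C ?k (Cmp C (tA g f) (braid monoidal X Y))"
    using pr_cmp[OF y(1) s(2,1,4) v2(1) v1(1) g f] cmp_assoc[OF braid_hom[OF X(1) Y(1)] tA_hom[OF g f] p]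
    by simp
  finally show "Cmp C (braid monoidal X' Y') (tA f g) = Cmp C (tA g f) (braid monoidal X Y)"
    by (rule iso_monic[OF i p cmp_hom[OF tA_hom[OF f g] braid_hom[OF X(2) Y(2)]]
          cmp_hom[OF braid_hom[OF X(1) Y(1)] tA_hom[OF g f]]])
next
  fix W X Y Z assume W: "W \<in> Obj C" and X: "X \<in> Obj C" and Y: "Y \<in> Obj C" and Z: "Z \<in> Obj C"
  obtain y and v :: "nat \<Rightarrow> 'a" where y: "y \<in> Fam" "ix y = {0, 1, 2, 3}"
    and v0: "v 0 \<in> hom C W (N y {0})" "iso_arr C (v 0)"
    and v1: "v 1 \<in> hom C X (N y {1})" "iso_arr C (v 1)"
    and v2: "v 2 \<in> hom C Y (N y {2})" "iso_arr C (v 2)"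
    and v3: "v 3 \<in> hom C Z (N y {3})" "iso_arr C (v 3)"
    using realize4[OF W X Y Z] .
  let ?a = "assoc monoidal"
  define v01 where "v01 = pr y {0} {1} (v 0) (v 1)"
  define v12 where "v12 = pr y {1} {2} (v 1) (v 2)"
  define v23 where "v23 = pr y {2} {3} (v 2) (v 3)"
  define v012 where "v012 = pr y ({0} \<union> {1}) {2} v01 (v 2)"
  define v012' where "v012' = pr y {0} ({1} \<union> {2}) (v 0) v12"
  define v123 where "v123 = pr y ({1} \<union> {2}) {3} v12 (v 3)"
  define v123' where "v123' = pr y {1} ({2} \<union> {3}) (v 1) v23"
  have v01: "v01 \<in> hom C (tO W X) (N y ({0} \<union> {1}))"
    unfolding v01_def by (rule pr_hom) (use y v0 v1 in auto)
  have v12: "v12 \<in> hom C (tO X Y) (N y ({1} \<union> {2}))"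
    unfolding v12_def by (rule pr_hom) (use y v1 v2 in auto)
  have v23: "v23 \<in> hom C (tO Y Z) (N y ({2} \<union> {3}))" "iso_arr C v23"
    unfolding v23_def by (rule pr_hom pr_iso; use y v2 v3 in auto)+
  have v012: "v012 \<in> hom C (tO (tO W X) Y) (N y ({0} \<union> {1} \<union> {2}))"
    unfolding v012_def by (rule pr_hom) (use y v01 v2 in auto)
  have v012': "v012' \<in> hom C (tO W (tO X Y)) (N y ({0} \<union> ({1} \<union> {2})))"
    unfolding v012'_def by (rule pr_hom) (use y v12 v0 in auto)
  have v123: "v123 \<in> hom C (tO (tO X Y) Z) (N y ({1} \<union> {2} \<union> {3}))"
    unfolding v123_def by (rule pr_hom) (use y v12 v3 in auto)
  have v123': "v123' \<in> hom C (tO X (tO Y Z)) (N y ({1} \<union> ({2} \<union> {3})))" "iso_arr C v123'"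
    unfolding v123'_def by (rule pr_hom pr_iso; use y v23 v1 in auto)+
  \<comment> \<open>\<open>k\<close> is the fully right-nested bracketing. Facts 3, 2, 1 absorb the
    three factors of one side into it, from the outermost inwards; facts 5 and 4 absorb the two
    factors of the other. Both chains end at the left-nested bracketing.\<close>
  define k where "k = pr y {0} ({1} \<union> ({2} \<union> {3})) (v 0) v123'"
  have k: "k \<in> hom C (tO W (tO X (tO Y Z))) (N y ({0} \<union> ({1} \<union> ({2} \<union> {3}))))" "iso_arr C k"
    unfolding k_def by (rule pr_hom pr_iso; use y v123' v0 in auto)+
  note XY = tO_obj[OF X Y] and WX = tO_obj[OF W X] and YZ = tO_obj[OF Y Z]
  note a1 = tA_hom[OF assoc_hom[OF W X Y] idn_hom[OF Z]]
  note a2 = assoc_hom[OF W XY Z]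
  note a3 = tA_hom[OF idn_hom[OF W] assoc_hom[OF X Y Z]]
  note a4 = assoc_hom[OF WX Y Z] and a5 = assoc_hom[OF W X YZ]
  have 3: "Cmp C k (tA (Idn C W) (?a X Y Z)) = pr y {0} ({1} \<union> {2} \<union> {3}) (v 0) v123"
  proof -
    have "Cmp C k (tA (Idn C W) (?a X Y Z)) =
        pr y {0} ({1} \<union> ({2} \<union> {3})) (Cmp C (v 0) (Idn C W)) (Cmp C v123' (?a X Y Z))"
      unfolding k_def
      by (rule pr_cmp[OF y(1) _ _ _ v0(1) v123'(1) idn_hom[OF W] assoc_hom[OF X Y Z]]) (use y in auto)
    also have "Cmp C v123' (?a X Y Z) = v123"
      unfolding v123'_def v123_def v12_def v23_def
      by (rule pr_assoc[OF y(1) _ _ _ _ _ _ v1(1) v2(1) v3(1)]) (use y in auto)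
    finally show ?thesis using idn_right[OF v0(1)] by (simp add: Un_assoc)
  qed
  have 2: "Cmp C (pr y {0} ({1} \<union> {2} \<union> {3}) (v 0) v123) (?a W (tO X Y) Z) =
      pr y ({0} \<union> ({1} \<union> {2})) {3} v012' (v 3)"
    unfolding v123_def v012'_def
    by (rule pr_assoc[OF y(1) _ _ _ _ _ _ v0(1) v12 v3(1)]) (use y in auto)
  have 1: "Cmp C (pr y ({0} \<union> ({1} \<union> {2})) {3} v012' (v 3)) (tA (?a W X Y) (Idn C Z)) =
      pr y ({0} \<union> {1} \<union> {2}) {3} v012 (v 3)"
  proof -
    have "Cmp C (pr y ({0} \<union> ({1} \<union> {2})) {3} v012' (v 3)) (tA (?a W X Y) (Idn C Z)) =
        pr y ({0} \<union> ({1} \<union> {2})) {3} (Cmp C v012' (?a W X Y)) (Cmp C (v 3) (Idn C Z))"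
      by (rule pr_cmp[OF y(1) _ _ _ v012' v3(1) assoc_hom[OF W X Y] idn_hom[OF Z]]) (use y in auto)
    also have "Cmp C v012' (?a W X Y) = v012"
      unfolding v012_def v012'_def v12_def v01_def
      by (rule pr_assoc[OF y(1) _ _ _ _ _ _ v0(1) v1(1) v2(1)]) (use y in auto)
    finally show ?thesis using idn_right[OF v3(1)] by (simp add: Un_assoc)
  qed
  have 5: "Cmp C k (?a W X (tO Y Z)) = pr y ({0} \<union> {1}) ({2} \<union> {3}) v01 v23"
    unfolding k_def v123'_def v01_def
    by (rule pr_assoc[OF y(1) _ _ _ _ _ _ v0(1) v1(1) v23(1)]) (use y in auto)
  have 4: "Cmp C (pr y ({0} \<union> {1}) ({2} \<union> {3}) v01 v23) (?a (tO W X) Y Z) =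
      pr y ({0} \<union> {1} \<union> {2}) {3} v012 (v 3)"
    unfolding v23_def v012_def
    by (rule pr_assoc[OF y(1) _ _ _ _ _ _ v01 v2(1) v3(1)]) (use y in auto)
  show "Cmp C (tA (Idn C W) (?a X Y Z)) (Cmp C (?a W (tO X Y) Z) (tA (?a W X Y) (Idn C Z))) =
      Cmp C (?a W X (tO Y Z)) (?a (tO W X) Y Z)"
  proof (rule iso_monic[OF k(2,1) cmp_hom[OF cmp_hom[OF a1 a2] a3] cmp_hom[OF a4 a5]])
    have "Cmp C k (Cmp C (tA (Idn C W) (?a X Y Z)) (Cmp C (?a W (tO X Y) Z) (tA (?a W X Y) (Idn C Z)))) =
        pr y ({0} \<union> {1} \<union> {2}) {3} v012 (v 3)"
      using cmp_assoc[OF cmp_hom[OF a1 a2] a3 k(1)] cmp_assoc[OF a1 a2 cmp_hom[OF a3 k(1)]] 1 2 3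
      by simp
    moreover have "Cmp C k (Cmp C (?a W X (tO Y Z)) (?a (tO W X) Y Z)) =
        pr y ({0} \<union> {1} \<union> {2}) {3} v012 (v 3)"
      using cmp_assoc[OF a4 a5 k(1)] 4 5 by simp
    ultimately show "Cmp C k (Cmp C (tA (Idn C W) (?a X Y Z))
        (Cmp C (?a W (tO X Y) Z) (tA (?a W X Y) (Idn C Z)))) =
        Cmp C k (Cmp C (?a W X (tO Y Z)) (?a (tO W X) Y Z))" by simp
  qed
next
  fix X Y assume X: "X \<in> Obj C" and Y: "Y \<in> Obj C"
  obtain y and v :: "nat \<Rightarrow> 'a" where y: "y \<in> Fam" "ix y = {1, 2}"
    and v1: "v 1 \<in> hom C X (N y {1})" "iso_arr C (v 1)"
    and v2: "v 2 \<in> hom C Y (N y {2})" "iso_arr C (v 2)"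
    using realize2[OF X Y] .
  \<comment> \<open>The unit occupies the empty index set: \<open>{1}\<close>, \<open>{}\<close>,
    \<open>{2}\<close> are pairwise disjoint, so \<open>pr_assoc\<close> applies with
    \<open>e y\<close> in the middle.\<close>
  have s: "{1} \<subseteq> ix y" "{2} \<subseteq> ix y" "{1} \<inter> {2 :: nat} = {}" "{2} \<inter> {1 :: nat} = {}" "{} \<subseteq> ix y"
    "{1} \<inter> {} = ({} :: nat set)" "{} \<inter> {2 :: nat} = {}"
    using y by auto
  note e = e_hom[OF y(1)]
  note p = pr_hom[OF y(1) s(1-3) v1(1) v2(1)] and i = pr_iso[OF y(1) s(1-3) v1(1) v2(1) v1(2) v2(2)]
  let ?k = "pr y {1} {2} (v 1) (v 2)"
  note a = assoc_hom[OF X U_obj Y] and l = tA_hom[OF idn_hom[OF X] lunit_hom[OF Y]]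
    and r = tA_hom[OF runit_hom[OF X] idn_hom[OF Y]]
  show "Cmp C (tA (Idn C X) (lunit monoidal Y)) (assoc monoidal X U Y) =
      tA (runit monoidal X) (Idn C Y)"
  proof (rule iso_monic[OF i p cmp_hom[OF a l] r])
    have "Cmp C ?k (Cmp C (tA (Idn C X) (lunit monoidal Y)) (assoc monoidal X U Y)) =
        Cmp C (pr y {1} {2} (v 1) (pr y {} {2} (e y) (v 2))) (assoc monoidal X U Y)"
      using cmp_assoc[OF a l p] idn_right[OF v1(1)] pr_unit(1)[OF y(1) s(2) v2(1)]
        pr_cmp[OF y(1) s(1-3) v1(1) v2(1) idn_hom[OF X] lunit_hom[OF Y]] by simp
    also have "\<dots> = pr y {1} {2} (pr y {1} {} (v 1) (e y)) (v 2)"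
      using pr_assoc[OF y(1) s(1,5,2,6,3,7) v1(1) e v2(1)] by simp
    also have "\<dots> = Cmp C ?k (tA (runit monoidal X) (Idn C Y))"
      using idn_right[OF v2(1)] pr_unit(2)[OF y(1) s(1) v1(1)]
        pr_cmp[OF y(1) s(1-3) v1(1) v2(1) runit_hom[OF X] idn_hom[OF Y]] by simp
    finally show "Cmp C ?k (Cmp C (tA (Idn C X) (lunit monoidal Y)) (assoc monoidal X U Y)) =
        Cmp C ?k (tA (runit monoidal X) (Idn C Y))" .
  qed
  note b = braid_hom[OF X Y] braid_hom[OF Y X]
  show "Cmp C (braid monoidal Y X) (braid monoidal X Y) = Idn C (tO X Y)"
  proof (rule iso_monic[OF i p cmp_hom[OF b] idn_hom[OF tO_obj[OF X Y]]])
    show "Cmp C ?k (Cmp C (braid monoidal Y X) (braid monoidal X Y)) = Cmp C ?k (Idn C (tO X Y))"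
      using cmp_assoc[OF b p] pr_braid[OF y(1) s(2,1,4) v2(1) v1(1)]
        pr_braid[OF y(1) s(1-3) v1(1) v2(1)] idn_right[OF p] by simp
  qed
next
  fix X Y Z assume X: "X \<in> Obj C" and Y: "Y \<in> Obj C" and Z: "Z \<in> Obj C"
  obtain y and v :: "nat \<Rightarrow> 'a" where y: "y \<in> Fam" "ix y = {1, 2, 3}"
    and v1: "v 1 \<in> hom C X (N y {1})" "iso_arr C (v 1)"
    and v2: "v 2 \<in> hom C Y (N y {2})" "iso_arr C (v 2)"
    and v3: "v 3 \<in> hom C Z (N y {3})" "iso_arr C (v 3)"
    using realize3[OF X Y Z] .
  let ?a = "assoc monoidal" and ?b = "braid monoidal"
  define v12 where "v12 = pr y {1} {2} (v 1) (v 2)"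
  define v21 where "v21 = pr y {2} {1} (v 2) (v 1)"
  define v23 where "v23 = pr y {2} {3} (v 2) (v 3)"
  define v31 where "v31 = pr y {3} {1} (v 3) (v 1)"
  define v13 where "v13 = pr y {1} {3} (v 1) (v 3)"
  have v21: "v21 \<in> hom C (tO Y X) (N y ({2} \<union> {1}))"
    unfolding v21_def by (rule pr_hom) (use y v1 v2 in auto)
  have v23: "v23 \<in> hom C (tO Y Z) (N y ({2} \<union> {3}))"
    unfolding v23_def by (rule pr_hom) (use y v2 v3 in auto)
  have v31: "v31 \<in> hom C (tO Z X) (N y ({3} \<union> {1}))" "iso_arr C v31"
    unfolding v31_def by (rule pr_hom pr_iso; use y v1 v3 in auto)+
  \<comment> \<open>The common target carries the rotated bracketing. Facts 3, 2, 1 reduce one side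
    of the hexagon to \<open>?w\<close>, facts 6, 5, 4 the other.\<close>
  define k where "k = pr y {2} ({3} \<union> {1}) (v 2) v31"
  have k: "k \<in> hom C (tO Y (tO Z X)) (N y ({2} \<union> ({3} \<union> {1})))" "iso_arr C k"
    unfolding k_def by (rule pr_hom pr_iso; use y v31 v2 in auto)+
  note a1 = assoc_hom[OF X Y Z] and a2 = braid_hom[OF X tO_obj[OF Y Z]] and a3 = assoc_hom[OF Y Z X]
  note c1 = tA_hom[OF braid_hom[OF X Y] idn_hom[OF Z]] and c2 = assoc_hom[OF Y X Z]
    and c3 = tA_hom[OF idn_hom[OF Y] braid_hom[OF X Z]]
  let ?w = "pr y ({1} \<union> {2}) {3} v12 (v 3)"
  have 3: "Cmp C k (?a Y Z X) = pr y ({2} \<union> {3}) {1} v23 (v 1)"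
    unfolding k_def v31_def v23_def
    by (rule pr_assoc[OF y(1) _ _ _ _ _ _ v2(1) v3(1) v1(1)]) (use y in auto)
  have 2: "Cmp C (pr y ({2} \<union> {3}) {1} v23 (v 1)) (?b X (tO Y Z)) = pr y {1} ({2} \<union> {3}) (v 1) v23"
    by (rule pr_braid[OF y(1) _ _ _ v1(1) v23]) (use y in auto)
  have 1: "Cmp C (pr y {1} ({2} \<union> {3}) (v 1) v23) (?a X Y Z) = ?w"
    unfolding v23_def v12_def
    by (rule pr_assoc[OF y(1) _ _ _ _ _ _ v1(1) v2(1) v3(1)]) (use y in auto)
  have 6: "Cmp C k (tA (Idn C Y) (?b X Z)) = pr y {2} ({1} \<union> {3}) (v 2) v13"
  proof -
    have "Cmp C k (tA (Idn C Y) (?b X Z)) =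
        pr y {2} ({3} \<union> {1}) (Cmp C (v 2) (Idn C Y)) (Cmp C v31 (?b X Z))"
      unfolding k_def
      by (rule pr_cmp[OF y(1) _ _ _ v2(1) v31(1) idn_hom[OF Y] braid_hom[OF X Z]]) (use y in auto)
    also have "Cmp C v31 (?b X Z) = v13"
      unfolding v31_def v13_def by (rule pr_braid[OF y(1) _ _ _ v1(1) v3(1)]) (use y in auto)
    finally show ?thesis using idn_right[OF v2(1)] by (simp add: Un_commute)
  qed
  have 5: "Cmp C (pr y {2} ({1} \<union> {3}) (v 2) v13) (?a Y X Z) = pr y ({2} \<union> {1}) {3} v21 (v 3)"
    unfolding v13_def v21_def
    by (rule pr_assoc[OF y(1) _ _ _ _ _ _ v2(1) v1(1) v3(1)]) (use y in auto)
  have 4: "Cmp C (pr y ({2} \<union> {1}) {3} v21 (v 3)) (tA (?b X Y) (Idn C Z)) = ?w"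
  proof -
    have "Cmp C (pr y ({2} \<union> {1}) {3} v21 (v 3)) (tA (?b X Y) (Idn C Z)) =
        pr y ({2} \<union> {1}) {3} (Cmp C v21 (?b X Y)) (Cmp C (v 3) (Idn C Z))"
      by (rule pr_cmp[OF y(1) _ _ _ v21 v3(1) braid_hom[OF X Y] idn_hom[OF Z]]) (use y in auto)
    also have "Cmp C v21 (?b X Y) = v12"
      unfolding v21_def v12_def by (rule pr_braid[OF y(1) _ _ _ v1(1) v2(1)]) (use y in auto)
    finally show ?thesis using idn_right[OF v3(1)] by (simp add: Un_commute)
  qed
  show "Cmp C (?a Y Z X) (Cmp C (?b X (tO Y Z)) (?a X Y Z)) =
      Cmp C (tA (Idn C Y) (?b X Z)) (Cmp C (?a Y X Z) (tA (?b X Y) (Idn C Z)))"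
  proof (rule iso_monic[OF k(2,1) cmp_hom[OF cmp_hom[OF a1 a2] a3] cmp_hom[OF cmp_hom[OF c1 c2] c3]])
    have "Cmp C k (Cmp C (?a Y Z X) (Cmp C (?b X (tO Y Z)) (?a X Y Z))) = ?w"
      using cmp_assoc[OF cmp_hom[OF a1 a2] a3 k(1)] cmp_assoc[OF a1 a2 cmp_hom[OF a3 k(1)]] 1 2 3
      by simp
    moreover have "Cmp C k (Cmp C (tA (Idn C Y) (?b X Z)) (Cmp C (?a Y X Z) (tA (?b X Y) (Idn C Z)))) = ?w"
      using cmp_assoc[OF cmp_hom[OF c1 c2] c3 k(1)] cmp_assoc[OF c1 c2 cmp_hom[OF c3 k(1)]] 4 5 6
      by simp
    ultimately show "Cmp C k (Cmp C (?a Y Z X) (Cmp C (?b X (tO Y Z)) (?a X Y Z))) =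
        Cmp C k (Cmp C (tA (Idn C Y) (?b X Z)) (Cmp C (?a Y X Z) (tA (?b X Y) (Idn C Z))))" by simp
  qed
qed (fact tA_cmp | simp add: tO_obj tA_hom tA_idn tA_cmp U_obj assoc_hom iso_assoc lunit_hom iso_lunit runit_hom
    iso_runit braid_hom iso_braid)+

text \<open>The unbiased products are themselves objects of \<open>C\<close>, so
  \<open>pr_assoc\<close> may be used with identity maps, for which \<open>pr\<close> reduces to
  \<open>m\<close>.\<close>

lemma m_assoc:
  assumes "x \<in> Fam" "R \<subseteq> ix x" "S \<subseteq> ix x" "T \<subseteq> ix x" "R \<inter> S = {}" "R \<inter> T = {}" "S \<inter> T = {}"
  shows "Cmp C (m x (R \<union> S) T) (tA (m x R S) (Idn C (N x T))) =
    Cmp C (m x R (S \<union> T)) (Cmp C (tA (Idn C (N x R)) (m x S T))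
      (assoc monoidal (N x R) (N x S) (N x T)))"
proof -
  note n = idn_hom[OF N_obj[OF assms(1,2)]] idn_hom[OF N_obj[OF assms(1,3)]] idn_hom[OF N_obj[OF assms(1,4)]]
  note mm = m_hom[OF assms(1,3,4,7)]
  have d: "R \<inter> (S \<union> T) = {}" and s: "S \<union> T \<subseteq> ix x" using assms by auto
  have "Cmp C (m x R (S \<union> T)) (Cmp C (tA (Idn C (N x R)) (m x S T)) (assoc monoidal (N x R) (N x S) (N x T))) =
      Cmp C (pr x R (S \<union> T) (Idn C (N x R)) (m x S T)) (assoc monoidal (N x R) (N x S) (N x T))"
    unfolding pr_def
    using cmp_assoc[OF assoc_hom[OF N_obj[OF assms(1,2)] N_obj[OF assms(1,3)] N_obj[OF assms(1,4)]]
        tA_hom[OF n(1) mm] m_hom[OF assms(1,2) s d]] by simp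
  also have "\<dots> = pr x (R \<union> S) T (m x R S) (Idn C (N x T))"
    using pr_assoc[OF assms n] pr_idn[OF assms(1,3,4,7)] pr_idn[OF assms(1,2,3,5)] by simp
  finally show ?thesis by (simp add: pr_def)
qed

lemma m_braid:
  assumes "x \<in> Fam" "R \<subseteq> ix x" "S \<subseteq> ix x" "R \<inter> S = {}"
  shows "Cmp C (m x S R) (braid monoidal (N x R) (N x S)) = m x R S"
  using pr_braid[OF assms idn_hom[OF N_obj[OF assms(1,2)]] idn_hom[OF N_obj[OF assms(1,3)]]]
    pr_idn[OF assms] pr_idn[OF assms(1,3,2)] assms(4) by (simp add: Int_commute)

lemma m_unit:
  assumes "x \<in> Fam" "S \<subseteq> ix x"
  shows "Cmp C (m x {} S) (tA (e x) (Idn C (N x S))) = lunit monoidal (N x S)"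
    and "Cmp C (m x S {}) (tA (Idn C (N x S)) (e x)) = runit monoidal (N x S)"
  using pr_unit[OF assms idn_hom[OF N_obj[OF assms]]] N_obj[OF assms]
    idn_left[OF lunit_hom] idn_left[OF runit_hom] by (simp_all add: pr_def)

end

section \<open>Exact functors on graded 2-vector spaces\<close>

lemma hom_tot:
  "f \<in> hom (tot C) X Y \<longleftrightarrow>
     X \<in> Obj (tot C) \<and> Y \<in> Obj (tot C) \<and> (\<forall>n. f n \<in> hom (C n) (X n) (Y n))"
  by (auto simp: tot_def hom_def Let_def)

lemma Obj_tot: "X \<in> Obj (tot C) \<longleftrightarrow> (\<forall>n. X n \<in> Obj (C n)) \<and> finite {n. \<not> zero_object (C n) (X n)}"
  by (simp add: tot_def Let_def)

lemma tot_simps: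
  "Dom (tot C) f = (\<lambda>n. Dom (C n) (f n))" "Cod (tot C) f = (\<lambda>n. Cod (C n) (f n))"
  "Idn (tot C) X = (\<lambda>n. Idn (C n) (X n))" "Cmp (tot C) g f = (\<lambda>n. Cmp (C n) (g n) (f n))"
  "Zero (tot C) X Y = (\<lambda>n. Zero (C n) (X n) (Y n))" "Add (tot C) f g = (\<lambda>n. Add (C n) (f n) (g n))"
  "Scl (tot C) c f = (\<lambda>n. Scl (C n) c (f n))"
  by (simp_all add: tot_def Let_def)

text \<open>All operations act in each degree separately, and the finiteness condition concerns only
  objects, so every axiom is inherited degreewise.\<close>

lemma linear_category_tot:
  assumes "\<And>n. linear_category (C n)"
  shows "linear_category (tot C)"
proof -
  interpret linear_category "C n" for n by (rule assms)
  have "category (tot C)"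
  proof
    show "Dom (tot C) f \<in> Obj (tot C)" "Cod (tot C) f \<in> Obj (tot C)" if "f \<in> Arr (tot C)" for f
      using that by (auto simp: tot_def Let_def)
    show "Idn (tot C) X \<in> hom (tot C) X X" if "X \<in> Obj (tot C)" for X
      using that by (simp add: hom_tot tot_simps Obj_tot idn_hom)
    show "Cmp (tot C) g f \<in> hom (tot C) X Z" if "f \<in> hom (tot C) X Y" "g \<in> hom (tot C) Y Z" for f g X Y Z
      using that unfolding hom_tot tot_simps by (blast intro: cmp_hom)
  qed (unfold hom_tot tot_simps, (rule ext, rule cmp_assoc idn_left idn_right, (blast)+)+)
  then show ?thesis
  proof (rule linear_category.intro, unfold_locales)
    show "Zero (tot C) X Y \<in> hom (tot C) X Y" if "X \<in> Obj (tot C)" "Y \<in> Obj (tot C)" for X Y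
      using that by (simp add: hom_tot tot_simps Obj_tot zero_hom)
    show "Add (tot C) f g \<in> hom (tot C) X Y" if "f \<in> hom (tot C) X Y" "g \<in> hom (tot C) X Y" for f g X Y
      using that unfolding hom_tot tot_simps by (blast intro: add_hom)
    show "Scl (tot C) c f \<in> hom (tot C) X Y" if "f \<in> hom (tot C) X Y" for f X Y c
      using that unfolding hom_tot tot_simps by (blast intro: scl_hom)
  qed (unfold hom_tot tot_simps, (rule ext, rule add_assoc add_commute add_zero add_inverse scl_add
          add_scl scl_scl scl_one cmp_add_left cmp_add_right cmp_scl_left cmp_scl_right, (blast)+)+)
qed

section \<open>Products of categories, and exact functors of one and several variables\<close>

lemma hom_Prod:
  "f \<in> hom (Prod A C) X Y \<longleftrightarrow>
     f \<in> extensional A \<and> X \<in> extensional A \<and> Y \<in> extensional A \<and> (\<forall>i\<in>A. f i \<in> hom (C i) (X i) (Y i))"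
  by (auto simp: Prod_def hom_def PiE_def Pi_def extensional_def fun_eq_iff)

lemma Prod_simps:
  "Obj (Prod A C) = (\<Pi>\<^sub>E i\<in>A. Obj (C i))" "Arr (Prod A C) = (\<Pi>\<^sub>E i\<in>A. Arr (C i))"
  "Dom (Prod A C) f = (\<lambda>i\<in>A. Dom (C i) (f i))" "Cod (Prod A C) f = (\<lambda>i\<in>A. Cod (C i) (f i))"
  "Idn (Prod A C) X = (\<lambda>i\<in>A. Idn (C i) (X i))"
  "Cmp (Prod A C) g f = (\<lambda>i\<in>A. Cmp (C i) (g i) (f i))"
  by (simp_all add: Prod_def)

lemma Prod_cong:
  assumes "A = B" "\<And>i. i \<in> B \<Longrightarrow> C i = D i"
  shows "Prod A C = Prod B D"
  unfolding Prod_def using assms by (auto simp: fun_eq_iff restrict_def PiE_def Pi_def)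

lemma category_Prod:
  assumes "\<And>i. i \<in> A \<Longrightarrow> category (C i)"
  shows "category (Prod A C)"
proof
  show "Dom (Prod A C) f \<in> Obj (Prod A C)" "Cod (Prod A C) f \<in> Obj (Prod A C)" if "f \<in> Arr (Prod A C)" for f
    using that category.dom_obj[OF assms] category.cod_obj[OF assms]
    by (auto simp: Prod_simps PiE_def Pi_def)
  show "Idn (Prod A C) X \<in> hom (Prod A C) X X" if "X \<in> Obj (Prod A C)" for X
    using that category.idn_hom[OF assms] by (auto simp: hom_Prod Prod_simps PiE_def Pi_def)
  show "Cmp (Prod A C) g f \<in> hom (Prod A C) X Z"
    if "f \<in> hom (Prod A C) X Y" "g \<in> hom (Prod A C) Y Z" for f g X Y Z
    using that category.cmp_hom[OF assms] by (auto simp: hom_Prod Prod_simps)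
  show "Cmp (Prod A C) h (Cmp (Prod A C) g f) = Cmp (Prod A C) (Cmp (Prod A C) h g) f"
    if "f \<in> hom (Prod A C) W X" "g \<in> hom (Prod A C) X Y" "h \<in> hom (Prod A C) Y Z" for f g h W X Y Z
    unfolding Prod_simps
    by (rule restrict_ext) (use that category.cmp_assoc[OF assms] in \<open>simp add: hom_Prod, blast\<close>)
  show "Cmp (Prod A C) (Idn (Prod A C) Y) f = f" "Cmp (Prod A C) f (Idn (Prod A C) X) = f"
    if "f \<in> hom (Prod A C) X Y" for f X Y
    unfolding Prod_simps
    by (rule extensionalityI[of _ A];
        use that category.idn_left[OF assms] category.idn_right[OF assms] in \<open>auto simp: hom_Prod\<close>)+
qed

lemma iso_Prod:
  assumes "\<And>i. i \<in> A \<Longrightarrow> category (C i)" "f \<in> hom (Prod A C) X Y" "\<And>i. i \<in> A \<Longrightarrow> iso_arr (C i) (f i)"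
  shows "iso_arr (Prod A C) f"
proof (rule category.isoI[OF category_Prod[OF assms(1)] assms(2)])
  have f: "f i \<in> hom (C i) (X i) (Y i)" if "i \<in> A" for i using assms(2) that by (simp add: hom_Prod)
  note inv = category.inv_arr[OF assms(1,3) f]
  show "(\<lambda>i\<in>A. inv_arr (C i) (f i)) \<in> hom (Prod A C) Y X"
    using assms(2) inv(1) by (simp add: hom_Prod)
  show "Cmp (Prod A C) (\<lambda>i\<in>A. inv_arr (C i) (f i)) f = Idn (Prod A C) X"
    "Cmp (Prod A C) f (\<lambda>i\<in>A. inv_arr (C i) (f i)) = Idn (Prod A C) Y"
    using inv by (auto simp: Prod_simps intro!: restrict_ext)
qed

text \<open>This is the one-variable case of \<open>multi_exact\<close>, without the indexing by a
  one-element product.\<close>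

definition exact_functor ::
  "('o, 'a, 'k) lincat \<Rightarrow> ('p, 'b, 'k) lincat \<Rightarrow> ('o, 'a, 'p, 'b) fnctr \<Rightarrow> bool" where
  "exact_functor C D F \<longleftrightarrow> linear_functor C D F \<and>
     (\<forall>f g. short_exact C f g \<longrightarrow> short_exact D (fa F f) (fa F g))"

lemma exact_functor_functor: "exact_functor C D F \<Longrightarrow> is_functor C D F"
  by (simp add: exact_functor_def linear_functor_def)

lemma short_exact_arr: "short_exact C f g \<Longrightarrow> f \<in> Arr C" "short_exact C f g \<Longrightarrow> g \<in> Arr C"
  by (auto simp: short_exact_def is_kernel_def)

lemma exact_id:
  assumes "linear_category C"
  shows "exact_functor C C (id_functor C)"
proof -
  interpret linear_category C by fact
  show ?thesis
    unfolding exact_functor_def linear_functor_def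
  proof (intro conjI allI impI ballI)
    show "short_exact C (fa (id_functor C) f) (fa (id_functor C) g)" if "short_exact C f g" for f g
      using that short_exact_arr[OF that] by simp
  qed (simp_all add: id_is_functor category_axioms hom_arr[OF add_hom] hom_arr
      hom_arr[OF scl_hom[OF arr_hom]])
qed

lemma exact_cmp:
  assumes "linear_category A" "exact_functor A B F" "exact_functor B C G"
  shows "exact_functor A C (cmp_functor A G F)"
proof -
  interpret linear_category A by fact
  note F = exact_functor_functor[OF assms(2)] and G = exact_functor_functor[OF assms(3)]
  have "fa (cmp_functor A G F) (Add A f g) = Add C (fa (cmp_functor A G F) f) (fa (cmp_functor A G F) g)"
    if f: "f \<in> hom A X Y" and g: "g \<in> hom A X Y" for f g X Y
  proof -
    have "fa F (Add A f g) = Add B (fa F f) (fa F g)"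
      using assms(2) f g by (auto simp: exact_functor_def linear_functor_def)
    moreover have "fa G (Add B (fa F f) (fa F g)) = Add C (fa G (fa F f)) (fa G (fa F g))"
      using assms(3) functor_hom[OF F f] functor_hom[OF F g]
      unfolding exact_functor_def linear_functor_def by blast
    ultimately show ?thesis using hom_arr[OF f] hom_arr[OF g] hom_arr[OF add_hom[OF f g]] by simp
  qed
  moreover have "fa (cmp_functor A G F) (Scl A c f) = Scl C c (fa (cmp_functor A G F) f)"
    if f: "f \<in> Arr A" for f c
    using f assms(2,3) hom_arr[OF functor_hom[OF F arr_hom[OF f]]] hom_arr[OF scl_hom[OF arr_hom[OF f]]]
    by (simp add: exact_functor_def linear_functor_def)
  moreover have "short_exact C (fa (cmp_functor A G F) f) (fa (cmp_functor A G F) g)"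
    if "short_exact A f g" for f g
    using that assms(2,3) short_exact_arr[OF that] by (simp add: exact_functor_def)
  ultimately show ?thesis
    using cmp_is_functor[OF category_axioms F G] unfolding exact_functor_def linear_functor_def by blast
qed

text \<open>Every component of a 1-cell is a multifunctor, even over a one-element fibre.
  \<open>multi\<close> and \<open>single\<close> pass between functors on \<open>C i\<close> and
  functors on the product with the single factor \<open>C i\<close>.\<close>

definition multi ::
  "nat \<Rightarrow> (nat \<Rightarrow> ('o, 'a, 'k) lincat) \<Rightarrow> ('o, 'a, 'p, 'b) fnctr \<Rightarrow> (nat \<Rightarrow> 'o, nat \<Rightarrow> 'a, 'p, 'b) fnctr" where
  "multi i C F = \<lparr>fo = (\<lambda>X \<in> Obj (Prod {i} C). fo F (X i)), fa = (\<lambda>u \<in> Arr (Prod {i} C). fa F (u i))\<rparr>"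

definition single ::
  "nat \<Rightarrow> ('o, 'a, 'k) lincat \<Rightarrow> (nat \<Rightarrow> 'o, nat \<Rightarrow> 'a, 'p, 'b) fnctr \<Rightarrow> ('o, 'a, 'p, 'b) fnctr" where
  "single i C F = \<lparr>fo = (\<lambda>X \<in> Obj C. fo F (\<lambda>j \<in> {i}. X)), fa = (\<lambda>u \<in> Arr C. fa F (\<lambda>j \<in> {i}. u))\<rparr>"

lemma singleton_ext: "f \<in> extensional {i} \<Longrightarrow> (\<lambda>j\<in>{i}. f i) = f"
  by (auto simp: extensional_def fun_eq_iff)

lemma multi_simps:
  "X \<in> Obj (Prod {i} C) \<Longrightarrow> fo (multi i C F) X = fo F (X i)"
  "u \<in> Arr (Prod {i} C) \<Longrightarrow> fa (multi i C F) u = fa F (u i)"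
  by (simp_all add: multi_def)

lemma single_simps:
  "X \<in> Obj C \<Longrightarrow> fo (single i C F) X = fo F (\<lambda>j\<in>{i}. X)"
  "u \<in> Arr C \<Longrightarrow> fa (single i C F) u = fa F (\<lambda>j\<in>{i}. u)"
  by (simp_all add: single_def)

lemma single_functor:
  assumes "category (C i)" "is_functor (Prod {i} C) D F"
  shows "is_functor (C i) D (single i (C i) F)"
proof -
  interpret category "C i" by fact
  have h: "(\<lambda>j\<in>{i}. f) \<in> hom (Prod {i} C) (\<lambda>j\<in>{i}. X) (\<lambda>j\<in>{i}. Y)" if "f \<in> hom (C i) X Y" for f X Y
    using that by (simp add: hom_Prod)
  have o: "(\<lambda>j\<in>{i}. X) \<in> Obj (Prod {i} C)" if "X \<in> Obj (C i)" for X
    using that by (simp add: Prod_simps)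
  show ?thesis
  proof (rule is_functorI)
    show "fa (single i (C i) F) f \<in> hom D (fo (single i (C i) F) X) (fo (single i (C i) F) Y)"
      if "f \<in> hom (C i) X Y" for f X Y
      using functor_hom[OF assms(2) h[OF that]] hom_arr[OF that] hom_obj[OF that] by (simp add: single_simps)
    show "fa (single i (C i) F) (Idn (C i) X) = Idn D (fo (single i (C i) F) X)" if "X \<in> Obj (C i)" for X
      using functor_idn[OF assms(2) o[OF that]] that idn_hom[OF that, THEN hom_arr]
      by (simp add: single_simps Prod_simps cong: restrict_cong)
    show "fa (single i (C i) F) (Cmp (C i) g f) = Cmp D (fa (single i (C i) F) g) (fa (single i (C i) F) f)"
      if f: "f \<in> hom (C i) X Y" and g: "g \<in> hom (C i) Y Z" for f g X Y Z
      using functor_cmp[OF assms(2) h[OF f] h[OF g]] hom_arr[OF f] hom_arr[OF g] hom_arr[OF cmp_hom[OF f g]]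
      by (simp add: single_simps Prod_simps cong: restrict_cong)
  qed (use functor_obj[OF assms(2) o] in \<open>simp_all add: single_simps assms(1)\<close>,
      simp_all add: single_def)
qed

lemma exact_single:
  assumes "linear_category (C i)" "multi_exact {i} C D F"
  shows "exact_functor (C i) D (single i (C i) F)"
proof -
  interpret linear_category "C i" by fact
  have F: "is_functor (Prod {i} C) D F" using assms(2) by (simp add: multi_exact_def)
  have u: "(\<lambda>j\<in>{i}. f) \<in> Arr (Prod {i} C)" if "f \<in> Arr (C i)" for f using that by (simp add: Prod_simps)
  have upd: "(\<lambda>j\<in>{i}. f)(i := g) = (\<lambda>j\<in>{i}. g)" for f g :: 'b by (auto simp: fun_eq_iff)
  have "fa (single i (C i) F) (Add (C i) f g) =
      Add D (fa (single i (C i) F) f) (fa (single i (C i) F) g)"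
    if f: "f \<in> hom (C i) X Y" and g: "g \<in> hom (C i) X Y" for f g X Y
  proof -
    have "\<forall>v \<in> hom (C i) (Dom (C i) f) (Cod (C i) f).
         fa F ((\<lambda>j\<in>{i}. f)(i := Add (C i) f v)) = Add D (fa F (\<lambda>j\<in>{i}. f)) (fa F ((\<lambda>j\<in>{i}. f)(i := v)))"
      using assms(2) u[OF hom_arr[OF f]] unfolding multi_exact_def by fastforce
    then show ?thesis
      using f g hom_arr[OF f] hom_arr[OF g] hom_arr[OF add_hom[OF f g]]
      by (simp add: upd single_simps hom_dom[OF f] hom_cod[OF f])
  qed
  moreover have "fa (single i (C i) F) (Scl (C i) c f) = Scl D c (fa (single i (C i) F) f)"
    if f: "f \<in> Arr (C i)" for f c
  proof -
    have "fa F ((\<lambda>j\<in>{i}. f)(i := Scl (C i) c f)) = Scl D c (fa F (\<lambda>j\<in>{i}. f))"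
      using assms(2) u[OF f] unfolding multi_exact_def by fastforce
    then show ?thesis
      using f hom_arr[OF scl_hom[OF arr_hom[OF f]]] by (simp add: upd single_simps)
  qed
  moreover have "short_exact D (fa (single i (C i) F) f) (fa (single i (C i) F) g)"
    if fg: "short_exact (C i) f g" for f g
  proof -
    \<comment> \<open>\<open>multi_exact\<close> asks for an object filling the other slots; with a
      single factor any object serves, since the update overwrites it.\<close>
    define X where "X = (\<lambda>j\<in>{i}. Dom (C i) f)"
    have "X \<in> Obj (Prod {i} C)"
      using short_exact_arr[OF fg] dom_obj by (simp add: X_def Prod_simps)
    then have "short_exact D (fa F ((Idn (Prod {i} C) X)(i := f))) (fa F ((Idn (Prod {i} C) X)(i := g)))"
      using assms(2) fg unfolding multi_exact_def by blast
    moreover have "(Idn (Prod {i} C) X)(i := h) = (\<lambda>j\<in>{i}. h)" for h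
      by (auto simp: Prod_simps fun_eq_iff)
    ultimately show ?thesis using short_exact_arr[OF fg] by (simp add: single_simps)
  qed
  ultimately show ?thesis
    using single_functor[OF category_axioms F] unfolding exact_functor_def linear_functor_def by blast
qed

definition precompose ::
  "nat set \<Rightarrow> (nat \<Rightarrow> ('o, 'a, 'k) lincat) \<Rightarrow> (nat \<Rightarrow> 'p, nat \<Rightarrow> 'b, 'q, 'c) fnctr \<Rightarrow>
   (nat \<Rightarrow> ('o, 'a, 'p, 'b) fnctr) \<Rightarrow> (nat \<Rightarrow> 'o, nat \<Rightarrow> 'a, 'q, 'c) fnctr" where
  "precompose A B F G =
     \<lparr>fo = (\<lambda>X \<in> Obj (Prod A B). fo F (\<lambda>i\<in>A. fo (G i) (X i))),
      fa = (\<lambda>u \<in> Arr (Prod A B). fa F (\<lambda>i\<in>A. fa (G i) (u i)))\<rparr>"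

lemma precompose_simps:
  "X \<in> Obj (Prod A B) \<Longrightarrow> fo (precompose A B F G) X = fo F (\<lambda>i\<in>A. fo (G i) (X i))"
  "u \<in> Arr (Prod A B) \<Longrightarrow> fa (precompose A B F G) u = fa F (\<lambda>i\<in>A. fa (G i) (u i))"
  by (simp_all add: precompose_def)

text \<open>Each \<open>G i\<close> acts in its own variable, so changing the entry at
  \<open>i\<close> and then applying the functors \<open>G\<close> is the same as changing the image
  tuple at \<open>i\<close> (\<open>upd\<close>). Linearity and exactness in slot \<open>i\<close>
  then follow from those of \<open>F\<close> and \<open>G i\<close>.\<close>

lemma multi_exact_precompose:
  assumes B: "\<And>i. i \<in> A \<Longrightarrow> linear_category (B i)"
    and F: "multi_exact A C D F" and G: "\<And>i. i \<in> A \<Longrightarrow> exact_functor (B i) (C i) (G i)"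
  shows "multi_exact A B D (precompose A B F G)"
  unfolding multi_exact_def
proof (intro conjI ballI allI impI)
  note cB = linear_category.axioms(1)[OF B]
  have FF: "is_functor (Prod A C) D F" using F by (simp add: multi_exact_def)
  note GG = exact_functor_functor[OF G]
  let ?G = "\<lambda>u. \<lambda>i\<in>A. fa (G i) (u i)" and ?O = "\<lambda>X. \<lambda>i\<in>A. fo (G i) (X i)"
  have h: "?G f \<in> hom (Prod A C) (?O X) (?O Y)" if "f \<in> hom (Prod A B) X Y" for f X Y
    using that functor_hom[OF GG] by (simp add: hom_Prod)
  have o: "?O X \<in> Obj (Prod A C)" if "X \<in> Obj (Prod A B)" for X
    using that functor_obj[OF GG] by (auto simp: Prod_simps PiE_def Pi_def)
  have idn: "?G (Idn (Prod A B) X) = Idn (Prod A C) (?O X)" if "X \<in> Obj (Prod A B)" for X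
    using that functor_idn[OF GG] by (auto simp: Prod_simps PiE_def Pi_def intro!: restrict_ext)
  have catP: "category (Prod A B)" by (rule category_Prod[OF cB])
  show "is_functor (Prod A B) D (precompose A B F G)"
  proof (rule is_functorI[OF catP])
    show "fa (precompose A B F G) f \<in> hom D (fo (precompose A B F G) X) (fo (precompose A B F G) Y)"
      if "f \<in> hom (Prod A B) X Y" for f X Y
      using functor_hom[OF FF h[OF that]] hom_arr[OF that] category.hom_obj[OF catP that]
      by (simp add: precompose_simps)
    show "fa (precompose A B F G) (Idn (Prod A B) X) = Idn D (fo (precompose A B F G) X)"
      if "X \<in> Obj (Prod A B)" for X
      using functor_idn[OF FF o[OF that]] idn[OF that] that
        hom_arr[OF category.idn_hom[OF catP that]] by (simp add: precompose_simps)
    show "fa (precompose A B F G) (Cmp (Prod A B) g f) =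
        Cmp D (fa (precompose A B F G) g) (fa (precompose A B F G) f)"
      if f: "f \<in> hom (Prod A B) X Y" and g: "g \<in> hom (Prod A B) Y Z" for f g X Y Z
    proof -
      have "fa (G i) (Cmp (B i) (g i) (f i)) = Cmp (C i) (fa (G i) (g i)) (fa (G i) (f i))" if "i \<in> A" for i
        using functor_cmp[OF GG[OF that], of "f i" "X i" "Y i" "g i" "Z i"] f g that by (simp add: hom_Prod)
      then have "?G (Cmp (Prod A B) g f) = Cmp (Prod A C) (?G g) (?G f)"
        by (auto simp: Prod_simps intro!: restrict_ext)
      then show ?thesis
        using functor_cmp[OF FF h[OF f] h[OF g]] hom_arr[OF f] hom_arr[OF g]
          hom_arr[OF category.cmp_hom[OF catP f g]] by (simp add: precompose_simps)
    qed
  qed (use functor_obj[OF FF o] in \<open>simp_all add: precompose_simps\<close>, simp_all add: precompose_def)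
  fix i assume i: "i \<in> A"
  interpret linear_category "B i" by (rule B[OF i])
  have upd: "?G (u(i := v)) = (?G u)(i := fa (G i) v)" for u v
    using i by (auto simp: fun_eq_iff)
  {
    fix u assume u: "u \<in> Arr (Prod A B)"
    have ui: "u i \<in> Arr (B i)" using u i by (auto simp: Prod_simps)
    have uv: "u(i := v) \<in> Arr (Prod A B)" if "v \<in> Arr (B i)" for v
      using u that i by (auto simp: Prod_simps PiE_def Pi_def extensional_def)
    have Gu: "?G u \<in> Arr (Prod A C)" using hom_arr[OF h[OF arr_hom[OF u]]] .
    have Gi: "(?G u) i = fa (G i) (u i)" using i by simp
    have hG: "fa (G i) v \<in> hom (C i) (Dom (C i) ((?G u) i)) (Cod (C i) ((?G u) i))"
      if "v \<in> hom (B i) (Dom (B i) (u i)) (Cod (B i) (u i))" for v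
      using functor_hom[OF GG[OF i] that] functor_hom[OF GG[OF i] arr_hom[OF ui]] Gi
      by (simp add: hom_def)
    show "fa (precompose A B F G) (u(i := Add (B i) (u i) v)) =
        Add D (fa (precompose A B F G) u) (fa (precompose A B F G) (u(i := v)))"
      if v: "v \<in> hom (B i) (Dom (B i) (u i)) (Cod (B i) (u i))" for v
    proof -
      have "fa (G i) (Add (B i) (u i) v) = Add (C i) (fa (G i) (u i)) (fa (G i) v)"
        using G[OF i] arr_hom[OF ui] v unfolding exact_functor_def linear_functor_def by blast
      moreover have "fa F ((?G u)(i := Add (C i) ((?G u) i) (fa (G i) v))) =
          Add D (fa F (?G u)) (fa F ((?G u)(i := fa (G i) v)))"
        using F i Gu hG[OF v] unfolding multi_exact_def by blast
      ultimately show ?thesis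
        using u uv[OF hom_arr[OF v]] uv[OF hom_arr[OF add_hom[OF arr_hom[OF ui] v]]] Gi i
        by (simp add: precompose_simps upd del: fun_upd_apply)
    qed
    show "fa (precompose A B F G) (u(i := Scl (B i) c (u i))) = Scl D c (fa (precompose A B F G) u)" for c
    proof -
      have "fa (G i) (Scl (B i) c (u i)) = Scl (C i) c (fa (G i) (u i))"
        using G[OF i] ui unfolding exact_functor_def linear_functor_def by blast
      moreover have "fa F ((?G u)(i := Scl (C i) c ((?G u) i))) = Scl D c (fa F (?G u))"
        using F i Gu unfolding multi_exact_def by blast
      ultimately show ?thesis
        using u uv[OF hom_arr[OF scl_hom[OF arr_hom[OF ui]]]] Gi i by (simp add: precompose_simps upd del: fun_upd_apply)
    qed
  }
  fix X f g assume X: "X \<in> Obj (Prod A B)" and fg: "short_exact (B i) f g"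
  have "short_exact (C i) (fa (G i) f) (fa (G i) g)" using G[OF i] fg by (simp add: exact_functor_def)
  then have "short_exact D (fa F ((Idn (Prod A C) (?O X))(i := fa (G i) f)))
      (fa F ((Idn (Prod A C) (?O X))(i := fa (G i) g)))"
    using F i o[OF X] unfolding multi_exact_def by blast
  moreover have "(Idn (Prod A B) X)(i := k) \<in> Arr (Prod A B)" if "k \<in> Arr (B i)" for k
    using hom_arr[OF category.idn_hom[OF catP X]] that i
    by (auto simp: Prod_simps PiE_def Pi_def extensional_def)
  ultimately show "short_exact D (fa (precompose A B F G) ((Idn (Prod A B) X)(i := f)))
      (fa (precompose A B F G) ((Idn (Prod A B) X)(i := g)))"
    using short_exact_arr[OF fg] idn[OF X] i by (simp add: precompose_simps upd del: fun_upd_apply)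
qed

lemma multi_exact_multi:
  assumes "linear_category (C i)" "exact_functor (C i) D F"
  shows "multi_exact {i} C D (multi i C F)"
proof -
  interpret linear_category "C i" by fact
  note F = exact_functor_functor[OF assms(2)]
  have cat: "category (Prod {i} C)" by (rule category_Prod) (simp add: category_axioms)
  have h: "f i \<in> hom (C i) (X i) (Y i)" if "f \<in> hom (Prod {i} C) X Y" for f X Y
    using that by (simp add: hom_Prod)
  have "is_functor (Prod {i} C) D (multi i C F)"
  proof (rule is_functorI[OF cat])
    show "fo (multi i C F) X \<in> Obj D" if "X \<in> Obj (Prod {i} C)" for X
      using that functor_obj[OF F, of "X i"] by (simp add: multi_simps) (auto simp: Prod_simps)
    show "fa (multi i C F) f \<in> hom D (fo (multi i C F) X) (fo (multi i C F) Y)"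
      if "f \<in> hom (Prod {i} C) X Y" for f X Y
      using functor_hom[OF F h[OF that]] hom_arr[OF that] category.hom_obj[OF cat that]
      by (simp add: multi_simps)
    show "fa (multi i C F) (Idn (Prod {i} C) X) = Idn D (fo (multi i C F) X)"
      if X: "X \<in> Obj (Prod {i} C)" for X
    proof -
      have "X i \<in> Obj (C i)" using X by (auto simp: Prod_simps)
      then show ?thesis
        using functor_idn[OF F] X hom_arr[OF category.idn_hom[OF cat X]]
        by (simp add: multi_simps) (simp add: Prod_simps)
    qed
    show "fa (multi i C F) (Cmp (Prod {i} C) g f) = Cmp D (fa (multi i C F) g) (fa (multi i C F) f)"
      if f: "f \<in> hom (Prod {i} C) X Y" and g: "g \<in> hom (Prod {i} C) Y Z" for f g X Y Z
      using functor_cmp[OF F h[OF f] h[OF g]] hom_arr[OF f] hom_arr[OF g]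
        hom_arr[OF category.cmp_hom[OF cat f g]] by (simp add: multi_simps) (simp add: Prod_simps)
  qed (simp_all add: multi_def)
  moreover have upd: "u(i := v) \<in> Arr (Prod {i} C)" if "u \<in> Arr (Prod {i} C)" "v \<in> Arr (C i)" for u v
    using that by (auto simp: Prod_simps PiE_def Pi_def extensional_def)
  have "fa (multi i C F) (u(i := Add (C i) (u i) v)) =
      Add D (fa (multi i C F) u) (fa (multi i C F) (u(i := v)))"
    if u: "u \<in> Arr (Prod {i} C)" and v: "v \<in> hom (C i) (Dom (C i) (u i)) (Cod (C i) (u i))" for u v
  proof -
    have "u i \<in> Arr (C i)" using u by (auto simp: Prod_simps)
    note ui = arr_hom[OF this]
    have "fa F (Add (C i) (u i) v) = Add D (fa F (u i)) (fa F v)"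
      using assms(2) ui v unfolding exact_functor_def linear_functor_def by blast
    then show ?thesis
      using u upd[OF u hom_arr[OF v]] upd[OF u hom_arr[OF add_hom[OF ui v]]] by (simp add: multi_simps)
  qed
  moreover have "fa (multi i C F) (u(i := Scl (C i) c (u i))) = Scl D c (fa (multi i C F) u)"
    if u: "u \<in> Arr (Prod {i} C)" for u c
  proof -
    have ui: "u i \<in> Arr (C i)" using u by (auto simp: Prod_simps)
    then have "fa F (Scl (C i) c (u i)) = Scl D c (fa F (u i))"
      using assms(2) unfolding exact_functor_def linear_functor_def by blast
    then show ?thesis
      using u upd[OF u hom_arr[OF scl_hom[OF arr_hom[OF ui]]]] by (simp add: multi_simps)
  qed
  moreover have "short_exact D (fa (multi i C F) ((Idn (Prod {i} C) X)(i := f)))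
      (fa (multi i C F) ((Idn (Prod {i} C) X)(i := g)))"
    if "X \<in> Obj (Prod {i} C)" "short_exact (C i) f g" for X f g
    using assms(2) that(2) short_exact_arr[OF that(2)] upd[OF hom_arr[OF category.idn_hom[OF cat that(1)]]]
    by (simp add: multi_simps exact_functor_def)
  ultimately show ?thesis unfolding multi_exact_def by blast
qed

section \<open>Functors of degree zero\<close>

definition preserves_degree ::
  "('o, 'a, 'k) grcat \<Rightarrow> ('p, 'b, 'k) grcat \<Rightarrow> (nat \<Rightarrow> 'o, nat \<Rightarrow> 'a, nat \<Rightarrow> 'p, nat \<Rightarrow> 'b) fnctr \<Rightarrow> bool"
  where
  "preserves_degree C D F \<longleftrightarrow>
     (\<forall>X n. homogeneous C (int n) X \<longrightarrow> homogeneous D (int n) (fo F X))"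

lemma homogeneous_obj: "homogeneous C d X \<Longrightarrow> X \<in> Obj (tot C)"
  by (simp add: homogeneous_def)

lemma preserves_degree_id: "preserves_degree C C (id_functor (tot C))"
  by (simp add: preserves_degree_def homogeneous_obj)

lemma preserves_degree_cmp:
  "preserves_degree A B F \<Longrightarrow> preserves_degree B C G \<Longrightarrow> preserves_degree A C (cmp_functor (tot A) G F)"
  by (simp add: preserves_degree_def homogeneous_obj)

lemma preserves_degree_single:
  assumes "of_degree 0 {i} C D F"
  shows "preserves_degree (C i) D (single i (tot (C i)) F)"
  unfolding preserves_degree_def
proof (intro allI impI)
  fix X n assume X: "homogeneous (C i) (int n) X"
  then have "(\<lambda>j\<in>{i}. X) \<in> Obj (Prod {i} (\<lambda>i. tot (C i)))"
    by (simp add: Prod_simps homogeneous_obj)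
  then have "homogeneous D (int (\<Sum>j \<in> {i}. n) + 0) (fo F (\<lambda>j\<in>{i}. X))"
    using assms X unfolding of_degree_def by fastforce
  then show "homogeneous D (int n) (fo (single i (tot (C i)) F) X)"
    using homogeneous_obj[OF X] by (simp add: single_simps)
qed

lemma of_degree_multi:
  assumes "preserves_degree (C i) D F"
  shows "of_degree 0 {i} C D (multi i (\<lambda>i. tot (C i)) F)"
  using assms by (simp add: of_degree_def preserves_degree_def multi_simps)

lemma of_degree_precompose:
  assumes "of_degree 0 A C D F" "\<And>i. i \<in> A \<Longrightarrow> preserves_degree (B i) (C i) (G i)"
  shows "of_degree 0 A B D (precompose A (\<lambda>i. tot (B i)) F G)"
  unfolding of_degree_def
proof (intro ballI allI impI)
  fix X and n :: "nat \<Rightarrow> nat"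
  assume X: "X \<in> Obj (Prod A (\<lambda>i. tot (B i)))" and n: "\<forall>i\<in>A. homogeneous (B i) (int (n i)) (X i)"
  have G: "homogeneous (C i) (int (n i)) (fo (G i) (X i))" if "i \<in> A" for i
    using assms(2)[OF that] n that unfolding preserves_degree_def by blast
  then have "(\<lambda>i\<in>A. fo (G i) (X i)) \<in> Obj (Prod A (\<lambda>i. tot (C i)))"
    using homogeneous_obj by (fastforce simp: Prod_simps)
  then have "homogeneous D (int (\<Sum>i\<in>A. n i) + 0) (fo F (\<lambda>i\<in>A. fo (G i) (X i)))"
    using assms(1) G unfolding of_degree_def by simp
  then show "homogeneous D (int (\<Sum>i\<in>A. n i) + 0) (fo (precompose A (\<lambda>i. tot (B i)) F G) X)"
    using X by (simp add: precompose_simps)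
qed

text \<open>A functor with a single degree is the one-term direct sum of itself, with identities as
  inclusion and projection.\<close>

lemma bounded_multi_exactI:
  assumes "linear_category (tot D)" "\<And>i. i \<in> A \<Longrightarrow> category (tot (C i))"
    and "multi_exact A (\<lambda>i. tot (C i)) (tot D) F" "of_degree d A C D F" "d \<in> L"
  shows "bounded_multi_exact L A C D F"
proof -
  interpret linear_category "tot D" by fact
  let ?P = "Prod A (\<lambda>i. tot (C i))"
  interpret P: category ?P by (rule category_Prod) (rule assms(2))
  have F: "is_functor ?P (tot D) F" using assms(3) by (simp add: multi_exact_def)
  define t where "t = (\<lambda>X \<in> Obj ?P. Idn (tot D) (fo F X))"
  have t: "t X \<in> hom (tot D) (fo F X) (fo F X)" if "X \<in> Obj ?P" for X
    using idn_hom functor_obj[OF F that] that by (simp add: t_def)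
  have nat: "nat_trans ?P (tot D) F F t"
    unfolding nat_trans_def
  proof (intro conjI ballI)
    show "t \<in> (\<Pi>\<^sub>E X \<in> Obj ?P. hom (tot D) (fo F X) (fo F X))" using t by (auto simp: t_def)
    fix f assume f: "f \<in> Arr ?P"
    note h = functor_hom[OF F arr_hom[OF f]]
    show "Cmp (tot D) (t (Cod ?P f)) (fa F f) = Cmp (tot D) (fa F f) (t (Dom ?P f))"
      using idn_left[OF h] idn_right[OF h] P.dom_obj[OF f] P.cod_obj[OF f] by (simp add: t_def)
  qed
  have "direct_sum (tot D) (Suc 0) (\<lambda>k. fo F X) (fo F X) (\<lambda>k. t X) (\<lambda>k. t X)" if "X \<in> Obj ?P" for X
  proof -
    note o = functor_obj[OF F that]
    have tt: "t X = Idn (tot D) (fo F X)" using that by (simp add: t_def)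
    note i = idn_hom[OF o]
    \<comment> \<open>\<open>sum_arr\<close> starts from zero, so the one-term sum is zero plus the
      identity.\<close>
    have "Add (tot D) (Zero (tot D) (fo F X) (fo F X)) (Idn (tot D) (fo F X)) = Idn (tot D) (fo F X)"
      using add_commute[OF zero_hom[OF o o] i] add_zero[OF i] by simp
    then show ?thesis
      unfolding direct_sum_def using o i idn_left[OF i] by (simp add: tt)
  qed
  then show ?thesis
    unfolding bounded_multi_exact_def Let_def
    using assms nat by (intro conjI exI[of _ "Suc 0"] exI[of _ "\<lambda>_. d"] exI[of _ "\<lambda>_. F"]
        exI[of _ "\<lambda>_. t"]) auto
qed

section \<open>The bicategory of collections\<close>

lemma graded_linear_category: "graded_two_vector_space C \<Longrightarrow> linear_category (tot C)"
  by (rule linear_category_tot) (auto simp: graded_two_vector_space_def two_vector_space_def)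

lemma graded_category: "graded_two_vector_space C \<Longrightarrow> category (tot C)"
  using graded_linear_category linear_category.axioms(1) by blast

lemma varrs_functor:
  assumes "F \<in> varrs L" "j \<in> fst (tgt F)"
  shows varrs_is_functor: "is_functor (vdom F j) (vcod F j) (cmps F j)"
    and varrs_multi_exact: "multi_exact (fibre (base F) j) (\<lambda>i. tot (snd (src F) i)) (vcod F j) (cmps F j)"
    and varrs_dom: "category (vdom F j)" and varrs_cod: "category (vcod F j)"
proof -
  show "multi_exact (fibre (base F) j) (\<lambda>i. tot (snd (src F) i)) (vcod F j) (cmps F j)"
    using assms by (auto simp: varrs_def bounded_multi_exact_def Let_def)
  then show "is_functor (vdom F j) (vcod F j) (cmps F j)" by (simp add: multi_exact_def)
  have "graded_two_vector_space (snd (src F) i)" if "i \<in> fst (src F)" for i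
    using assms that by (auto simp: varrs_def vobjs_def)
  moreover have "fibre (base F) j \<subseteq> fst (src F)"
    using assms by (auto simp: varrs_def pointed_map_def fibre_def)
  ultimately show "category (vdom F j)"
    by (intro category_Prod graded_category) blast
  have "graded_two_vector_space (snd (tgt F) j)"
    using assms by (auto simp: varrs_def vobjs_def)
  then show "category (vcod F j)" by (rule graded_category)
qed

lemma GrVect_simps [simp]:
  "Ob0 (GrVect L) = vobjs" "Ar1 (GrVect L) = varrs L" "dom1 (GrVect L) = src" "cod1 (GrVect L) = tgt"
  "id1 (GrVect L) = vid" "cmp1 (GrVect L) = vcomp" "Ar2 (GrVect L) = vcells L"
  "dom2 (GrVect L) = tsrc" "cod2 (GrVect L) = ttgt" "id2 (GrVect L) = vtid"
  "vcmp (GrVect L) = vtvert" "hcmp (GrVect L) = vthoriz"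
  by (simp_all add: GrVect_def)

lemma hom2_D:
  assumes "t \<in> hom2 (GrVect L) F G"
  shows "F \<in> varrs L" "G \<in> varrs L" "src G = src F" "tgt G = tgt F" "base G = base F"
    "tsrc t = F" "ttgt t = G"
    "\<And>j. j \<in> fst (tgt F) \<Longrightarrow> nat_trans (vdom F j) (vcod F j) (cmps F j) (cmps G j) (tcmps t j)"
  using assms by (auto simp: hom2_def vcells_def)

text \<open>Vertical composition of 2-cells is composition at each object, so an inverse 2-cell
  evaluates to inverses of the components.\<close>

lemma hom2_nat_iso:
  assumes t: "t \<in> hom2 (GrVect L) F G" "invertible2 (GrVect L) t" and j: "j \<in> fst (tgt F)"
  shows "nat_iso (vdom F j) (vcod F j) (cmps F j) (cmps G j) (tcmps t j)"
  unfolding nat_iso_def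
proof (intro conjI ballI)
  note D = hom2_D[OF t(1)]
  show "nat_trans (vdom F j) (vcod F j) (cmps F j) (cmps G j) (tcmps t j)" by (rule D(8)[OF j])
  fix X assume X: "X \<in> Obj (vdom F j)"
  obtain s where s: "inverse2 (GrVect L) t s" using t(2) by (auto simp: invertible2_def)
  then have s2: "s \<in> hom2 (GrVect L) G F" and st: "vtvert s t = vtid F" and ts: "vtvert t s = vtid G"
    using D(6,7) by (auto simp: inverse2_def)
  note E = hom2_D[OF s2]
  have tX: "tcmps t j X \<in> hom (vcod F j) (fo (cmps F j) X) (fo (cmps G j) X)"
    using D(8)[OF j] X by (auto simp: nat_trans_def)
  have sX: "tcmps s j X \<in> hom (vcod F j) (fo (cmps G j) X) (fo (cmps F j) X)"
    using E(8)[of j] j D(3-5) X by (auto simp: nat_trans_def)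
  have "Cmp (vcod F j) (tcmps s j X) (tcmps t j X) = Idn (vcod F j) (fo (cmps F j) X)"
    using arg_cong[OF st, of "\<lambda>c. tcmps c j X"] D E(6,7) j X by (simp add: vtvert_def vtid_def)
  moreover have "Cmp (vcod F j) (tcmps t j X) (tcmps s j X) = Idn (vcod F j) (fo (cmps G j) X)"
    using arg_cong[OF ts, of "\<lambda>c. tcmps c j X"] D E(6,7) j X by (simp add: vtvert_def vtid_def)
  ultimately show "iso_arr (vcod F j) (tcmps t j X)"
    by (rule category.isoI[OF varrs_cod[OF D(1) j] tX sX])
qed

text \<open>The pointwise inverses of natural isomorphisms are again natural and assemble to an
  inverse 2-cell. Extensionality of \<open>t\<close> is demanded because \<open>vcells\<close>
  consists of extensional families.\<close>

lemma cellI: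
  assumes F: "F \<in> varrs L" and G: "G \<in> varrs L"
    and FG: "src G = src F" "tgt G = tgt F" "base G = base F"
    and t: "t \<in> extensional (fst (tgt F))"
      "\<And>j. j \<in> fst (tgt F) \<Longrightarrow> nat_iso (vdom F j) (vcod F j) (cmps F j) (cmps G j) (t j)"
  shows "\<lparr>tsrc = F, ttgt = G, tcmps = t\<rparr> \<in> hom2 (GrVect L) F G"
    and "invertible2 (GrVect L) \<lparr>tsrc = F, ttgt = G, tcmps = t\<rparr>"
proof -
  show 1: "\<lparr>tsrc = F, ttgt = G, tcmps = t\<rparr> \<in> hom2 (GrVect L) F G"
    using F G FG t by (auto simp: hom2_def vcells_def nat_iso_def PiE_def)
  define s where "s = (\<lambda>j \<in> fst (tgt F). \<lambda>X \<in> Obj (vdom F j). inv_arr (vcod F j) (t j X))"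
  have s: "nat_iso (vdom F j) (vcod F j) (cmps G j) (cmps F j) (s j)" if j: "j \<in> fst (tgt F)" for j
  proof -
    have "is_functor (vdom F j) (vcod F j) (cmps G j)"
      using varrs_is_functor[OF G, of j] FG j by simp
    then show ?thesis
      using nat_iso_inverse[OF varrs_dom[OF F j] varrs_cod[OF F j] varrs_is_functor[OF F j] _ t(2)[OF j]] j
      by (simp add: s_def)
  qed
  have 2: "\<lparr>tsrc = G, ttgt = F, tcmps = s\<rparr> \<in> hom2 (GrVect L) G F"
    using F G FG s by (auto simp: hom2_def vcells_def nat_iso_def PiE_def s_def)
  have "Cmp (vcod F j) (s j X) (t j X) = Idn (vcod F j) (fo (cmps F j) X)"
    "Cmp (vcod F j) (t j X) (s j X) = Idn (vcod F j) (fo (cmps G j) X)"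
    if j: "j \<in> fst (tgt F)" and X: "X \<in> Obj (vdom F j)" for j X
    using category.inv_left[OF varrs_cod[OF F j] nat_iso_iso[OF t(2)[OF j] X] nat_iso_hom[OF t(2)[OF j] X]]
      category.inv_right[OF varrs_cod[OF F j] nat_iso_iso[OF t(2)[OF j] X] nat_iso_hom[OF t(2)[OF j] X]] j X
    by (simp_all add: s_def)
  then have "inverse2 (GrVect L) \<lparr>tsrc = F, ttgt = G, tcmps = t\<rparr> \<lparr>tsrc = G, ttgt = F, tcmps = s\<rparr>"
    using 1 2 FG by (auto simp: inverse2_def hom2_def vtvert_def vtid_def intro!: restrict_ext)
  then show "invertible2 (GrVect L) \<lparr>tsrc = F, ttgt = G, tcmps = t\<rparr>"
    by (auto simp: invertible2_def)
qed

section \<open>Copies of the one-point set\<close>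

lemma FinSetCop_simps:
  "Dom FinSetCop = src" "Cod FinSetCop = tgt"
  "Cmp FinSetCop t s = \<lparr>src = src s, tgt = tgt t, base = base t \<circ>\<^sub>m base s,
     cmps = (\<lambda>i \<in> dom (base t \<circ>\<^sub>m base s).
        \<lambda>x \<in> snd (src s) i. cmps t (the (base s i)) (cmps s i x))\<rparr>"
  by (simp_all add: FinSetCop_def Let_def)

lemma Obj_FinSetCop: "X \<in> Obj FinSetCop \<longleftrightarrow> finite (fst X) \<and> snd X \<in> (\<Pi>\<^sub>E i \<in> fst X. {T. finite T})"
  by (auto simp: FinSetCop_def Let_def split: prod.splits)

lemma Arr_FinSetCop: "s \<in> Arr FinSetCop \<longleftrightarrow> src s \<in> Obj FinSetCop \<and> tgt s \<in> Obj FinSetCop \<and>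
    pointed_map (fst (src s)) (base s) (fst (tgt s)) \<and>
    cmps s \<in> (\<Pi>\<^sub>E i \<in> dom (base s). snd (src s) i \<rightarrow>\<^sub>E snd (tgt s) (the (base s i)))"
  by (auto simp: FinSetCop_def Let_def)

lemma ones_obj: "finite I \<Longrightarrow> ones I \<in> Obj FinSetCop"
  by (simp add: Obj_FinSetCop ones_def)

lemma ids_hom: "pointed_map I \<phi> J \<Longrightarrow> ids I \<phi> J \<in> hom FinSetCop (ones I) (ones J)"
  unfolding hom_def mem_Collect_eq Arr_FinSetCop FinSetCop_simps ids_def
  by (auto simp: pointed_map_def ones_obj) (auto simp: ones_def ran_def)

lemma map_comp_eq_Some: "(\<psi> \<circ>\<^sub>m \<phi>) i = Some k \<longleftrightarrow> (\<exists>j. \<phi> i = Some j \<and> \<psi> j = Some k)"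
  by (auto simp: map_comp_def split: option.splits)

lemma ids_cmp:
  assumes "pointed_map I \<phi> J" "pointed_map J \<psi> K"
  shows "Cmp FinSetCop (ids J \<psi> K) (ids I \<phi> J) = ids I (\<psi> \<circ>\<^sub>m \<phi>) K"
  unfolding FinSetCop_simps ids_def
  using assms by (auto simp: pointed_map_def ones_def map_comp_eq_Some dom_def subset_iff intro!: restrict_ext)

lemma ids_idn: "Idn FinSetCop (ones I) = ids I (\<lambda>i. if i \<in> I then Some i else None) I"
  by (auto simp: FinSetCop_def Let_def ids_def ones_def dom_def intro!: restrict_ext)

text \<open>With only identity 2-cells the categories of arrows are discrete, and a bijection of
  objects is an equivalence; \<open>h\<close> is the inverse of precomposition with
  \<open>s\<close>.\<close>

lemma discrete_equivalence:
  fixes C :: "('o, 'a, 'm) cat_scheme"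
  assumes inv: "\<And>f. f \<in> hom C y z \<Longrightarrow> p f = b \<Longrightarrow> Cmp C f s \<in> hom C x z \<and> p (Cmp C f s) = b' \<and> h (Cmp C f s) = f"
    and h: "\<And>f. f \<in> hom C x z \<Longrightarrow> p f = b' \<Longrightarrow> h f \<in> hom C y z \<and> p (h f) = b \<and> Cmp C (h f) s = f"
  shows "is_equivalence (arrows_over (discrete_bicat C) p y z b) (arrows_over (discrete_bicat C) p x z b')
    (precomposition (discrete_bicat C) s (arrows_over (discrete_bicat C) p y z b))"
proof -
  define A where "A = {f \<in> hom C y z. p f = b}"
  define B where "B = {f \<in> hom C x z. p f = b'}"
  define D :: "'a set \<Rightarrow> ('a, 'a) cat" where
    "D S = \<lparr>Obj = S, Arr = S, Dom = (\<lambda>f. f), Cod = (\<lambda>f. f), Idn = (\<lambda>f. f), Cmp = (\<lambda>g f. f)\<rparr>" for S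
  have o: "arrows_over (discrete_bicat C) p y z b = D A" "arrows_over (discrete_bicat C) p x z b' = D B"
    by (auto simp: arrows_over_def discrete_bicat_def D_def A_def B_def hom1_def hom_def Let_def)
  define F :: "('a, 'a, 'a, 'a) fnctr" where "F = \<lparr>fo = (\<lambda>f\<in>A. Cmp C f s), fa = (\<lambda>f\<in>A. Cmp C f s)\<rparr>"
  define G :: "('a, 'a, 'a, 'a) fnctr" where "G = \<lparr>fo = (\<lambda>f\<in>B. h f), fa = (\<lambda>f\<in>B. h f)\<rparr>"
  have Fp: "precomposition (discrete_bicat C) s (D A) = F"
    by (simp add: precomposition_def discrete_bicat_def D_def F_def)
  have iso: "iso_arr (D S) f" if "f \<in> S" for S f
    using that by (auto simp: iso_arr_def inverse_arrows_def D_def hom_def)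
  have "is_functor (D A) (D B) F" "is_functor (D B) (D A) G"
    using inv h by (auto simp: is_functor_def D_def F_def G_def A_def B_def)
  moreover have "nat_iso (D A) (D A) (id_functor (D A)) (cmp_functor (D A) G F) (\<lambda>f\<in>A. f)"
    "nat_iso (D B) (D B) (cmp_functor (D B) F G) (id_functor (D B)) (\<lambda>f\<in>B. f)"
    using inv h iso by (auto simp: nat_iso_def nat_trans_def id_functor_def cmp_functor_def hom_def
        D_def F_def G_def A_def B_def)
  ultimately show ?thesis unfolding o Fp is_equivalence_def by blast
qed

lemma collapse_hom: "finite I \<Longrightarrow> S \<subseteq> I \<Longrightarrow> collapse I S \<in> hom FinSetCop (ones I) (ones {1})"
  unfolding collapse_def by (rule ids_hom) (auto simp: pointed_map_def dom_def ran_def)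

text \<open>All indices except \<open>i\<close> go to the base point, so an arrow out of
  \<open>ones I\<close> over a map factoring through the collapse has at most one component, the one
  at \<open>i\<close>. As the collapse is the identity of the one-point set there, this component is
  the same datum as an arrow out of \<open>ones {1}\<close>.\<close>

lemma cocartesian_collapse:
  assumes I: "finite I" "i \<in> I"
  shows "cocartesian (discrete_bicat FinSetCop) FinSetPt proj0 proj1 (collapse I {i})"
  unfolding cocartesian_def
proof (intro conjI ballI)
  let ?c = "collapse I {i}"
  let ?r = "\<lambda>k. if k \<in> {i} then Some 1 else None :: nat option"
  have c: "?c \<in> hom FinSetCop (ones I) (ones {1})" using collapse_hom I by blast
  then show "?c \<in> Ar1 (discrete_bicat FinSetCop)" by (simp add: discrete_bicat_def hom_def)
  have cs: "src ?c = ones I" "tgt ?c = ones {1}" "base ?c = ?r"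
    "cmps ?c = (\<lambda>k \<in> {i}. \<lambda>x \<in> {1}. x)"
    by (auto simp: collapse_def ids_def dom_def)
  fix z g assume z: "z \<in> Ob0 (discrete_bicat FinSetCop)"
    and g: "g \<in> hom FinSetPt (proj0 (cod1 (discrete_bicat FinSetCop) ?c)) (proj0 z)"
  then have z': "z \<in> Obj FinSetCop" by (simp add: discrete_bicat_def)
  from g obtain \<psi> where g': "g = ({1}, \<psi>, fst z)" and \<psi>: "pointed_map {1} \<psi> (fst z)"
    by (auto simp: discrete_bicat_def FinSetCop_simps cs proj0_def ones_def FinSetPt_def hom_def)
  have p1: "Cmp FinSetPt g (proj1 ?c) = (I, \<psi> \<circ>\<^sub>m ?r, fst z)"
    by (simp add: g' FinSetPt_def proj1_def cs ones_def)
  have dom\<psi>: "dom \<psi> \<subseteq> {1}" using \<psi> by (simp add: pointed_map_def)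
  \<comment> \<open>The domain of \<open>\<psi>\<close> is \<open>{1}\<close> or empty;
    \<open>domc\<close> and \<open>dom1\<close> cover both cases at once.\<close>
  have domc: "dom (\<psi> \<circ>\<^sub>m ?r) = (if 1 \<in> dom \<psi> then {i} else {})"
    using dom\<psi> by (auto simp: map_comp_def dom_def split: if_splits)
  have dom1: "dom \<psi> = (if 1 \<in> dom \<psi> then {1} else {})"
    using subset_singletonD[OF dom\<psi>] by (elim disjE) simp_all
  \<comment> \<open>The inverse moves the component at \<open>i\<close> to the index
    \<open>1\<close>; when \<open>\<psi>\<close> is empty there is no component to move.\<close>
  define h :: "farr \<Rightarrow> farr" where
    "h f = \<lparr>src = ones {1}, tgt = z, base = \<psi>, cmps = (\<lambda>k \<in> dom \<psi>. cmps f i)\<rparr>" for f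
  have src: "dom1 (discrete_bicat FinSetCop) ?c = ones I" "cod1 (discrete_bicat FinSetCop) ?c = ones {1}"
    by (simp_all add: discrete_bicat_def FinSetCop_simps cs)
  show "is_equivalence
     (arrows_over (discrete_bicat FinSetCop) proj1 (cod1 (discrete_bicat FinSetCop) ?c) z g)
     (arrows_over (discrete_bicat FinSetCop) proj1 (dom1 (discrete_bicat FinSetCop) ?c) z
       (Cmp FinSetPt g (proj1 ?c)))
     (precomposition (discrete_bicat FinSetCop) ?c
       (arrows_over (discrete_bicat FinSetCop) proj1 (cod1 (discrete_bicat FinSetCop) ?c) z g))"
    unfolding src
  proof (rule discrete_equivalence[where h = h])
    fix f assume f: "f \<in> hom FinSetCop (ones {1}) z" "proj1 f = g"
    then have fs': "src f = ones {1}" "tgt f = z" "base f = \<psi>"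
      by (simp_all add: hom_def FinSetCop_simps proj1_def g')
    with f have "cmps f \<in> (\<Pi>\<^sub>E k \<in> dom \<psi>. snd (ones {1}) k \<rightarrow>\<^sub>E snd z (the (\<psi> k)))"
      by (simp add: hom_def Arr_FinSetCop)
    note fs = fs' this
    have f1: "cmps f 1 \<in> {1} \<rightarrow>\<^sub>E snd z (the (\<psi> 1))" if "1 \<in> dom \<psi>"
      using PiE_mem[OF fs(4) that] by (simp add: ones_def)
    have cmp: "Cmp FinSetCop f ?c = \<lparr>src = ones I, tgt = z, base = \<psi> \<circ>\<^sub>m ?r,
        cmps = (\<lambda>k \<in> dom (\<psi> \<circ>\<^sub>m ?r). cmps f 1)\<rparr>"
      using I f1 unfolding FinSetCop_simps cs fs domc
      by (auto simp: ones_def fun_eq_iff extensional_def PiE_def)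
    have "pointed_map I (\<psi> \<circ>\<^sub>m ?r) (fst z)"
      using \<psi> I by (auto simp: pointed_map_def ran_def map_comp_eq_Some split: if_splits)
    then have "Cmp FinSetCop f ?c \<in> hom FinSetCop (ones I) z"
      unfolding hom_def mem_Collect_eq Arr_FinSetCop FinSetCop_simps(1,2) cmp
      using f1 z' I domc by (auto simp: ones_obj) (auto simp: ones_def)
    moreover have "(\<lambda>k \<in> dom \<psi>. (\<lambda>k \<in> dom (\<psi> \<circ>\<^sub>m ?r). cmps f 1) i) = cmps f"
    proof (rule extensionalityI[of _ "dom \<psi>"])
      fix k assume k: "k \<in> dom \<psi>"
      then have "k = 1" using dom\<psi> by auto
      then show "(\<lambda>k \<in> dom \<psi>. (\<lambda>k \<in> dom (\<psi> \<circ>\<^sub>m ?r). cmps f 1) i) k = cmps f k"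
        using k unfolding domc by simp
    qed (use fs(4) in \<open>auto simp: PiE_def\<close>)
    then have "h (Cmp FinSetCop f ?c) = f"
      unfolding h_def cmp using fs(1-3) by simp
    ultimately show "Cmp FinSetCop f ?c \<in> hom FinSetCop (ones I) z \<and>
        proj1 (Cmp FinSetCop f ?c) = Cmp FinSetPt g (proj1 ?c) \<and> h (Cmp FinSetCop f ?c) = f"
      by (simp add: p1) (simp add: proj1_def cmp ones_def)
  next
    fix f assume f: "f \<in> hom FinSetCop (ones I) z" "proj1 f = Cmp FinSetPt g (proj1 ?c)"
    then have fs': "src f = ones I" "tgt f = z" "base f = \<psi> \<circ>\<^sub>m ?r"
      unfolding p1 by (simp_all add: hom_def FinSetCop_simps proj1_def)
    with f have "cmps f \<in> (\<Pi>\<^sub>E k \<in> dom (\<psi> \<circ>\<^sub>m ?r). snd (ones I) k \<rightarrow>\<^sub>E snd z (the ((\<psi> \<circ>\<^sub>m ?r) k)))"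
      by (simp add: hom_def Arr_FinSetCop)
    note fs = fs' this
    have fi: "cmps f i \<in> {1} \<rightarrow>\<^sub>E snd z (the (\<psi> 1))" if "1 \<in> dom \<psi>"
      using PiE_mem[OF fs(4), of i] that I unfolding domc by (simp add: ones_def map_comp_def)
    have "cmps f i \<in> snd (ones {1}) k \<rightarrow>\<^sub>E snd z (the (\<psi> k))" if k: "k \<in> dom \<psi>" for k
    proof -
      have "k = 1" using k dom\<psi> by auto
      then show ?thesis using fi k by (simp add: ones_def)
    qed
    then have "h f \<in> hom FinSetCop (ones {1}) z"
      unfolding hom_def mem_Collect_eq Arr_FinSetCop FinSetCop_simps(1,2) h_def coll_arr.simps restrict_PiE_iff
      using z' \<psi> by (simp add: ones_obj) (simp add: ones_def)
    moreover have "proj1 (h f) = g" by (simp add: proj1_def h_def g' ones_def)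
    moreover have "(\<lambda>k \<in> dom (\<psi> \<circ>\<^sub>m ?r). \<lambda>x \<in> snd (ones I) k.
        (\<lambda>k \<in> dom \<psi>. cmps f i) (the (?r k)) ((\<lambda>k \<in> {i}. \<lambda>x \<in> {1}. x) k x)) = cmps f"
    proof (rule extensionalityI[of _ "dom (\<psi> \<circ>\<^sub>m ?r)"])
      fix k assume k: "k \<in> dom (\<psi> \<circ>\<^sub>m ?r)"
      then have ki: "k = i" and 1: "1 \<in> dom \<psi>" unfolding domc by (auto split: if_splits)
      have "snd (ones I) i = {1}" using I by (simp add: ones_def)
      then show "(\<lambda>k \<in> dom (\<psi> \<circ>\<^sub>m ?r). \<lambda>x \<in> snd (ones I) k.
          (\<lambda>k \<in> dom \<psi>. cmps f i) (the (?r k)) ((\<lambda>k \<in> {i}. \<lambda>x \<in> {1}. x) k x)) k = cmps f k"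
        using k 1 fi[OF 1] unfolding ki
        by (intro extensionalityI[of _ "{1}"]) (auto simp: PiE_def)
    qed (use fs(4) in \<open>auto simp: PiE_def\<close>)
    then have "Cmp FinSetCop (h f) ?c = f"
      unfolding FinSetCop_simps cs h_def using fs(1-3) by simp
    ultimately show "h f \<in> hom FinSetCop (ones {1}) z \<and> proj1 (h f) = g \<and> Cmp FinSetCop (h f) ?c = f"
      by simp
  qed
qed

lemma fibre_map_comp: "fibre (\<psi> \<circ>\<^sub>m \<phi>) k = (\<Union>j \<in> fibre \<psi> k. fibre \<phi> j)"
  by (auto simp: fibre_def map_comp_eq_Some)

section \<open>Evaluating composites and whiskerings of collections\<close>

lemma vcomp_simps [simp]:
  "src (vcomp G F) = src F" "tgt (vcomp G F) = tgt G" "base (vcomp G F) = base G \<circ>\<^sub>m base F"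
  by (simp_all add: vcomp_def)

lemma cmps_vcomp:
  assumes "k \<in> fst (tgt G)"
  shows "A \<in> Obj (vdom (vcomp G F) k) \<Longrightarrow> fo (cmps (vcomp G F) k) A =
      fo (cmps G k) (\<lambda>j \<in> fibre (base G) k. fo (cmps F j) (restrict A (fibre (base F) j)))"
    and "u \<in> Arr (vdom (vcomp G F) k) \<Longrightarrow> fa (cmps (vcomp G F) k) u =
      fa (cmps G k) (\<lambda>j \<in> fibre (base G) k. fa (cmps F j) (restrict u (fibre (base F) j)))"
  using assms by (simp_all add: vcomp_def Let_def)

lemma varrs_fibre: "F \<in> varrs L \<Longrightarrow> j \<in> fibre (base F) k \<Longrightarrow> j \<in> fst (src F)"
  by (auto simp: varrs_def pointed_map_def fibre_def)

lemma restrict_Obj_Prod: "A \<in> Obj (Prod I K) \<Longrightarrow> J \<subseteq> I \<Longrightarrow> restrict A J \<in> Obj (Prod J K)"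
  by (auto simp: Prod_simps)

lemma restrict_hom_Prod:
  "u \<in> hom (Prod I K) A B \<Longrightarrow> J \<subseteq> I \<Longrightarrow> restrict u J \<in> hom (Prod J K) (restrict A J) (restrict B J)"
  by (auto simp: hom_Prod)

lemma vcomp_obj:
  assumes "G \<in> varrs L" "F \<in> varrs L" "tgt F = src G" "A \<in> Obj (vdom (vcomp G F) k)"
  shows "(\<lambda>j \<in> fibre (base G) k. fo (cmps F j) (restrict A (fibre (base F) j))) \<in> Obj (vdom G k)"
    and "j \<in> fibre (base G) k \<Longrightarrow> restrict A (fibre (base F) j) \<in> Obj (vdom F j)"
proof -
  show 1: "restrict A (fibre (base F) j) \<in> Obj (vdom F j)" if "j \<in> fibre (base G) k" for j
    using assms(4) that by (intro restrict_Obj_Prod) (auto simp: fibre_map_comp)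
  have "fo (cmps F j) (restrict A (fibre (base F) j)) \<in> Obj (tot (snd (src G) j))"
    if "j \<in> fibre (base G) k" for j
    using functor_obj[OF varrs_is_functor[OF assms(2)] 1[OF that]] varrs_fibre[OF assms(1) that] assms(3)
    by simp
  then show "(\<lambda>j \<in> fibre (base G) k. fo (cmps F j) (restrict A (fibre (base F) j))) \<in> Obj (vdom G k)"
    by (simp add: Prod_simps)
qed

text \<open>Horizontal composition with the identity of \<open>G\<close> is the image of
  \<open>t\<close> under \<open>G\<close> followed by an identity, which cancels.\<close>

lemma tcmps_whisker_left:
  assumes t: "t \<in> hom2 (GrVect L) F F'" and G: "G \<in> varrs L" and FG: "tgt F = src G"
    and k: "k \<in> fst (tgt G)" and A: "A \<in> Obj (vdom (vcomp G F) k)"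
  shows "tcmps (vthoriz (vtid G) t) k A =
    fa (cmps G k) (\<lambda>j \<in> fibre (base G) k. tcmps t j (restrict A (fibre (base F) j)))"
proof -
  note D = hom2_D[OF t]
  note sub = vcomp_obj(2)[OF G D(1) FG A]
  have A': "A \<in> Obj (vdom (vcomp G F') k)" using A D(3,5) by simp
  note o' = vcomp_obj(1)[OF G D(2) _ A'] 
  let ?X = "\<lambda>j \<in> fibre (base G) k. fo (cmps F j) (restrict A (fibre (base F) j))"
  let ?Y = "\<lambda>j \<in> fibre (base G) k. fo (cmps F' j) (restrict A (fibre (base F) j))"
  let ?u = "\<lambda>j \<in> fibre (base G) k. tcmps t j (restrict A (fibre (base F) j))"
  have Y: "?Y \<in> Obj (vdom G k)" using o' D(4,5) FG by simp
  have "tcmps t j (restrict A (fibre (base F) j)) \<in> hom (tot (snd (src G) j))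
      (fo (cmps F j) (restrict A (fibre (base F) j))) (fo (cmps F' j) (restrict A (fibre (base F) j)))"
    if j: "j \<in> fibre (base G) k" for j
  proof -
    have "j \<in> fst (tgt F)" using varrs_fibre[OF G j] FG by simp
    from D(8)[OF this] sub[OF j] show ?thesis using FG by (auto simp: nat_trans_def)
  qed
  then have "?u \<in> hom (vdom G k) ?X ?Y" by (simp add: hom_Prod)
  note u = functor_hom[OF varrs_is_functor[OF G k] this]
  show ?thesis
    using category.idn_left[OF varrs_cod[OF G k] u] k A Y D(6,7)
    by (simp add: vthoriz_def vtid_def Let_def)
qed

text \<open>Here the factor inside \<open>G\<close> is a tuple of identities, which \<open>G\<close>
  preserves, so only \<open>s\<close> at the image of \<open>A\<close> under \<open>F\<close>
  remains.\<close>

lemma tcmps_whisker_right: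
  assumes s: "s \<in> hom2 (GrVect L) G G'" and F: "F \<in> varrs L"
    and FG: "tgt F = src G" and k: "k \<in> fst (tgt G)" and A: "A \<in> Obj (vdom (vcomp G F) k)"
  shows "tcmps (vthoriz s (vtid F)) k A =
    tcmps s k (\<lambda>j \<in> fibre (base G) k. fo (cmps F j) (restrict A (fibre (base F) j)))"
proof -
  note D = hom2_D[OF s]
  note o = vcomp_obj[OF D(1) F FG A]
  let ?X = "\<lambda>j \<in> fibre (base G) k. fo (cmps F j) (restrict A (fibre (base F) j))"
  have "(\<lambda>j \<in> fibre (base G) k. tcmps (vtid F) j (restrict A (fibre (base F) j))) = Idn (vdom G k) ?X"
    unfolding Prod_simps
  proof (rule restrict_ext)
    fix j assume j: "j \<in> fibre (base G) k"
    then have "j \<in> fst (tgt F)" using varrs_fibre[OF D(1)] FG by simp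
    then show "tcmps (vtid F) j (restrict A (fibre (base F) j)) = Idn (tot (snd (src G) j)) (?X j)"
      using o(2)[OF j] j FG by (simp add: vtid_def)
  qed
  moreover have "tcmps s k ?X \<in> hom (vcod G k) (fo (cmps G k) ?X) (fo (cmps G' k) ?X)"
    using D(8)[OF k] o(1) by (auto simp: nat_trans_def)
  ultimately show ?thesis
    using category.idn_right[OF varrs_cod[OF D(1) k]] k A D(6,7) functor_idn[OF varrs_is_functor[OF D(1) k] o(1)]
    by (simp add: vthoriz_def Let_def) (simp add: vtid_def)
qed

text \<open>A 1-cell over an identity map amounts to one functor for each index. The Segal arrow,
  its inverse and the identities have this form, so the equivalence can be checked index by
  index.\<close>

definition diag :: "('o, 'a, 'k) vobj \<Rightarrow> ('o, 'a, 'k) vobj \<Rightarrow>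
    (nat \<Rightarrow> (nat \<Rightarrow> 'o, nat \<Rightarrow> 'a, nat \<Rightarrow> 'o, nat \<Rightarrow> 'a) fnctr) \<Rightarrow> ('o, 'a, 'k) varr" where
  "diag X Y F = \<lparr>src = X, tgt = Y, base = (\<lambda>i. if i \<in> fst X then Some i else None),
     cmps = (\<lambda>i \<in> fst X. multi i (\<lambda>i. tot (snd X i)) (F i))\<rparr>"

lemma fibre_id: "fibre (\<lambda>i. if i \<in> I then Some i else None) j = (if j \<in> I then {j} else {})"
  by (auto simp: fibre_def)

lemma diag_simps [simp]:
  "src (diag X Y F) = X" "tgt (diag X Y F) = Y" "base (diag X Y F) = (\<lambda>i. if i \<in> fst X then Some i else None)"
  "i \<in> fst X \<Longrightarrow> cmps (diag X Y F) i = multi i (\<lambda>i. tot (snd X i)) (F i)"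
  by (simp_all add: diag_def)

lemma vobjs_graded: "X \<in> vobjs \<Longrightarrow> i \<in> fst X \<Longrightarrow> graded_two_vector_space (snd X i)"
  by (auto simp: vobjs_def)

lemma diag_varrs:
  assumes "X \<in> vobjs" "Y \<in> vobjs" "fst X = fst Y"
    and F: "\<And>i. i \<in> fst X \<Longrightarrow> exact_functor (tot (snd X i)) (tot (snd Y i)) (F i)"
      "\<And>i. i \<in> fst X \<Longrightarrow> preserves_degree (snd X i) (snd Y i) (F i)"
  shows "diag X Y F \<in> varrs {0..}"
proof -
  have "bounded_multi_exact {0..} {i} (snd X) (snd Y i) (multi i (\<lambda>i. tot (snd X i)) (F i))"
    if "i \<in> fst X" for i
    using that assms vobjs_graded[OF assms(1), of i] vobjs_graded[OF assms(2), of i]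
    by (intro bounded_multi_exactI[where d = 0] graded_linear_category graded_category multi_exact_multi
        of_degree_multi) auto
  moreover have "finite (fst X)" using assms by (auto simp: vobjs_def)
  ultimately show ?thesis
    using assms(1-3) by (auto simp: varrs_def fibre_id pointed_map_def dom_def ran_def diag_def)
qed

lemma fnctr_eqI:
  fixes F G :: "('o, 'a, 'p, 'b) fnctr"
  assumes "fo F \<in> extensional (Obj C)" "fo G \<in> extensional (Obj C)"
    "fa F \<in> extensional (Arr C)" "fa G \<in> extensional (Arr C)"
    "\<And>X. X \<in> Obj C \<Longrightarrow> fo F X = fo G X" "\<And>u. u \<in> Arr C \<Longrightarrow> fa F u = fa G u"
  shows "F = G"
  using extensionalityI[OF assms(1,2,5)] extensionalityI[OF assms(3,4,6)] by simp

lemma id_map_comp: "(\<lambda>i. if i \<in> I then Some i else None) \<circ>\<^sub>m (\<lambda>i. if i \<in> I then Some i else None) =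
    (\<lambda>i. if i \<in> I then Some i else None)"
  by (auto simp: map_comp_def)

text \<open>The equality is strict, not up to isomorphism: the functors involved are extensional, so
  agreement on the objects and arrows of the product category suffices.\<close>

lemma vcomp_diag:
  assumes "fst X = fst Y" "fst Y = fst Z"
    and F: "\<And>i. i \<in> fst X \<Longrightarrow> is_functor (tot (snd X i)) (tot (snd Y i)) (F i)"
  shows "vcomp (diag Y Z G) (diag X Y F) = diag X Z (\<lambda>i. cmp_functor (tot (snd X i)) (G i) (F i))"
proof -
  have "cmps (vcomp (diag Y Z G) (diag X Y F)) i =
      cmps (diag X Z (\<lambda>i. cmp_functor (tot (snd X i)) (G i) (F i))) i" (is "?L = ?R")
    if i: "i \<in> fst X" for i
  proof (rule fnctr_eqI[where C = "Prod {i} (\<lambda>i. tot (snd X i))"])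
    have d: "vdom (vcomp (diag Y Z G) (diag X Y F)) i = Prod {i} (\<lambda>i. tot (snd X i))"
      using i assms(1) by (simp add: id_map_comp fibre_id)
    have i': "i \<in> fst (tgt (diag Y Z G))" using i assms by simp
    have iY: "i \<in> fst Y" using i assms by simp
    show "fo ?L A = fo ?R A" if A: "A \<in> Obj (Prod {i} (\<lambda>i. tot (snd X i)))" for A
    proof -
      have "A i \<in> Obj (tot (snd X i))" and r: "restrict A {i} = A" using A by (auto simp: Prod_simps)
      moreover from this have "(\<lambda>j\<in>{i}. fo (F j) (A j)) \<in> Obj (Prod {i} (\<lambda>i. tot (snd Y i)))"
        using functor_obj[OF F[OF i]] by (simp add: Prod_simps)
      moreover have "fo ?L A = fo (multi i (\<lambda>i. tot (snd Y i)) (G i)) (\<lambda>j\<in>{i}. fo (F j) (A j))"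
        using cmps_vcomp(1)[OF i', of A "diag X Y F", unfolded d, OF A] i iY assms(1) r A
        by (simp add: fibre_id multi_simps cong: restrict_cong)
      ultimately show ?thesis using i A by (simp add: multi_simps)
    qed
    show "fa ?L u = fa ?R u" if A: "u \<in> Arr (Prod {i} (\<lambda>i. tot (snd X i)))" for u
    proof -
      have ui: "u i \<in> Arr (tot (snd X i))" and r: "restrict u {i} = u" using A by (auto simp: Prod_simps)
      moreover from this have "(\<lambda>j\<in>{i}. fa (F j) (u j)) \<in> Arr (Prod {i} (\<lambda>i. tot (snd Y i)))"
        using hom_arr[OF functor_hom[OF F[OF i] arr_hom[OF ui]]] by (simp add: Prod_simps)
      moreover have "fa ?L u = fa (multi i (\<lambda>i. tot (snd Y i)) (G i)) (\<lambda>j\<in>{i}. fa (F j) (u j))"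
        using cmps_vcomp(2)[OF i', of u "diag X Y F", unfolded d, OF A] i iY assms(1) r A
        by (simp add: fibre_id multi_simps cong: restrict_cong)
      ultimately show ?thesis using i A by (simp add: multi_simps)
    qed
    show "fo ?L \<in> extensional (Obj (Prod {i} (\<lambda>i. tot (snd X i))))"
      "fa ?L \<in> extensional (Arr (Prod {i} (\<lambda>i. tot (snd X i))))"
      using d i' by (simp_all add: vcomp_def Let_def)
    show "fo ?R \<in> extensional (Obj (Prod {i} (\<lambda>i. tot (snd X i))))"
      "fa ?R \<in> extensional (Arr (Prod {i} (\<lambda>i. tot (snd X i))))"
      using i by (simp_all add: multi_def)
  qed
  moreover have "cmps (vcomp (diag Y Z G) (diag X Y F)) \<in> extensional (fst X)"
    using assms by (simp add: vcomp_def)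
  ultimately have "cmps (vcomp (diag Y Z G) (diag X Y F)) =
      cmps (diag X Z (\<lambda>i. cmp_functor (tot (snd X i)) (G i) (F i)))"
    by (intro extensionalityI[of _ "fst X"]) (simp_all add: diag_def)
  then show ?thesis
    using assms by (intro coll_arr.equality) (simp_all add: id_map_comp)
qed

lemma vid_diag: "vid X = diag X X (\<lambda>i. id_functor (tot (snd X i)))"
proof -
  have "\<lparr>fo = (\<lambda>A \<in> Obj (Prod {i} (\<lambda>i. tot (snd X i))). A i),
        fa = (\<lambda>u \<in> Arr (Prod {i} (\<lambda>i. tot (snd X i))). u i)\<rparr> =
      multi i (\<lambda>i. tot (snd X i)) (id_functor (tot (snd X i)))" for i
    by (auto simp: multi_def Prod_simps id_functor_def restrict_def PiE_def Pi_def fun_eq_iff)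
  then show ?thesis by (simp add: vid_def diag_def)
qed

lemma diag_cell:
  assumes F: "diag X Y F \<in> varrs L" and G: "diag X Y G \<in> varrs L" and XY: "fst X = fst Y"
    and t: "\<And>i. i \<in> fst X \<Longrightarrow> nat_iso (tot (snd X i)) (tot (snd Y i)) (F i) (G i) (t i)"
  shows "\<exists>s \<in> hom2 (GrVect L) (diag X Y F) (diag X Y G). invertible2 (GrVect L) s"
proof -
  define s where "s = (\<lambda>i \<in> fst Y. \<lambda>A \<in> Obj (vdom (diag X Y F) i). t i (A i))"
  have s: "nat_iso (vdom (diag X Y F) i) (vcod (diag X Y F) i) (cmps (diag X Y F) i) (cmps (diag X Y G) i) (s i)"
    if i: "i \<in> fst Y" for i
  proof -
    have d: "vdom (diag X Y F) i = Prod {i} (\<lambda>i. tot (snd X i))" "i \<in> fst X"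
      using i XY by (simp_all add: fibre_id)
    have s': "s i = (\<lambda>A \<in> Obj (Prod {i} (\<lambda>i. tot (snd X i))). t i (A i))"
      using i d by (simp add: s_def)
    have o: "A i \<in> Obj (tot (snd X i))" if "A \<in> Obj (Prod {i} (\<lambda>i. tot (snd X i)))" for A
      using that by (auto simp: Prod_simps)
    note c = varrs_dom[OF F, of i]
    have "nat_iso (Prod {i} (\<lambda>i. tot (snd X i))) (tot (snd Y i)) (multi i (\<lambda>i. tot (snd X i)) (F i))
        (multi i (\<lambda>i. tot (snd X i)) (G i)) (s i)"
    proof (rule nat_isoI)
      fix f A B assume f: "f \<in> hom (Prod {i} (\<lambda>i. tot (snd X i))) A B"
      then have fi: "f i \<in> hom (tot (snd X i)) (A i) (B i)" by (simp add: hom_Prod)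
      have AB: "A \<in> Obj (Prod {i} (\<lambda>i. tot (snd X i)))" "B \<in> Obj (Prod {i} (\<lambda>i. tot (snd X i)))"
        using category.hom_obj[OF c, of f A B] i f d by simp_all
      show "Cmp (tot (snd Y i)) (s i B) (fa (multi i (\<lambda>i. tot (snd X i)) (F i)) f) =
          Cmp (tot (snd Y i)) (fa (multi i (\<lambda>i. tot (snd X i)) (G i)) f) (s i A)"
        using nat_iso_nat[OF t[OF d(2)] fi] AB hom_arr[OF f] by (simp add: s' multi_simps)
    qed (use nat_isoD[OF t[OF d(2)]] o in \<open>simp_all add: s' multi_simps\<close>)
    then show ?thesis unfolding d(1) using d(2) by simp
  qed
  have "s \<in> extensional (fst (tgt (diag X Y F)))" by (simp add: s_def)
  from cellI[OF F G _ _ _ this s] show ?thesis by auto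
qed

text \<open>Isomorphisms of functors for each index form an invertible 2-cell between diagonal
  arrows (\<open>diag_cell\<close>), so \<open>diag Y X G\<close> is an inverse in the
  bicategory.\<close>

lemma diag_equivalence:
  assumes X: "X \<in> vobjs" and Y: "Y \<in> vobjs" and XY: "fst X = fst Y"
    and F: "\<And>i. i \<in> fst X \<Longrightarrow> exact_functor (tot (snd X i)) (tot (snd Y i)) (F i)"
      "\<And>i. i \<in> fst X \<Longrightarrow> preserves_degree (snd X i) (snd Y i) (F i)"
    and G: "\<And>i. i \<in> fst X \<Longrightarrow> exact_functor (tot (snd Y i)) (tot (snd X i)) (G i)"
      "\<And>i. i \<in> fst X \<Longrightarrow> preserves_degree (snd Y i) (snd X i) (G i)"
    and t: "\<And>i. i \<in> fst X \<Longrightarrow> nat_iso (tot (snd X i)) (tot (snd X i))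
        (cmp_functor (tot (snd X i)) (G i) (F i)) (id_functor (tot (snd X i))) (t i)"
    and b: "\<And>i. i \<in> fst X \<Longrightarrow> nat_iso (tot (snd Y i)) (tot (snd Y i))
        (cmp_functor (tot (snd Y i)) (F i) (G i)) (id_functor (tot (snd Y i))) (b i)"
  shows "equivalence1 TwoVectGrTensor (diag X Y F)"
proof -
  note lX = graded_linear_category[OF vobjs_graded[OF X]] and cX = graded_category[OF vobjs_graded[OF X]]
  have lY: "linear_category (tot (snd Y i))" if "i \<in> fst X" for i
    using that XY graded_linear_category[OF vobjs_graded[OF Y]] by auto
  note FF = exact_functor_functor[OF F(1)] and GG = exact_functor_functor[OF G(1)]
  have vF: "diag X Y F \<in> varrs {0..}" by (rule diag_varrs[OF X Y XY F])
  have "diag Y X G \<in> varrs {0..}" by (rule diag_varrs[OF Y X XY[symmetric]]) (use G XY in auto)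
  then have gG: "diag Y X G \<in> hom1 (GrVect {0..}) (tgt (diag X Y F)) (src (diag X Y F))"
    by (simp add: hom1_def)
  let ?GF = "\<lambda>i. cmp_functor (tot (snd X i)) (G i) (F i)" and ?FG = "\<lambda>i. cmp_functor (tot (snd Y i)) (F i) (G i)"
  have GF: "vcomp (diag Y X G) (diag X Y F) = diag X X ?GF"
    by (rule vcomp_diag) (use XY FF in auto)
  have FG: "vcomp (diag X Y F) (diag Y X G) = diag Y Y ?FG"
    by (rule vcomp_diag) (use XY GG in auto)
  have vGF: "diag X X ?GF \<in> varrs {0..}"
    by (rule diag_varrs[OF X X refl]) (use lX F G exact_cmp preserves_degree_cmp in blast)+
  have vFG: "diag Y Y ?FG \<in> varrs {0..}"
    by (rule diag_varrs[OF Y Y refl]) (use lY F G XY exact_cmp preserves_degree_cmp in fastforce)+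
  have iX: "diag X X (\<lambda>i. id_functor (tot (snd X i))) \<in> varrs {0..}"
    by (rule diag_varrs[OF X X refl]) (use lX exact_id preserves_degree_id in auto)
  have iY: "diag Y Y (\<lambda>i. id_functor (tot (snd Y i))) \<in> varrs {0..}"
    by (rule diag_varrs[OF Y Y refl]) (use lY XY exact_id preserves_degree_id in auto)
  \<comment> \<open>\<open>equivalence1\<close> wants its first 2-cell to start at the identity,
    whereas \<open>t\<close> ends there.\<close>
  have t': "nat_iso (tot (snd X i)) (tot (snd X i)) (id_functor (tot (snd X i))) (?GF i)
      (\<lambda>A \<in> Obj (tot (snd X i)). inv_arr (tot (snd X i)) (t i A))" if i: "i \<in> fst X" for i
    by (rule nat_iso_inverse[OF cX[OF i] cX[OF i] cmp_is_functor[OF cX[OF i] FF[OF i] GG[OF i]]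
          id_is_functor[OF cX[OF i]] t[OF i]])
  from diag_cell[OF iX vGF refl t']
  have "\<exists>s \<in> hom2 (GrVect {0..}) (vid (src (diag X Y F))) (vcomp (diag Y X G) (diag X Y F)).
      invertible2 (GrVect {0..}) s"
    by (simp add: vid_diag GF)
  moreover from diag_cell[OF vFG iY refl b] XY
  have "\<exists>s \<in> hom2 (GrVect {0..}) (vcomp (diag X Y F) (diag Y X G)) (vid (tgt (diag X Y F))).
      invertible2 (GrVect {0..}) s"
    by (simp add: vid_diag FG)
  ultimately show ?thesis
    unfolding equivalence1_def TwoVectGrTensor_def GrVect_simps using vF gG by blast
qed

lemma multi_single:
  assumes "is_functor (Prod {i} C) D F"
  shows "multi i C (single i (C i) F) = F"
proof (rule fnctr_eqI[where C = "Prod {i} C"])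
  show "fo (multi i C (single i (C i) F)) X = fo F X" if "X \<in> Obj (Prod {i} C)" for X
    using that singleton_ext[of X i] by (auto simp: multi_simps single_simps Prod_simps PiE_def)
  show "fa (multi i C (single i (C i) F)) X = fa F X" if "X \<in> Arr (Prod {i} C)" for X
    using that singleton_ext[of X i] by (auto simp: multi_simps single_simps Prod_simps PiE_def)
qed (use assms in \<open>auto simp: multi_def is_functor_def PiE_def\<close>)

text \<open>\<open>F\<close> is applied to the tuple of all \<open>t i\<close>; a tuple of
  isomorphisms is an isomorphism in the product category, and functors preserve
  isomorphisms.\<close>

lemma nat_iso_precompose:
  assumes B: "\<And>i. i \<in> A \<Longrightarrow> category (B i)" and D: "category D" and F: "is_functor (Prod A B) D F"
    and G: "\<And>i. i \<in> A \<Longrightarrow> is_functor (B i) (B i) (G i)"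
    and t: "\<And>i. i \<in> A \<Longrightarrow> nat_iso (B i) (B i) (G i) (id_functor (B i)) (t i)"
  shows "nat_iso (Prod A B) D (precompose A B F G) F (\<lambda>X \<in> Obj (Prod A B). fa F (\<lambda>i\<in>A. t i (X i)))"
proof (rule nat_isoI)
  note P = category_Prod[of A B, OF B]
  have tX: "(\<lambda>i\<in>A. t i (X i)) \<in> hom (Prod A B) (\<lambda>i\<in>A. fo (G i) (X i)) X"
    and tX': "iso_arr (Prod A B) (\<lambda>i\<in>A. t i (X i))" if X: "X \<in> Obj (Prod A B)" for X
  proof -
    have "t i (X i) \<in> hom (B i) (fo (G i) (X i)) (X i)" "iso_arr (B i) (t i (X i))" if "i \<in> A" for i
    proof -
      have "X i \<in> Obj (B i)" using X that by (auto simp: Prod_simps)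
      with nat_isoD(1,2)[OF t[OF that] this]
      show "t i (X i) \<in> hom (B i) (fo (G i) (X i)) (X i)" "iso_arr (B i) (t i (X i))" by simp_all
    qed
    then show 1: "(\<lambda>i\<in>A. t i (X i)) \<in> hom (Prod A B) (\<lambda>i\<in>A. fo (G i) (X i)) X"
      using X by (simp add: hom_Prod) (simp add: Prod_simps PiE_def)
    show "iso_arr (Prod A B) (\<lambda>i\<in>A. t i (X i))"
      by (rule iso_Prod[OF B 1]) (use \<open>\<And>i. i \<in> A \<Longrightarrow> iso_arr (B i) (t i (X i))\<close> in auto)
  qed
  show "(\<lambda>X \<in> Obj (Prod A B). fa F (\<lambda>i\<in>A. t i (X i))) X \<in> hom D (fo (precompose A B F G) X) (fo F X)"
    if "X \<in> Obj (Prod A B)" for X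
    using functor_hom[OF F tX[OF that]] that by (simp add: precompose_simps)
  show "iso_arr D ((\<lambda>X \<in> Obj (Prod A B). fa F (\<lambda>i\<in>A. t i (X i))) X)" if "X \<in> Obj (Prod A B)" for X
    using functor_iso[OF P D F tX tX'] that by simp
  fix f X Y assume f: "f \<in> hom (Prod A B) X Y"
  then have fi: "f i \<in> hom (B i) (X i) (Y i)" if "i \<in> A" for i using that by (simp add: hom_Prod)
  have XY: "X \<in> Obj (Prod A B)" "Y \<in> Obj (Prod A B)" using category.hom_obj[OF P f] by auto
  have Gf: "(\<lambda>i\<in>A. fa (G i) (f i)) \<in> hom (Prod A B) (\<lambda>i\<in>A. fo (G i) (X i)) (\<lambda>i\<in>A. fo (G i) (Y i))"
    using functor_hom[OF G fi] by (simp add: hom_Prod)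
  have "Cmp (B i) (t i (Y i)) (fa (G i) (f i)) = Cmp (B i) (f i) (t i (X i))" if "i \<in> A" for i
    using nat_iso_nat[OF t[OF that] fi[OF that]] hom_arr[OF fi[OF that]] by simp
  then have "Cmp (Prod A B) (\<lambda>i\<in>A. t i (Y i)) (\<lambda>i\<in>A. fa (G i) (f i)) =
      Cmp (Prod A B) f (\<lambda>i\<in>A. t i (X i))"
    by (auto simp: Prod_simps intro!: restrict_ext)
  then show "Cmp D ((\<lambda>X \<in> Obj (Prod A B). fa F (\<lambda>i\<in>A. t i (X i))) Y) (fa (precompose A B F G) f) =
      Cmp D (fa F f) ((\<lambda>X \<in> Obj (Prod A B). fa F (\<lambda>i\<in>A. t i (X i))) X)"
    using functor_cmp[OF F Gf tX[OF XY(2)]] functor_cmp[OF F tX[OF XY(1)] f] XY hom_arr[OF f]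
    by (simp add: precompose_simps)
qed simp

section \<open>The symmetric monoidal structure of an SSH structure\<close>

abbreviation idm :: "nat set \<Rightarrow> nat \<rightharpoonup> nat" where
  "idm I \<equiv> (\<lambda>i. if i \<in> I then Some i else None)"

text \<open>The base maps of \<open>collapse I S\<close> and \<open>split_map I S S'\<close>.\<close>

abbreviation col :: "nat set \<Rightarrow> nat \<rightharpoonup> nat" where
  "col S \<equiv> (\<lambda>i. if i \<in> S then Some 1 else None)"

abbreviation spl :: "nat set \<Rightarrow> nat set \<Rightarrow> nat \<rightharpoonup> nat" where
  "spl S S' \<equiv> (\<lambda>i. if i \<in> S then Some 1 else if i \<in> S' then Some 2 else None)"

text \<open>Inverse image under a partial map; an index sent to the base point lies in no inverse
  image.\<close>

definition pre :: "(nat \<rightharpoonup> nat) \<Rightarrow> nat set \<Rightarrow> nat set" where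
  "pre \<sigma> T = {i. \<exists>j \<in> T. \<sigma> i = Some j}"

lemma fibre_col: "fibre (col S) 1 = S"
  by (auto simp: fibre_def)

text \<open>This is why the product over \<open>T\<close> of a tuple pushed along
  \<open>\<sigma>\<close> compares with a product over the inverse image of
  \<open>T\<close>.\<close>

lemma col_comp: "col T \<circ>\<^sub>m \<sigma> = col (pre \<sigma> T)"
  by (auto simp: map_comp_def pre_def fun_eq_iff split: option.splits)

lemma spl_comp: "T \<inter> T' = {} \<Longrightarrow> spl T T' \<circ>\<^sub>m \<sigma> = spl (pre \<sigma> T) (pre \<sigma> T')"
  by (auto simp: map_comp_def pre_def fun_eq_iff split: option.splits)

lemma pre_spl:
  assumes "S \<inter> S' = {}"
  shows "pre (spl S S') {1} = S" "pre (spl S S') {2} = S'" "pre (spl S S') {1, 2} = S \<union> S'"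
  using assms by (auto simp: pre_def)

lemma pre_simps: "pre \<sigma> (T \<union> T') = pre \<sigma> T \<union> pre \<sigma> T'" "pre \<sigma> {} = {}"
  "T \<inter> T' = {} \<Longrightarrow> pre \<sigma> T \<inter> pre \<sigma> T' = {}" "pre (\<tau> \<circ>\<^sub>m \<sigma>) T = pre \<sigma> (pre \<tau> T)"
  by (auto simp: pre_def map_comp_eq_Some)

lemma pointed_comp: "pointed_map I \<phi> J \<Longrightarrow> pointed_map J \<psi> L \<Longrightarrow> pointed_map I (\<psi> \<circ>\<^sub>m \<phi>) L"
  by (auto simp: pointed_map_def dom_def ran_def map_comp_eq_Some subset_iff)

lemma pointed_pre: "pointed_map I \<sigma> J \<Longrightarrow> pre \<sigma> T \<subseteq> I"
  by (auto simp: pointed_map_def pre_def)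

lemma pointed_col: "finite I \<Longrightarrow> S \<subseteq> I \<Longrightarrow> pointed_map I (col S) {1}"
  and pointed_spl: "finite I \<Longrightarrow> S \<subseteq> I \<Longrightarrow> S' \<subseteq> I \<Longrightarrow> pointed_map I (spl S S') {1, 2}"
  and pointed_idm: "finite I \<Longrightarrow> pointed_map I (idm I) I"
  and pointed_empty: "finite I \<Longrightarrow> finite J \<Longrightarrow> pointed_map I Map.empty J"
  by (auto simp: pointed_map_def dom_def ran_def split: if_splits)

locale ssh =
  fixes H :: "('o, 'a, 'k :: field_char_0) ssh_data" and C :: "('o, 'a, 'k) grcat"
  assumes structure_HC: "ssh_structure H C"
begin

text \<open>For \<open>I = {1}\<close> the only component is literally the total category of
  \<open>C\<close>; in general the identification goes through the Segal functors
  \<open>sf\<close>.\<close>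

definition K :: "nat set \<Rightarrow> nat \<Rightarrow> (nat \<Rightarrow> 'o, nat \<Rightarrow> 'a, 'k) lincat" where
  "K I i = tot (snd (pob H (ones I)) i)"

abbreviation D :: "(nat \<Rightarrow> 'o, nat \<Rightarrow> 'a, 'k) lincat" where
  "D \<equiv> tot C"

definition act :: "nat set \<Rightarrow> (nat \<rightharpoonup> nat) \<Rightarrow> nat set \<Rightarrow> nat \<Rightarrow> ('o, 'a) multifunctor" where
  "act I \<phi> J j = cmps (par H (ids I \<phi> J)) j"

definition mu where
  "mu I \<phi> J \<psi> L k = tcmps (pmu H (ids J \<psi> L) (ids I \<phi> J)) k"

lemma ssh: "ssh_category H" and pob1: "pob H (ones {1}) = ({1}, \<lambda>i \<in> {1}. C)"
  using structure_HC by (auto simp: ssh_structure_def)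

lemma pf: "pseudofunctor FinSetCop (GrVect {0..}) H"
  using ssh by (simp add: ssh_category_def TwoVectGrTensor_def)

lemma pob: assumes "finite I"
  shows pob_vobjs: "pob H (ones I) \<in> vobjs" and fst_pob: "fst (pob H (ones I)) = I"
  using pseudofunctor.pob_ob[OF pf ones_obj[OF assms]] ssh ones_obj[OF assms]
  by (auto simp: ssh_category_def proj0_def ones_def)

lemma K1: "K {1} 1 = D"
  unfolding K_def pob1 by simp

lemma graded_K: "finite I \<Longrightarrow> i \<in> I \<Longrightarrow> graded_two_vector_space (snd (pob H (ones I)) i)"
  using vobjs_graded[OF pob_vobjs] fst_pob by simp

lemma linear_K: "finite I \<Longrightarrow> i \<in> I \<Longrightarrow> linear_category (K I i)"
  and cat_K: "finite I \<Longrightarrow> i \<in> I \<Longrightarrow> category (K I i)"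
  unfolding K_def using graded_linear_category graded_category graded_K by blast+

lemma linear_D: "linear_category D" and cat_D: "category D" and graded_C: "graded_two_vector_space C"
  using linear_K[of "{1}" 1] cat_K[of "{1}" 1] graded_K[of "{1}" 1] K1 unfolding pob1 by simp_all

lemma par:
  assumes "pointed_map I \<phi> J"
  shows par_varrs: "par H (ids I \<phi> J) \<in> varrs {0..}"
    and par_src: "src (par H (ids I \<phi> J)) = pob H (ones I)"
    and par_tgt: "tgt (par H (ids I \<phi> J)) = pob H (ones J)"
    and par_base: "base (par H (ids I \<phi> J)) = \<phi>"
proof -
  show "par H (ids I \<phi> J) \<in> varrs {0..}"
    "src (par H (ids I \<phi> J)) = pob H (ones I)" "tgt (par H (ids I \<phi> J)) = pob H (ones J)"
    using pseudofunctor.par_hom[OF pf ids_hom[OF assms]] by (auto simp: hom1_def)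
  have "proj1 (par H (ids I \<phi> J)) = proj1 (ids I \<phi> J)"
    using ssh hom_arr[OF ids_hom[OF assms]] by (simp add: ssh_category_def)
  then show "base (par H (ids I \<phi> J)) = \<phi>" by (simp add: proj1_def ids_def)
qed

lemma finite_pointed: "pointed_map I \<phi> J \<Longrightarrow> finite I" "pointed_map I \<phi> J \<Longrightarrow> finite J"
  by (auto simp: pointed_map_def)

lemma act:
  assumes "pointed_map I \<phi> J" "j \<in> J"
  shows act_functor: "is_functor (Prod (fibre \<phi> j) (K I)) (K J j) (act I \<phi> J j)"
    and act_exact: "multi_exact (fibre \<phi> j) (K I) (K J j) (act I \<phi> J j)"
    and act_degree: "of_degree 0 (fibre \<phi> j) (snd (pob H (ones I))) (snd (pob H (ones J)) j) (act I \<phi> J j)"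
proof -
  note p = par[OF assms(1)]
  have j: "j \<in> fst (tgt (par H (ids I \<phi> J)))"
    using p(3) assms(2) fst_pob[OF finite_pointed(2)[OF assms(1)]] by simp
  have K: "K I = (\<lambda>i. tot (snd (pob H (ones I)) i))" for I by (simp add: K_def fun_eq_iff)
  show "is_functor (Prod (fibre \<phi> j) (K I)) (K J j) (act I \<phi> J j)"
    "multi_exact (fibre \<phi> j) (K I) (K J j) (act I \<phi> J j)"
    using varrs_is_functor[OF p(1) j] varrs_multi_exact[OF p(1) j] p by (simp_all add: K act_def)
  have "degree_zero (par H (ids I \<phi> J))"
    using ssh hom_arr[OF ids_hom[OF assms(1)]] by (simp add: ssh_category_def)
  then show "of_degree 0 (fibre \<phi> j) (snd (pob H (ones I))) (snd (pob H (ones J)) j) (act I \<phi> J j)"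
    using j p by (simp add: degree_zero_def act_def)
qed

text \<open>
  Writing \<open>\<phi>\<^sub>*\<close> for the functor \<open>push \<phi>\<close> between products of categories, \<open>mu\<close> is an isomorphism
  from the components of \<open>\<psi>\<^sub>* \<phi>\<^sub>* A\<close> to those of \<open>(\<psi>\<phi>)\<^sub>* A\<close>.
\<close>

definition push :: "nat set \<Rightarrow> (nat \<rightharpoonup> nat) \<Rightarrow> nat set \<Rightarrow> (nat \<Rightarrow> nat \<Rightarrow> 'o) \<Rightarrow> nat \<Rightarrow> nat \<Rightarrow> 'o" where
  "push I \<phi> J A = (\<lambda>j \<in> J. fo (act I \<phi> J j) (restrict A (fibre \<phi> j)))"

definition pusha :: "nat set \<Rightarrow> (nat \<rightharpoonup> nat) \<Rightarrow> nat set \<Rightarrow> (nat \<Rightarrow> nat \<Rightarrow> 'a) \<Rightarrow> nat \<Rightarrow> nat \<Rightarrow> 'a" where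
  "pusha I \<phi> J u = (\<lambda>j \<in> J. fa (act I \<phi> J j) (restrict u (fibre \<phi> j)))"

lemma fibre_sub: "pointed_map I \<phi> J \<Longrightarrow> fibre \<phi> j \<subseteq> I" "pointed_map I \<phi> J \<Longrightarrow> j \<notin> J \<Longrightarrow> fibre \<phi> j = {}"
  by (auto simp: pointed_map_def fibre_def ran_def)

lemma push_obj:
  assumes "pointed_map I \<phi> J" "A \<in> Obj (Prod I (K I))"
  shows "push I \<phi> J A \<in> Obj (Prod J (K J))"
proof -
  have "fo (act I \<phi> J j) (restrict A (fibre \<phi> j)) \<in> Obj (K J j)" if "j \<in> J" for j
    by (rule functor_obj[OF act_functor[OF assms(1) that]
          restrict_Obj_Prod[OF assms(2) fibre_sub(1)[OF assms(1)]]])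
  then show ?thesis by (simp add: push_def Prod_simps)
qed

lemma pusha_hom:
  assumes "pointed_map I \<phi> J" "u \<in> hom (Prod I (K I)) A B"
  shows "pusha I \<phi> J u \<in> hom (Prod J (K J)) (push I \<phi> J A) (push I \<phi> J B)"
proof -
  have "fa (act I \<phi> J j) (restrict u (fibre \<phi> j)) \<in>
      hom (K J j) (fo (act I \<phi> J j) (restrict A (fibre \<phi> j))) (fo (act I \<phi> J j) (restrict B (fibre \<phi> j)))"
    if "j \<in> J" for j
    by (rule functor_hom[OF act_functor[OF assms(1) that]
          restrict_hom_Prod[OF assms(2) fibre_sub(1)[OF assms(1)]]])
  then show ?thesis by (simp add: push_def pusha_def hom_Prod)
qed

lemma cat_PK: "finite I \<Longrightarrow> J \<subseteq> I \<Longrightarrow> category (Prod J (K I))"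
  by (rule category_Prod) (auto intro: cat_K)

section \<open>Compositors evaluated on tuples of objects\<close>

lemma pmu:
  assumes "pointed_map I \<phi> J" "pointed_map J \<psi> L"
  shows pmu_hom2: "pmu H (ids J \<psi> L) (ids I \<phi> J) \<in>
      hom2 (GrVect {0..}) (vcomp (par H (ids J \<psi> L)) (par H (ids I \<phi> J))) (par H (ids I (\<psi> \<circ>\<^sub>m \<phi>) L))"
    and pmu_invertible: "invertible2 (GrVect {0..}) (pmu H (ids J \<psi> L) (ids I \<phi> J))"
  using pseudofunctor.pmu_hom[OF pf ids_hom[OF assms(1)] ids_hom[OF assms(2)]] ids_cmp[OF assms]
  by simp_all

lemma vcomp_push:
  assumes "pointed_map I \<phi> J" "pointed_map J \<psi> L" and k: "k \<in> L"
  shows "A \<in> Obj (Prod (fibre (\<psi> \<circ>\<^sub>m \<phi>) k) (K I)) \<Longrightarrow>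
      fo (cmps (vcomp (par H (ids J \<psi> L)) (par H (ids I \<phi> J))) k) A =
      fo (act J \<psi> L k) (restrict (push I \<phi> J A) (fibre \<psi> k))"
    and "u \<in> Arr (Prod (fibre (\<psi> \<circ>\<^sub>m \<phi>) k) (K I)) \<Longrightarrow>
      fa (cmps (vcomp (par H (ids J \<psi> L)) (par H (ids I \<phi> J))) k) u =
      fa (act J \<psi> L k) (restrict (pusha I \<phi> J u) (fibre \<psi> k))"
proof -
  note p = par[OF assms(1)] and q = par[OF assms(2)]
  have k': "k \<in> fst (tgt (par H (ids J \<psi> L)))"
    using k q(3) fst_pob[OF finite_pointed(2)[OF assms(2)]] by simp
  have d: "vdom (vcomp (par H (ids J \<psi> L)) (par H (ids I \<phi> J))) k = Prod (fibre (\<psi> \<circ>\<^sub>m \<phi>) k) (K I)"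
    using p q by (simp add: K_def[abs_def])
  have sub: "fibre \<psi> k \<subseteq> J" by (rule fibre_sub(1)[OF assms(2)])
  show "fo (cmps (vcomp (par H (ids J \<psi> L)) (par H (ids I \<phi> J))) k) A =
      fo (act J \<psi> L k) (restrict (push I \<phi> J A) (fibre \<psi> k))"
    if "A \<in> Obj (Prod (fibre (\<psi> \<circ>\<^sub>m \<phi>) k) (K I))"
    using cmps_vcomp(1)[OF k', of A "par H (ids I \<phi> J)", unfolded d, OF that] p(4) q(4) sub
    by (simp add: act_def push_def Int_absorb1)
  show "fa (cmps (vcomp (par H (ids J \<psi> L)) (par H (ids I \<phi> J))) k) u =
      fa (act J \<psi> L k) (restrict (pusha I \<phi> J u) (fibre \<psi> k))"
    if "u \<in> Arr (Prod (fibre (\<psi> \<circ>\<^sub>m \<phi>) k) (K I))"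
    using cmps_vcomp(2)[OF k', of u "par H (ids I \<phi> J)", unfolded d, OF that] p(4) q(4) sub
    by (simp add: act_def pusha_def Int_absorb1)
qed

text \<open>Over the fibre of \<open>\<psi>\<close> at \<open>k\<close>, a pushed tuple reads
  \<open>A\<close> only on the fibre of the composite at \<open>k\<close>.\<close>

lemma restrict_push:
  "restrict (push I \<phi> J (restrict A (fibre (\<psi> \<circ>\<^sub>m \<phi>) k))) (fibre \<psi> k) = restrict (push I \<phi> J A) (fibre \<psi> k)"
  "restrict (pusha I \<phi> J (restrict u (fibre (\<psi> \<circ>\<^sub>m \<phi>) k))) (fibre \<psi> k) = restrict (pusha I \<phi> J u) (fibre \<psi> k)"
proof -
  have *: "fibre (\<psi> \<circ>\<^sub>m \<phi>) k \<inter> fibre \<phi> j = fibre \<phi> j" if "j \<in> fibre \<psi> k" for j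
    using that by (auto simp: fibre_map_comp)
  show "restrict (push I \<phi> J (restrict A (fibre (\<psi> \<circ>\<^sub>m \<phi>) k))) (fibre \<psi> k) = restrict (push I \<phi> J A) (fibre \<psi> k)"
    by (rule restrict_ext) (simp add: push_def *)
  show "restrict (pusha I \<phi> J (restrict u (fibre (\<psi> \<circ>\<^sub>m \<phi>) k))) (fibre \<psi> k) = restrict (pusha I \<phi> J u) (fibre \<psi> k)"
    by (rule restrict_ext) (simp add: pusha_def *)
qed

text \<open>An invertible compositor is a natural isomorphism in each component, by
  \<open>hom2_nat_iso\<close>. Its argument is the tuple restricted to the fibre of the composite
  map, since only that part enters component \<open>k\<close>.\<close>

lemma mu:
  assumes "pointed_map I \<phi> J" "pointed_map J \<psi> L" "k \<in> L" and A: "A \<in> Obj (Prod I (K I))"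
  shows mu_hom: "mu I \<phi> J \<psi> L k (restrict A (fibre (\<psi> \<circ>\<^sub>m \<phi>) k)) \<in>
      hom (K L k) (push J \<psi> L (push I \<phi> J A) k) (push I (\<psi> \<circ>\<^sub>m \<phi>) L A k)"
    and mu_iso: "iso_arr (K L k) (mu I \<phi> J \<psi> L k (restrict A (fibre (\<psi> \<circ>\<^sub>m \<phi>) k)))"
    and mu_nat: "u \<in> hom (Prod I (K I)) A B \<Longrightarrow>
      Cmp (K L k) (mu I \<phi> J \<psi> L k (restrict B (fibre (\<psi> \<circ>\<^sub>m \<phi>) k))) (pusha J \<psi> L (pusha I \<phi> J u) k) =
      Cmp (K L k) (pusha I (\<psi> \<circ>\<^sub>m \<phi>) L u k) (mu I \<phi> J \<psi> L k (restrict A (fibre (\<psi> \<circ>\<^sub>m \<phi>) k)))"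
proof -
  note p = par[OF assms(1)] and q = par[OF assms(2)]
  let ?F = "vcomp (par H (ids J \<psi> L)) (par H (ids I \<phi> J))"
  have k': "k \<in> fst (tgt ?F)"
    using assms(3) q(3) fst_pob[OF finite_pointed(2)[OF assms(2)]] by simp
  have d: "vdom ?F k = Prod (fibre (\<psi> \<circ>\<^sub>m \<phi>) k) (K I)" "vcod ?F k = K L k"
    using p q by (simp_all add: K_def[abs_def])
  note t = hom2_nat_iso[OF pmu_hom2[OF assms(1,2)] pmu_invertible[OF assms(1,2)] k',
      unfolded d, folded mu_def act_def]
  note sub = fibre_sub(1)[OF pointed_comp[OF assms(1,2)]]
  note A' = restrict_Obj_Prod[OF A sub]
  show "mu I \<phi> J \<psi> L k (restrict A (fibre (\<psi> \<circ>\<^sub>m \<phi>) k)) \<in>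
      hom (K L k) (push J \<psi> L (push I \<phi> J A) k) (push I (\<psi> \<circ>\<^sub>m \<phi>) L A k)"
    using nat_iso_hom[OF t A'] assms(3) unfolding vcomp_push(1)[OF assms(1-3) A'] restrict_push
    by (simp add: push_def)
  show "iso_arr (K L k) (mu I \<phi> J \<psi> L k (restrict A (fibre (\<psi> \<circ>\<^sub>m \<phi>) k)))"
    by (rule nat_iso_iso[OF t A'])
  assume u: "u \<in> hom (Prod I (K I)) A B"
  note u' = restrict_hom_Prod[OF u sub]
  show "Cmp (K L k) (mu I \<phi> J \<psi> L k (restrict B (fibre (\<psi> \<circ>\<^sub>m \<phi>) k))) (pusha J \<psi> L (pusha I \<phi> J u) k) =
      Cmp (K L k) (pusha I (\<psi> \<circ>\<^sub>m \<phi>) L u k) (mu I \<phi> J \<psi> L k (restrict A (fibre (\<psi> \<circ>\<^sub>m \<phi>) k)))"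
    using nat_iso_nat[OF t u'] assms(3) unfolding vcomp_push(2)[OF assms(1-3) hom_arr[OF u']] restrict_push
    by (simp add: pusha_def)
qed

lemma map_comp_assoc: "(\<chi> \<circ>\<^sub>m \<psi>) \<circ>\<^sub>m \<phi> = \<chi> \<circ>\<^sub>m (\<psi> \<circ>\<^sub>m \<phi>)"
  by (auto simp: map_comp_def fun_eq_iff split: option.splits)

text \<open>Collecting the components makes the compositor a single map of tuples, to which
  \<open>pusha\<close> can be applied.\<close>

definition muf where
  "muf I \<phi> J \<psi> L A = (\<lambda>l \<in> L. mu I \<phi> J \<psi> L l (restrict A (fibre (\<psi> \<circ>\<^sub>m \<phi>) l)))"

lemma muf_hom:
  assumes "pointed_map I \<phi> J" "pointed_map J \<psi> L" "A \<in> Obj (Prod I (K I))"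
  shows "muf I \<phi> J \<psi> L A \<in> hom (Prod L (K L)) (push J \<psi> L (push I \<phi> J A)) (push I (\<psi> \<circ>\<^sub>m \<phi>) L A)"
  using mu_hom[OF assms(1,2) _ assms(3)] by (simp add: muf_def hom_Prod) (simp add: push_def)

text \<open>The associativity axiom of the pseudofunctor is read in component \<open>k\<close> at
  the object \<open>A\<close>: the left whiskering becomes the push of \<open>muf\<close>, the right
  whiskering becomes \<open>muf\<close> at the pushed tuple.\<close>

lemma mu_assoc:
  assumes "pointed_map I \<phi> J" "pointed_map J \<psi> L" "pointed_map L \<chi> Q" and k: "k \<in> Q"
    and A: "A \<in> Obj (Prod I (K I))"
  shows "Cmp (K Q k) (muf I (\<psi> \<circ>\<^sub>m \<phi>) L \<chi> Q A k) (pusha L \<chi> Q (muf I \<phi> J \<psi> L A) k) =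
    Cmp (K Q k) (muf I \<phi> J (\<chi> \<circ>\<^sub>m \<psi>) Q A k) (muf J \<psi> L \<chi> Q (push I \<phi> J A) k)"
proof -
  note p = par[OF assms(1)] and q = par[OF assms(2)] and r = par[OF assms(3)]
  note pq = pointed_comp[OF assms(1,2)] and qr = pointed_comp[OF assms(2,3)]
  let ?f = "par H (ids I \<phi> J)" and ?g = "par H (ids J \<psi> L)" and ?h = "par H (ids L \<chi> Q)"
  let ?gf = "pmu H (ids J \<psi> L) (ids I \<phi> J)" and ?hg = "pmu H (ids L \<chi> Q) (ids J \<psi> L)"
  let ?A = "restrict A (fibre (\<chi> \<circ>\<^sub>m (\<psi> \<circ>\<^sub>m \<phi>)) k)"
  have kQ: "k \<in> fst (pob H (ones Q))" using k fst_pob[OF finite_pointed(2)[OF assms(3)]] by simp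
  have A': "?A \<in> Obj (Prod (fibre (\<chi> \<circ>\<^sub>m (\<psi> \<circ>\<^sub>m \<phi>)) k) (K I))"
    by (rule restrict_Obj_Prod[OF A fibre_sub(1)[OF pointed_comp[OF pq assms(3)]]])
  have dom: "vdom (vcomp ?h (vcomp ?g ?f)) k = Prod (fibre (\<chi> \<circ>\<^sub>m (\<psi> \<circ>\<^sub>m \<phi>)) k) (K I)"
    "vdom (vcomp (vcomp ?h ?g) ?f) k = Prod (fibre (\<chi> \<circ>\<^sub>m (\<psi> \<circ>\<^sub>m \<phi>)) k) (K I)"
    using p q r by (simp_all add: K_def[abs_def] map_comp_assoc)
  note gf = pmu_hom2[OF assms(1,2)] and hg = pmu_hom2[OF assms(2,3)]
  have l: "tcmps (vthoriz (vtid ?h) ?gf) k ?A =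
      fa (cmps ?h k) (\<lambda>l \<in> fibre (base ?h) k. tcmps ?gf l (restrict ?A (fibre (base (vcomp ?g ?f)) l)))"
    by (rule tcmps_whisker_left[OF gf r(1)]) (use q r kQ A' dom in simp_all)
  have "tcmps (vthoriz ?hg (vtid ?f)) k ?A =
      tcmps ?hg k (\<lambda>j \<in> fibre (base (vcomp ?h ?g)) k. fo (cmps ?f j) (restrict ?A (fibre (base ?f) j)))"
    by (rule tcmps_whisker_right[OF hg p(1)]) (use p q r kQ A' dom in simp_all)
  moreover have "(\<lambda>j \<in> fibre (base (vcomp ?h ?g)) k. fo (cmps ?f j) (restrict ?A (fibre (base ?f) j))) =
      restrict (push I \<phi> J A) (fibre (\<chi> \<circ>\<^sub>m \<psi>) k)"
    using q(4) r(4) p(4) fibre_sub(1)[OF qr, of k] restrict_push(1)[of I \<phi> J A "\<chi> \<circ>\<^sub>m \<psi>" k]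
    by (simp add: push_def act_def map_comp_assoc Int_absorb1)
  moreover have "(\<lambda>l \<in> fibre (base ?h) k. tcmps ?gf l (restrict ?A (fibre (base (vcomp ?g ?f)) l))) =
      restrict (muf I \<phi> J \<psi> L A) (fibre \<chi> k)"
  proof -
    have *: "fibre (\<chi> \<circ>\<^sub>m (\<psi> \<circ>\<^sub>m \<phi>)) k \<inter> fibre (\<psi> \<circ>\<^sub>m \<phi>) l = fibre (\<psi> \<circ>\<^sub>m \<phi>) l" if "l \<in> fibre \<chi> k" for l
      using that by (auto simp: fibre_map_comp)
    show ?thesis
      unfolding r(4)
      by (rule restrict_ext)
        (use q(4) p(4) fibre_sub(1)[OF assms(3), of k] * in \<open>auto simp: muf_def mu_def\<close>)
  qed
  moreover have "tsrc (vthoriz (vtid ?h) ?gf) = vcomp ?h (vcomp ?g ?f)"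
    "tsrc (vthoriz ?hg (vtid ?f)) = vcomp (vcomp ?h ?g) ?f"
    using hom2_D(6)[OF gf] hom2_D(6)[OF hg] by (simp_all add: vthoriz_def vtid_def Let_def)
  moreover have "vtvert (pmu H (ids L \<chi> Q) (ids I (\<psi> \<circ>\<^sub>m \<phi>) L)) (vthoriz (vtid ?h) ?gf) =
      vtvert (pmu H (ids J (\<chi> \<circ>\<^sub>m \<psi>) Q) (ids I \<phi> J)) (vthoriz ?hg (vtid ?f))"
    using pseudofunctor.pmu_assoc[OF pf ids_hom[OF assms(1)] ids_hom[OF assms(2)] ids_hom[OF assms(3)]]
    by (simp add: ids_cmp[OF assms(1,2)] ids_cmp[OF assms(2,3)])
  from arg_cong[OF this, of "\<lambda>t. tcmps t k ?A"] calculation l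
  show ?thesis
    using k kQ r A' dom
    by (simp add: vtvert_def mu_def muf_def pusha_def act_def map_comp_assoc K_def)
qed

text \<open>
  The Segal functors \<open>sf I i\<close> from the \<open>i\<close>-th component of \<open>H ([1])\<^sub>i\<^sub>\<in>\<^sub>I\<close> to \<open>C\<close>, and their right
  inverses \<open>sg I i\<close>, the images of the sections \<open>1 \<mapsto> i\<close> of the inert maps.
\<close>

definition sf where
  "sf I i = single i (K I i) (act I (col {i}) {1} 1)"

definition sg where
  "sg I i = single 1 D (act {1} [1 \<mapsto> i] I i)"

lemma pointed_col1: "finite I \<Longrightarrow> i \<in> I \<Longrightarrow> pointed_map I (col {i}) {1}"
  by (rule pointed_col) auto

lemma pointed_point: "finite I \<Longrightarrow> i \<in> I \<Longrightarrow> pointed_map {1} [1 \<mapsto> i] I"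
  by (simp add: pointed_map_def)

lemma fibre_point: "fibre [1 \<mapsto> i] i = {1}"
  by (auto simp: fibre_def)

lemma pob1_1: "snd (pob H (ones {1})) 1 = C"
  unfolding pob1 by simp

lemma sf:
  assumes "finite I" "i \<in> I"
  shows sf_exact: "exact_functor (K I i) D (sf I i)"
    and sf_functor: "is_functor (K I i) D (sf I i)"
    and sf_degree: "preserves_degree (snd (pob H (ones I)) i) C (sf I i)"
proof -
  note p = pointed_col1[OF assms]
  have "multi_exact {i} (K I) D (act I (col {i}) {1} 1)"
    using act_exact[OF p, of 1] unfolding fibre_col K1 by simp
  then show "exact_functor (K I i) D (sf I i)"
    unfolding sf_def by (rule exact_single[where C = "K I" and i = i, OF linear_K[OF assms]])
  then show "is_functor (K I i) D (sf I i)" by (rule exact_functor_functor)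
  have "of_degree 0 {i} (snd (pob H (ones I))) C (act I (col {i}) {1} 1)"
    using act_degree[OF p, of 1] unfolding fibre_col pob1_1 by simp
  then show "preserves_degree (snd (pob H (ones I)) i) C (sf I i)"
    unfolding sf_def K_def by (rule preserves_degree_single)
qed

lemma sg:
  assumes "finite I" "i \<in> I"
  shows sg_exact: "exact_functor D (K I i) (sg I i)"
    and sg_functor: "is_functor D (K I i) (sg I i)"
    and sg_degree: "preserves_degree C (snd (pob H (ones I)) i) (sg I i)"
proof -
  note p = pointed_point[OF assms]
  have "multi_exact {1} (K {1}) (K I i) (act {1} [1 \<mapsto> i] I i)"
    using act_exact[OF p assms(2)] unfolding fibre_point .
  from exact_single[OF _ this] linear_D
  show "exact_functor D (K I i) (sg I i)"
    unfolding sg_def K1 by simp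
  then show "is_functor D (K I i) (sg I i)" by (rule exact_functor_functor)
  have "of_degree 0 {1} (snd (pob H (ones {1}))) (snd (pob H (ones I)) i) (act {1} [1 \<mapsto> i] I i)"
    using act_degree[OF p assms(2)] unfolding fibre_point .
  from preserves_degree_single[OF this]
  show "preserves_degree C (snd (pob H (ones I)) i) (sg I i)"
    unfolding sg_def pob1_1 .
qed

lemma push_sf:
  "i \<in> I \<Longrightarrow> A \<in> Obj (Prod I (K I)) \<Longrightarrow> push I (col {i}) {1} A 1 = fo (sf I i) (A i)"
  "i \<in> I \<Longrightarrow> u \<in> Arr (Prod I (K I)) \<Longrightarrow> pusha I (col {i}) {1} u 1 = fa (sf I i) (u i)"
proof -
  have r: "restrict f {i} = (\<lambda>j\<in>{i}. f i)" for f :: "nat \<Rightarrow> 'z" by auto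
  show "push I (col {i}) {1} A 1 = fo (sf I i) (A i)" if "i \<in> I" "A \<in> Obj (Prod I (K I))"
  proof -
    have "A i \<in> Obj (K I i)" using that by (auto simp: Prod_simps)
    then show ?thesis
      using fibre_col[of "{i}"] r[of A] by (simp add: push_def sf_def single_simps)
  qed
  show "pusha I (col {i}) {1} u 1 = fa (sf I i) (u i)" if "i \<in> I" "u \<in> Arr (Prod I (K I))"
  proof -
    have "u i \<in> Arr (K I i)" using that by (auto simp: Prod_simps)
    then show ?thesis
      using fibre_col[of "{i}"] r[of u] by (simp add: pusha_def sf_def single_simps)
  qed
qed

lemma push_sg:
  "i \<in> I \<Longrightarrow> X \<in> Obj D \<Longrightarrow> push {1} [1 \<mapsto> i] I (\<lambda>j\<in>{1}. X) i = fo (sg I i) X"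
  "i \<in> I \<Longrightarrow> f \<in> Arr D \<Longrightarrow> pusha {1} [1 \<mapsto> i] I (\<lambda>j\<in>{1}. f) i = fa (sg I i) f"
  unfolding push_def pusha_def sg_def
  by (simp_all add: fibre_point[simplified] single_simps)

text \<open>The unitor of \<open>H\<close> at \<open>ones {1}\<close> is evaluated on one-element
  tuples; its naturality is that of an invertible 2-cell.\<close>

lemma unitor:
  obtains p where
    "\<And>X. X \<in> Obj D \<Longrightarrow> p X \<in> hom D X (push {1} (idm {1}) {1} (\<lambda>j\<in>{1}. X) 1) \<and> iso_arr D (p X)"
    "\<And>f X Y. f \<in> hom D X Y \<Longrightarrow> Cmp D (p Y) f = Cmp D (pusha {1} (idm {1}) {1} (\<lambda>j\<in>{1}. f) 1) (p X)"
proof -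
  let ?F = "vid (pob H (ones {1}))" and ?G = "par H (ids {1} (idm {1}) {1})" and ?t = "pun H (ones {1})"
  let ?P = "Prod {1} (K {1})"
  have "?t \<in> hom2 (GrVect {0..}) ?F ?G" "invertible2 (GrVect {0..}) ?t"
    using pseudofunctor.pun_hom[OF pf ones_obj[of "{1}"]] unfolding ids_idn by simp_all
  moreover have 1: "1 \<in> fst (tgt ?F)" by (simp add: vid_diag fst_pob)
  ultimately have t: "nat_iso (vdom ?F 1) (vcod ?F 1) (cmps ?F 1) (cmps ?G 1) (tcmps ?t 1)"
    by (rule hom2_nat_iso)
  have d: "vdom ?F 1 = ?P" "vcod ?F 1 = D" 
    unfolding vid_diag diag_simps fibre_id K_def pob1_1 using fst_pob[of "{1}"] by simp_all
  have c: "cmps ?F 1 = multi 1 (K {1}) (id_functor D)"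
    unfolding vid_diag diag_def using fst_pob[of "{1}"] K1 by (simp add: K_def[abs_def])
  note t' = nat_isoD[OF t[unfolded d c]]
  have o: "(\<lambda>j\<in>{1}. X) \<in> Obj ?P" if "X \<in> Obj D" for X using that K1 by (simp add: Prod_simps)
  have h: "(\<lambda>j\<in>{1}. f) \<in> hom ?P (\<lambda>j\<in>{1}. X) (\<lambda>j\<in>{1}. Y)" if "f \<in> hom D X Y" for f X Y
    using that K1 by (simp add: hom_Prod)
  have G: "fo (cmps ?G 1) (\<lambda>j\<in>{1}. X) = push {1} (idm {1}) {1} (\<lambda>j\<in>{1}. X) 1"
    "fa (cmps ?G 1) (\<lambda>j\<in>{1}. f) = pusha {1} (idm {1}) {1} (\<lambda>j\<in>{1}. f) 1" for X f
    using fibre_id[of "{1}" 1] by (simp_all add: push_def pusha_def act_def)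
  show thesis
  proof (rule that[of "\<lambda>X. tcmps ?t 1 (\<lambda>j\<in>{1}. X)"])
    show "tcmps ?t 1 (\<lambda>j\<in>{1}. X) \<in> hom D X (push {1} (idm {1}) {1} (\<lambda>j\<in>{1}. X) 1) \<and>
        iso_arr D (tcmps ?t 1 (\<lambda>j\<in>{1}. X))" if X: "X \<in> Obj D" for X
      using t'(1,2)[OF o[OF X]] X unfolding G multi_simps(1)[OF o[OF X]] by simp
    show "Cmp D (tcmps ?t 1 (\<lambda>j\<in>{1}. Y)) f =
        Cmp D (pusha {1} (idm {1}) {1} (\<lambda>j\<in>{1}. f) 1) (tcmps ?t 1 (\<lambda>j\<in>{1}. X))"
      if f: "f \<in> hom D X Y" for f X Y
      using t'(3)[OF h[OF f]] hom_arr[OF f] unfolding G multi_simps(2)[OF hom_arr[OF h[OF f]]] by simp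
  qed
qed

text \<open>The section followed by the inert map is the identity of \<open>{1}\<close>, so the
  compositor and the unitor give \<open>sf sg \<cong> H (id) \<cong> 1\<close>.\<close>

lemma sf_sg:
  assumes I: "finite I" "i \<in> I"
  shows "\<exists>b. nat_iso D D (cmp_functor D (sf I i) (sg I i)) (id_functor D) b"
proof -
  interpret category D by (rule cat_D)
  obtain p where p:
    "\<And>X. X \<in> Obj D \<Longrightarrow> p X \<in> hom D X (push {1} (idm {1}) {1} (\<lambda>j\<in>{1}. X) 1) \<and> iso_arr D (p X)"
    "\<And>f X Y. f \<in> hom D X Y \<Longrightarrow> Cmp D (p Y) f = Cmp D (pusha {1} (idm {1}) {1} (\<lambda>j\<in>{1}. f) 1) (p X)"
    by (rule unitor) blast
  note pa = pointed_point[OF I] and pb = pointed_col1[OF I]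
  have comp: "col {i} \<circ>\<^sub>m [1 \<mapsto> i] = idm {1}" by (auto simp: map_comp_def fun_eq_iff)
  have o: "(\<lambda>j\<in>{1}. X) \<in> Obj (Prod {1} (K {1}))" if "X \<in> Obj D" for X
    using that K1 by (simp add: Prod_simps)
  have h: "(\<lambda>j\<in>{1}. f) \<in> hom (Prod {1} (K {1})) (\<lambda>j\<in>{1}. X) (\<lambda>j\<in>{1}. Y)" if "f \<in> hom D X Y" for f X Y
    using that K1 by (simp add: hom_Prod)
  define q where "q X = mu {1} [1 \<mapsto> i] I (col {i}) {1} 1 (restrict (\<lambda>j\<in>{1}. X) (fibre (idm {1}) 1))" for X
  define FG where "FG = cmp_functor D (sf I i) (sg I i)"
  have fFG: "is_functor D D FG"
    unfolding FG_def by (rule cmp_is_functor[OF cat_D sg_functor[OF I] sf_functor[OF I]])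
  have FGo: "push I (col {i}) {1} (push {1} [1 \<mapsto> i] I (\<lambda>j\<in>{1}. X)) 1 = fo FG X" if X: "X \<in> Obj D" for X
    using push_sf(1)[OF I(2) push_obj[OF pa o[OF X]]] push_sg(1)[OF I(2) X] X by (simp add: FG_def)
  have FGa: "pusha I (col {i}) {1} (pusha {1} [1 \<mapsto> i] I (\<lambda>j\<in>{1}. f)) 1 = fa FG f" if f: "f \<in> hom D X Y" for f X Y
    using push_sf(2)[OF I(2) hom_arr[OF pusha_hom[OF pa h[OF f]]]] push_sg(2)[OF I(2) hom_arr[OF f]] hom_arr[OF f]
    by (simp add: FG_def)
  have q: "q X \<in> hom D (fo FG X) (push {1} (idm {1}) {1} (\<lambda>j\<in>{1}. X) 1)" "iso_arr D (q X)"
    if X: "X \<in> Obj D" for X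
    using mu_hom[OF pa pb _ o[OF X], of 1] mu_iso[OF pa pb _ o[OF X], of 1]
    unfolding comp K1 FGo[OF X] q_def by simp_all
  have qn: "Cmp D (q Y) (fa FG f) = Cmp D (pusha {1} (idm {1}) {1} (\<lambda>j\<in>{1}. f) 1) (q X)"
    if f: "f \<in> hom D X Y" for f X Y
    using mu_nat[OF pa pb _ o[OF hom_obj(1)[OF f]] h[OF f], of 1]
    unfolding comp K1 FGa[OF f] q_def by simp
  \<comment> \<open>The compositor \<open>q\<close> leads to the image of the identity map, and the
    inverse of the unitor \<open>p\<close> leads from there back to \<open>X\<close>.\<close>
  define b where "b = (\<lambda>X \<in> Obj D. Cmp D (inv_arr D (p X)) (q X))"
  have "nat_iso D D FG (id_functor D) b"
  proof (rule nat_isoI)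
    show "b X \<in> hom D (fo FG X) (fo (id_functor D) X)" "iso_arr D (b X)" if X: "X \<in> Obj D" for X
      using X p(1)[OF X] q[OF X] cmp_hom[OF q(1)[OF X] inv_hom]
        iso_cmp[OF q(2,1)[OF X] iso_inv inv_hom] by (auto simp: b_def)
    fix f X Y assume f: "f \<in> hom D X Y"
    note X = hom_obj(1)[OF f] and Y = hom_obj(2)[OF f]
    have pX: "p X \<in> hom D X (push {1} (idm {1}) {1} (\<lambda>j\<in>{1}. X) 1)" "iso_arr D (p X)"
      and pY: "p Y \<in> hom D Y (push {1} (idm {1}) {1} (\<lambda>j\<in>{1}. Y) 1)" "iso_arr D (p Y)"
      using p(1) X Y by auto
    note bX = cmp_hom[OF q(1)[OF X] inv_hom[OF pX(2,1)]]
    let ?v = "pusha {1} (idm {1}) {1} (\<lambda>j\<in>{1}. f) 1"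
    have v: "?v \<in> hom D (push {1} (idm {1}) {1} (\<lambda>j\<in>{1}. X) 1) (push {1} (idm {1}) {1} (\<lambda>j\<in>{1}. Y) 1)"
      using pusha_hom[OF pointed_idm[of "{1}"] h[OF f]] K1 by (simp add: hom_Prod)
    have "Cmp D (Cmp D (inv_arr D (p Y)) (q Y)) (fa FG f) = Cmp D (inv_arr D (p Y)) (Cmp D ?v (q X))"
      using cmp_assoc[OF functor_hom[OF fFG f] q(1)[OF Y] inv_hom[OF pY(2,1)]] qn[OF f] by simp
    also have "Cmp D ?v (q X) = Cmp D ?v (Cmp D (p X) (Cmp D (inv_arr D (p X)) (q X)))"
      using cancel_left'[OF pX(2,1) q(1)[OF X]] by simp
    also have "\<dots> = Cmp D (p Y) (Cmp D f (Cmp D (inv_arr D (p X)) (q X)))"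
      using cmp_assoc[OF bX pX(1) v] cmp_assoc[OF bX f pY(1)] p(2)[OF f] by simp
    also have "Cmp D (inv_arr D (p Y)) \<dots> = Cmp D f (Cmp D (inv_arr D (p X)) (q X))"
      by (rule cancel_left[OF pY(2,1) cmp_hom[OF bX f]])
    finally show "Cmp D (b Y) (fa FG f) = Cmp D (fa (id_functor D) f) (b X)"
      using X Y hom_arr[OF f] by (simp add: b_def)
  qed (simp add: b_def)
  then show ?thesis unfolding FG_def by blast
qed

text \<open>
  Since \<open>collapse I {i}\<close> is sent to a coCartesian arrow, the projection to the \<open>i\<close>-th component
  factors through it, which provides a left inverse of \<open>sf I i\<close>.
\<close>

lemma sf_left_inverse:
  assumes I: "finite I" "i \<in> I"
  shows "\<exists>G a. is_functor D (K I i) G \<and>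
    nat_iso (K I i) (K I i) (cmp_functor (K I i) G (sf I i)) (id_functor (K I i)) a"
proof -
  let ?E = "GrVect {0..} :: (('o, 'a, 'k) vobj, ('o, 'a, 'k) varr, ('o, 'a, 'k) vcell) bicat"
  let ?F = "par H (collapse I {i})" and ?i = "({1}, idm {1}, {1})"
  \<comment> \<open>The \<open>i\<close>-th component is viewed as a collection over
    \<open>{1}\<close>, so that the projection \<open>p\<close> onto it lies over the same base map
    as the collapse.\<close>
  define Z where "Z = ({1 :: nat}, \<lambda>j\<in>{1 :: nat}. snd (pob H (ones I)) i)"
  have Z: "Z \<in> vobjs" using graded_K[OF I] by (simp add: Z_def vobjs_def)
  note pb = pointed_col1[OF I]
  note F = par[OF pb, folded collapse_def]
  define p where "p = \<lparr>src = pob H (ones I), tgt = Z, base = col {i},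
     cmps = (\<lambda>j\<in>{1 :: nat}. multi i (K I) (id_functor (K I i)))\<rparr>"
  have KI: "K I = (\<lambda>i. tot (snd (pob H (ones I)) i))" by (simp add: K_def fun_eq_iff)
  have bp: "bounded_multi_exact {0..} {i} (snd (pob H (ones I))) (snd (pob H (ones I)) i)
      (multi i (K I) (id_functor (K I i)))"
    unfolding KI
    using linear_K[OF I] cat_K[OF I] unfolding KI
    by (intro bounded_multi_exactI[where d = 0] multi_exact_multi of_degree_multi exact_id preserves_degree_id)
      auto
  have fib: "fibre (col {i}) 1 = {i}" by (rule fibre_col)
  have p: "p \<in> varrs {0..}"
    unfolding varrs_def mem_Collect_eq p_def coll_arr.simps
    using pob_vobjs[OF I(1)] Z pb bp fib fst_pob[OF I(1)] by (simp add: Z_def)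
  have comp: "idm {1} \<circ>\<^sub>m col {i} = col {i}" by (auto simp: map_comp_def fun_eq_iff)
  have "cocartesian (discrete_bicat FinSetCop) FinSetPt proj0 proj1 (collapse I {i})"
    by (rule cocartesian_collapse[OF I])
  then have "cocartesian ?E FinSetPt proj0 proj1 ?F"
    using ssh by (simp add: ssh_category_def TwoVectGrTensor_def)
  then have coc: "\<forall>z \<in> Ob0 ?E. \<forall>g \<in> hom FinSetPt (proj0 (cod1 ?E ?F)) (proj0 z).
      is_equivalence (arrows_over ?E proj1 (cod1 ?E ?F) z g)
        (arrows_over ?E proj1 (dom1 ?E ?F) z (Cmp FinSetPt g (proj1 ?F)))
        (precomposition ?E ?F (arrows_over ?E proj1 (cod1 ?E ?F) z g))"
    unfolding cocartesian_def by blast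
  have i: "?i \<in> hom FinSetPt (proj0 (cod1 ?E ?F)) (proj0 Z)"
    using F(3) fst_pob[of "{1}"] pointed_idm[of "{1}"]
    by (simp add: FinSetPt_def hom_def proj0_def Z_def)
  define A where "A = arrows_over ?E proj1 (pob H (ones {1})) Z ?i"
  define B where "B = arrows_over ?E proj1 (pob H (ones I)) Z (I, col {i}, {1})"
  have c: "Cmp FinSetPt ?i (proj1 ?F) = (I, col {i}, {1})"
    using F fst_pob[OF I(1)] comp by (simp add: FinSetPt_def proj1_def)
  have Z0: "Z \<in> Ob0 ?E" using Z by simp
  \<comment> \<open>This is the universal property for the test object \<open>Z\<close> and the
    identity of \<open>{1}\<close>: arrows from \<open>pob H (ones {1})\<close> to \<open>Z\<close>
    over the identity correspond to arrows from \<open>pob H (ones I)\<close> to \<open>Z\<close>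
    over the collapse.\<close>
  have eq: "is_equivalence A B (precomposition ?E ?F A)"
    using bspec[OF bspec[OF coc Z0] i] unfolding c A_def B_def by (simp add: F)
  have pB: "p \<in> Obj B"
    using p fst_pob[OF I(1)] by (simp add: B_def arrows_over_def Let_def hom1_def p_def proj1_def Z_def)
  from eq obtain Q t where Q: "is_functor B A Q"
    and t: "nat_iso B B (cmp_functor B (precomposition ?E ?F A) Q) (id_functor B) t"
    unfolding is_equivalence_def by blast
  \<comment> \<open>The projection \<open>p\<close> factors up to isomorphism through
    \<open>?F\<close>. The factor \<open>G\<close>, evaluated on one-element tuples, becomes the
    left inverse \<open>g\<close>.\<close>
  define G where "G = fo Q p"
  have GA: "G \<in> Obj A" unfolding G_def by (rule functor_obj[OF Q pB])
  then have G: "G \<in> varrs {0..}" "src G = pob H (ones {1})" "tgt G = Z" "base G = idm {1}"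
    by (simp_all add: A_def arrows_over_def Let_def hom1_def proj1_def)
  have "fo (cmp_functor B (precomposition ?E ?F A) Q) p = vcomp G ?F"
    using pB GA by (simp add: precomposition_def G_def)
  then have tp: "t p \<in> hom B (vcomp G ?F) p" "iso_arr B (t p)"
    using nat_isoD(1,2)[OF t pB] pB by simp_all
  have t2: "t p \<in> hom2 ?E (vcomp G ?F) p"
    using tp(1) by (auto simp: B_def arrows_over_def Let_def hom_def hom2_def)
  have "invertible2 ?E (t p)"
    using tp(2) by (auto simp: B_def arrows_over_def Let_def hom_def hom2_def iso_arr_def
        inverse_arrows_def invertible2_def inverse2_def)
  moreover have 1: "1 \<in> fst (tgt (vcomp G ?F))" using G by (simp add: Z_def)
  ultimately have n: "nat_iso (vdom (vcomp G ?F) 1) (vcod (vcomp G ?F) 1) (cmps (vcomp G ?F) 1) (cmps p 1)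
      (tcmps (t p) 1)"
    by (intro hom2_nat_iso[OF t2])
  have d: "vdom (vcomp G ?F) 1 = Prod {i} (K I)" "vcod (vcomp G ?F) 1 = K I i"
    unfolding vcomp_simps F G comp fibre_col KI by (simp_all add: Z_def)
  have cp: "cmps p 1 = multi i (K I) (id_functor (K I i))" by (simp add: p_def)
  note n' = nat_isoD[OF n[unfolded d cp]]
  have "is_functor (vdom G 1) (vcod G 1) (cmps G 1)"
    by (rule varrs_is_functor[OF G(1)]) (simp add: G Z_def)
  moreover have "vdom G 1 = Prod {1} (\<lambda>_. D)" "vcod G 1 = K I i"
    unfolding G fibre_id KI by (auto simp: pob1_1[simplified] Z_def intro!: Prod_cong)
  ultimately have G1: "is_functor (Prod {1} (\<lambda>_. D)) (K I i) (cmps G 1)" by simp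
  define g where "g = single 1 D (cmps G 1)"
  have g: "is_functor D (K I i) g"
    unfolding g_def using single_functor[OF cat_D G1] .
  have o: "(\<lambda>j\<in>{i}. X) \<in> Obj (Prod {i} (K I))" if "X \<in> Obj (K I i)" for X
    using that by (simp add: Prod_simps)
  have h: "(\<lambda>j\<in>{i}. f) \<in> hom (Prod {i} (K I)) (\<lambda>j\<in>{i}. X) (\<lambda>j\<in>{i}. Y)" if "f \<in> hom (K I i) X Y" for f X Y
    using that by (simp add: hom_Prod)
  have fib1: "fibre (idm {1}) 1 = {1}" using fibre_id[of "{1}" 1] by simp
  have F1: "cmps ?F 1 = act I (col {i}) {1} 1" by (simp add: act_def collapse_def)
  have FX: "fo (cmps (vcomp G ?F) 1) (\<lambda>j\<in>{i}. X) = fo g (fo (sf I i) X)" if X: "X \<in> Obj (K I i)" for X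
  proof -
    have "fo (cmps (vcomp G ?F) 1) (\<lambda>j\<in>{i}. X) =
        fo (cmps G 1) (\<lambda>j\<in>fibre (idm {1}) 1. fo (cmps ?F j) (restrict (\<lambda>j\<in>{i}. X) (fibre (col {i}) j)))"
      using cmps_vcomp(1)[of 1 G "\<lambda>j\<in>{i}. X" ?F, unfolded d, OF _ o[OF X]] 1 by (simp add: F G)
    also have "\<dots> = fo (cmps G 1) (\<lambda>j\<in>{1}. fo (sf I i) X)"
      unfolding fib1
      by (rule arg_cong[of _ _ "fo (cmps G 1)"], rule restrict_ext)
        (use X fib F1 in \<open>simp add: sf_def single_simps\<close>)
    finally show ?thesis using functor_obj[OF sf_functor[OF I] X] by (simp add: g_def single_simps)
  qed
  have Ff: "fa (cmps (vcomp G ?F) 1) (\<lambda>j\<in>{i}. f) = fa g (fa (sf I i) f)" if f: "f \<in> hom (K I i) X Y" for f X Y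
  proof -
    have "fa (cmps (vcomp G ?F) 1) (\<lambda>j\<in>{i}. f) =
        fa (cmps G 1) (\<lambda>j\<in>fibre (idm {1}) 1. fa (cmps ?F j) (restrict (\<lambda>j\<in>{i}. f) (fibre (col {i}) j)))"
      using cmps_vcomp(2)[of 1 G "\<lambda>j\<in>{i}. f" ?F, unfolded d, OF _ hom_arr[OF h[OF f]]] 1 by (simp add: F G)
    also have "\<dots> = fa (cmps G 1) (\<lambda>j\<in>{1}. fa (sf I i) f)"
      unfolding fib1
      by (rule arg_cong[of _ _ "fa (cmps G 1)"], rule restrict_ext)
        (use hom_arr[OF f] fib F1 in \<open>simp add: sf_def single_simps\<close>)
    finally show ?thesis using hom_arr[OF functor_hom[OF sf_functor[OF I] f]] by (simp add: g_def single_simps)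
  qed
  have "nat_iso (K I i) (K I i) (cmp_functor (K I i) g (sf I i)) (id_functor (K I i))
      (\<lambda>X \<in> Obj (K I i). tcmps (t p) 1 (\<lambda>j\<in>{i}. X))"
  proof (rule nat_isoI)
    fix f X Y assume f: "f \<in> hom (K I i) X Y"
    note XY = category.hom_obj[OF cat_K[OF I] f]
    show "Cmp (K I i) ((\<lambda>X \<in> Obj (K I i). tcmps (t p) 1 (\<lambda>j\<in>{i}. X)) Y) (fa (cmp_functor (K I i) g (sf I i)) f) =
        Cmp (K I i) (fa (id_functor (K I i)) f) ((\<lambda>X \<in> Obj (K I i). tcmps (t p) 1 (\<lambda>j\<in>{i}. X)) X)"
      using n'(3)[OF h[OF f]] XY hom_arr[OF f] unfolding Ff[OF f] multi_simps(2)[OF hom_arr[OF h[OF f]]] by simp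
  next
    fix X assume X: "X \<in> Obj (K I i)"
    show "(\<lambda>X \<in> Obj (K I i). tcmps (t p) 1 (\<lambda>j\<in>{i}. X)) X \<in>
        hom (K I i) (fo (cmp_functor (K I i) g (sf I i)) X) (fo (id_functor (K I i)) X)"
      using n'(1)[OF o[OF X]] X unfolding FX[OF X] multi_simps(1)[OF o[OF X]] by simp
    show "iso_arr (K I i) ((\<lambda>X \<in> Obj (K I i). tcmps (t p) 1 (\<lambda>j\<in>{i}. X)) X)"
      using n'(2)[OF o[OF X]] X by simp
  qed simp
  then show ?thesis using g by blast
qed

text \<open>The functor from the universal property is a left inverse of \<open>sf\<close>, and
  \<open>sg\<close> is a right inverse, so \<open>sg\<close> is a left inverse too. This form is
  wanted because \<open>sg\<close> is known to be exact and to preserve degrees.\<close>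

lemma sg_sf:
  assumes I: "finite I" "i \<in> I"
  shows "\<exists>t. nat_iso (K I i) (K I i) (cmp_functor (K I i) (sg I i) (sf I i)) (id_functor (K I i)) t"
proof -
  obtain G a b where "is_functor D (K I i) G"
    "nat_iso (K I i) (K I i) (cmp_functor (K I i) G (sf I i)) (id_functor (K I i)) a"
    "nat_iso D D (cmp_functor D (sf I i) (sg I i)) (id_functor D) b"
    using sf_left_inverse[OF I] sf_sg[OF I] by blast
  then show ?thesis
    by (rule left_inverse_of_right_inverse[OF cat_K[OF I] cat_D sf_functor[OF I] sg_functor[OF I]])
qed

lemma sf_full:
  assumes I: "finite I" "i \<in> I" and X: "X \<in> Obj (K I i)" "Y \<in> Obj (K I i)"
    and v: "v \<in> hom D (fo (sf I i) X) (fo (sf I i) Y)"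
  shows "\<exists>u \<in> hom (K I i) X Y. fa (sf I i) u = v"
proof -
  obtain t b where "nat_iso (K I i) (K I i) (cmp_functor (K I i) (sg I i) (sf I i)) (id_functor (K I i)) t"
    "nat_iso D D (cmp_functor D (sf I i) (sg I i)) (id_functor D) b"
    using sg_sf[OF I] sf_sg[OF I] by blast
  then show ?thesis
    using full_of_inverse[OF cat_K[OF I] cat_D sf_functor[OF I] sg_functor[OF I] _ _ X v] by blast
qed

text \<open>Passing from a functor on a one-factor product to its one-variable form and back changes
  nothing (\<open>multi_single\<close>), so the Segal arrow is literally diagonal.\<close>

lemma segal_diag: "segal H C = diag (pob H (ones {1, 2})) ({1, 2}, \<lambda>i\<in>{1, 2}. C) (sf {1, 2})"
proof -
  have f: "finite {1, 2 :: nat}" by simp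
  have "cmps (par H (collapse {1, 2} {i})) 1 =
      multi i (\<lambda>i. tot (snd (pob H (ones {1, 2})) i)) (sf {1, 2} i)" if i: "i \<in> {1, 2}" for i
  proof -
    have "is_functor (Prod {i} (K {1, 2})) (K {1} 1) (act {1, 2} (col {i}) {1} 1)"
      using act_functor[OF pointed_col1[OF f i], of 1] unfolding fibre_col by simp
    from multi_single[OF this] show ?thesis
      unfolding sf_def by (simp add: act_def collapse_def K_def[abs_def])
  qed
  then have "(\<lambda>i\<in>{1, 2}. cmps (par H (collapse {1, 2} {i})) 1) =
      (\<lambda>i\<in>{1, 2}. multi i (\<lambda>i. tot (snd (pob H (ones {1, 2})) i)) (sf {1, 2} i))"
    by (rule restrict_ext)
  then show ?thesis unfolding segal_def diag_def fst_pob[OF f] by simp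
qed

lemma CC_vobjs: "({1, 2}, \<lambda>i\<in>{1, 2}. C) \<in> vobjs"
  using graded_C by (simp add: vobjs_def)

lemma segal_equivalence: "equivalence1 TwoVectGrTensor (segal H C)"
proof -
  have f: "finite {1, 2 :: nat}" by simp
  have "\<forall>i \<in> {1, 2}. \<exists>t. nat_iso (K {1, 2} i) (K {1, 2} i)
      (cmp_functor (K {1, 2} i) (sg {1, 2} i) (sf {1, 2} i)) (id_functor (K {1, 2} i)) t"
    using sg_sf[OF f] by blast
  then obtain t where t: "\<And>i. i \<in> {1, 2} \<Longrightarrow> nat_iso (K {1, 2} i) (K {1, 2} i)
      (cmp_functor (K {1, 2} i) (sg {1, 2} i) (sf {1, 2} i)) (id_functor (K {1, 2} i)) (t i)"
    by metis
  have "\<forall>i \<in> {1, 2}. \<exists>b. nat_iso D D (cmp_functor D (sf {1, 2} i) (sg {1, 2} i)) (id_functor D) b"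
    using sf_sg[OF f] by blast
  then obtain b where b: "\<And>i. i \<in> {1, 2} \<Longrightarrow>
      nat_iso D D (cmp_functor D (sf {1, 2} i) (sg {1, 2} i)) (id_functor D) (b i)"
    by metis
  show ?thesis
    unfolding segal_diag
    by (rule diag_equivalence[OF pob_vobjs[OF f] CC_vobjs, where G = "sg {1, 2}" and t = t and b = b];
        unfold fst_pob[OF f])
      (use sf_exact[OF f] sf_degree[OF f] sg_exact[OF f] sg_degree[OF f] t b in \<open>simp_all add: K_def[symmetric]\<close>)
qed

end

section \<open>The tensor product and its comparison with the image of the fold map\<close>

definition pair :: "'x \<Rightarrow> 'x \<Rightarrow> nat \<Rightarrow> 'x" where
  "pair x y = (\<lambda>i\<in>{1, 2}. if i = 1 then x else y)"

lemma pair_eta: "f \<in> extensional {1, 2} \<Longrightarrow> pair (f 1) (f 2) = f"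
  by (auto simp: pair_def extensional_def fun_eq_iff)

lemma pair_hom: "f \<in> hom C X X' \<Longrightarrow> g \<in> hom C Y Y' \<Longrightarrow>
    pair f g \<in> hom (Prod {1, 2} (\<lambda>_. C)) (pair X Y) (pair X' Y')"
  by (simp add: hom_Prod pair_def)

lemma pair_obj: "X \<in> Obj C \<Longrightarrow> Y \<in> Obj C \<Longrightarrow> pair X Y \<in> Obj (Prod {1, 2} (\<lambda>_. C))"
  by (simp add: Prod_simps pair_def)

context ssh
begin

abbreviation I2 :: "nat set" where
  "I2 \<equiv> {1, 2}"

definition fm where
  "fm = act I2 (col I2) {1} 1"

lemma fm:
  shows fm_exact: "multi_exact I2 (K I2) D fm" and fm_functor: "is_functor (Prod I2 (K I2)) D fm"
    and fm_degree: "of_degree 0 I2 (snd (pob H (ones I2))) C fm"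
proof -
  have p: "pointed_map I2 (col I2) {1}" by (rule pointed_col) auto
  have 1: "1 \<in> {1 :: nat}" by simp
  note a = act[OF p 1, unfolded fibre_col K1 pob1_1, folded fm_def]
  show "multi_exact I2 (K I2) D fm" "is_functor (Prod I2 (K I2)) D fm"
    "of_degree 0 I2 (snd (pob H (ones I2))) C fm"
    by (rule a)+
qed

text \<open>In each variable \<open>sg\<close> lifts an object of \<open>C\<close> to the
  corresponding component of \<open>H ([1], [1])\<close>, where \<open>fm\<close> multiplies. This
  is the image of the fold map composed with an inverse of the Segal arrow.\<close>

definition T where
  "T = precompose I2 (\<lambda>_. D) fm (sg I2)"

definition tO where "tO X Y = fo T (pair X Y)"

definition tA where "tA f g = fa T (pair f g)"

lemma sg2: "i \<in> I2 \<Longrightarrow> exact_functor D (K I2 i) (sg I2 i)" "i \<in> I2 \<Longrightarrow> is_functor D (K I2 i) (sg I2 i)"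
  "i \<in> I2 \<Longrightarrow> preserves_degree C (snd (pob H (ones I2)) i) (sg I2 i)"
  by (rule sg; simp)+

lemma T_exact: "multi_exact I2 (\<lambda>_. D) D T"
  unfolding T_def by (rule multi_exact_precompose[OF linear_D fm_exact sg2(1)])

lemma T_functor: "is_functor (Prod I2 (\<lambda>_. D)) D T"
  using T_exact by (simp add: multi_exact_def)

lemma tensor_arr_eq:
  assumes "tenO M = tO" "tenA M = tA"
  shows "tensor_arr C M = \<lparr>src = (I2, \<lambda>i\<in>I2. C), tgt = ({1}, \<lambda>i\<in>{1}. C), base = col I2, cmps = (\<lambda>j\<in>{1}. T)\<rparr>"
proof -
  have "\<lparr>fo = (\<lambda>A \<in> Obj (Prod I2 (\<lambda>i. D)). tenO M (A 1) (A 2)),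
        fa = (\<lambda>u \<in> Arr (Prod I2 (\<lambda>i. D)). tenA M (u 1) (u 2))\<rparr> = T"
  proof (rule fnctr_eqI[where C = "Prod I2 (\<lambda>i. D)"])
    show "fo \<lparr>fo = (\<lambda>A \<in> Obj (Prod I2 (\<lambda>i. D)). tenO M (A 1) (A 2)),
        fa = (\<lambda>u \<in> Arr (Prod I2 (\<lambda>i. D)). tenA M (u 1) (u 2))\<rparr> A = fo T A"
      if "A \<in> Obj (Prod I2 (\<lambda>i. D))" for A
      using that pair_eta[of A] assms by (simp add: tO_def) (simp add: Prod_simps PiE_def)
    show "fa \<lparr>fo = (\<lambda>A \<in> Obj (Prod I2 (\<lambda>i. D)). tenO M (A 1) (A 2)),
        fa = (\<lambda>u \<in> Arr (Prod I2 (\<lambda>i. D)). tenA M (u 1) (u 2))\<rparr> A = fa T A"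
      if "A \<in> Arr (Prod I2 (\<lambda>i. D))" for A
      using that pair_eta[of A] assms by (simp add: tA_def) (simp add: Prod_simps PiE_def)
  qed (use T_functor in \<open>auto simp: is_functor_def PiE_def\<close>)
  then show ?thesis by (simp add: tensor_arr_def)
qed

lemma C_vobjs: "({1}, \<lambda>i\<in>{1}. C) \<in> vobjs"
  using graded_C by (simp add: vobjs_def)

lemma tensor_arr:
  assumes "tenO M = tO" "tenA M = tA"
  shows "tensor_arr C M \<in> varrs {0..}" "degree_zero (tensor_arr C M)"
proof -
  let ?C = "\<lambda>i\<in>I2. C"
  \<comment> \<open>The source collection \<open>?C\<close> is undefined outside \<open>I2\<close>,
    so it differs as a function from the constant family in \<open>T\<close>; the products over
    \<open>I2\<close> agree.\<close>
  have T: "T = precompose I2 (\<lambda>i. tot (?C i)) fm (sg I2)"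
    unfolding T_def precompose_def
    using Prod_cong[of I2 I2 "\<lambda>i. tot (?C i)" "\<lambda>_. D"] by simp
  have e: "multi_exact I2 (\<lambda>i. tot (?C i)) D T"
    unfolding T by (rule multi_exact_precompose[OF _ fm_exact]) (use linear_D sg2(1) in auto)
  have d: "of_degree 0 I2 ?C C T"
    unfolding T by (rule of_degree_precompose[OF fm_degree]) (use sg2(3) in auto)
  have "bounded_multi_exact {0..} I2 ?C C T"
    by (rule bounded_multi_exactI[OF linear_D _ e d]) (use cat_D in auto)
  moreover have "pointed_map I2 (col I2) {1}" by (rule pointed_col) auto
  ultimately show "tensor_arr C M \<in> varrs {0..}"
    unfolding tensor_arr_eq[OF assms] varrs_def using CC_vobjs C_vobjs fibre_col[of I2] by simp
  show "degree_zero (tensor_arr C M)"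
    unfolding tensor_arr_eq[OF assms] degree_zero_def using d fibre_col[of I2] by simp
qed

definition sgf where
  "sgf i = cmp_functor (K I2 i) (sg I2 i) (sf I2 i)"

text \<open>One isomorphism \<open>sg sf \<cong> 1\<close> is fixed for each index;
  \<open>fm\<close> applied to the pair of them is the 2-cell \<open>th\<close>.\<close>

definition zt where
  "zt i = (SOME t. nat_iso (K I2 i) (K I2 i) (sgf i) (id_functor (K I2 i)) t)"

lemma zt: "i \<in> I2 \<Longrightarrow> nat_iso (K I2 i) (K I2 i) (sgf i) (id_functor (K I2 i)) (zt i)"
  unfolding zt_def using someI_ex[OF sg_sf[of I2 i]] by (simp add: sgf_def)

definition th where
  "th A = fa fm (\<lambda>i\<in>I2. zt i (A i))"

lemma sgf: "i \<in> I2 \<Longrightarrow> exact_functor (K I2 i) (K I2 i) (sgf i)"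
  "i \<in> I2 \<Longrightarrow> is_functor (K I2 i) (K I2 i) (sgf i)"
  "i \<in> I2 \<Longrightarrow> preserves_degree (snd (pob H (ones I2)) i) (snd (pob H (ones I2)) i) (sgf i)"
proof -
  assume i: "i \<in> I2"
  have f: "finite I2" by simp
  show 1: "exact_functor (K I2 i) (K I2 i) (sgf i)"
    unfolding sgf_def by (rule exact_cmp[OF linear_K[OF f i] sf_exact[OF f i] sg_exact[OF f i]])
  then show "is_functor (K I2 i) (K I2 i) (sgf i)" by (rule exact_functor_functor)
  show "preserves_degree (snd (pob H (ones I2)) i) (snd (pob H (ones I2)) i) (sgf i)"
    unfolding sgf_def K_def by (rule preserves_degree_cmp[OF sf_degree[OF f i] sg_degree[OF f i]])
qed

lemma th_nat_iso:
  "nat_iso (Prod I2 (K I2)) D (precompose I2 (K I2) fm sgf) fm (\<lambda>A \<in> Obj (Prod I2 (K I2)). th A)"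
  unfolding th_def
  by (rule nat_iso_precompose[OF _ cat_D fm_functor sgf(2) zt]) (simp_all add: cat_K)

text \<open>The composite applies \<open>sf\<close>, then \<open>sg\<close>, then \<open>fm\<close>;
  its only component is therefore, strictly, \<open>fm\<close> precomposed with \<open>sg sf\<close>
  in each variable.\<close>

lemma tensor_segal:
  assumes "tenO M = tO" "tenA M = tA"
  shows "vcomp (tensor_arr C M) (segal H C) = \<lparr>src = pob H (ones I2), tgt = ({1}, \<lambda>i\<in>{1}. C), base = col I2,
    cmps = (\<lambda>j\<in>{1}. precompose I2 (K I2) fm sgf)\<rparr>"
proof -
  let ?G = "tensor_arr C M" and ?F = "segal H C"
  have f: "finite I2" by simp
  have b: "base ?F = idm I2" "src ?F = pob H (ones I2)" "tgt ?F = (I2, \<lambda>i\<in>I2. C)"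
    unfolding segal_diag diag_simps fst_pob[OF f] by simp_all
  have c: "cmps ?F i = multi i (K I2) (sf I2 i)" if "i \<in> I2" for i
    unfolding segal_diag using that diag_simps(4)[of i "pob H (ones I2)"] fst_pob[OF f] by (simp add: K_def[abs_def])
  have g: "base ?G = col I2" "cmps ?G 1 = T" "tgt ?G = ({1}, \<lambda>i\<in>{1}. C)"
    unfolding tensor_arr_eq[OF assms] by simp_all
  have comp: "col I2 \<circ>\<^sub>m idm I2 = col I2" by (auto simp: map_comp_def fun_eq_iff)
  have d: "vdom (vcomp ?G ?F) 1 = Prod I2 (K I2)"
    unfolding vcomp_simps b g comp fibre_col by (simp add: K_def[abs_def])
  have 1: "1 \<in> fst (tgt ?G)" by (simp add: g)
  have fib: "fibre (idm I2) j = {j}" if "j \<in> I2" for j using that by (auto simp: fibre_def)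
  have fib1: "fibre (base ?G) 1 = I2" unfolding g by (rule fibre_col)
  have "cmps (vcomp ?G ?F) 1 = precompose I2 (K I2) fm sgf"
  proof (rule fnctr_eqI[where C = "Prod I2 (K I2)"])
    fix A assume A: "A \<in> Obj (Prod I2 (K I2))"
    have Ai: "A i \<in> Obj (K I2 i)" if "i \<in> I2" for i using A that by (auto simp: Prod_simps)
    have sA: "(\<lambda>i\<in>I2. fo (sf I2 i) (A i)) \<in> Obj (Prod I2 (\<lambda>_. D))"
      using functor_obj[OF sf_functor[OF f] Ai] by (simp add: Prod_simps)
    have "(\<lambda>j\<in>I2. fo (cmps ?F j) (restrict A (fibre (idm I2) j))) = (\<lambda>i\<in>I2. fo (sf I2 i) (A i))"
    proof (rule restrict_ext)
      fix j assume j: "j \<in> I2"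
      have "restrict A {j} \<in> Obj (Prod {j} (K I2))" using restrict_Obj_Prod[OF A, of "{j}"] j by blast
      then show "fo (cmps ?F j) (restrict A (fibre (idm I2) j)) = fo (sf I2 j) (A j)"
        unfolding fib[OF j] c[OF j] by (simp add: multi_simps)
    qed
    then have "fo (cmps (vcomp ?G ?F) 1) A = fo T (\<lambda>i\<in>I2. fo (sf I2 i) (A i))"
      using cmps_vcomp(1)[OF 1, of A ?F, unfolded d fib1 g(2) b(1), OF A] by simp
    also have "\<dots> = fo fm (\<lambda>i\<in>I2. fo (sg I2 i) (fo (sf I2 i) (A i)))"
      unfolding T_def precompose_simps(1)[OF sA]
      by (rule arg_cong[of _ _ "fo fm"], rule restrict_ext) simp
    also have "\<dots> = fo (precompose I2 (K I2) fm sgf) A"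
      unfolding precompose_simps(1)[OF A]
      by (rule arg_cong[of _ _ "fo fm"], rule restrict_ext) (use Ai in \<open>simp add: sgf_def\<close>)
    finally show "fo (cmps (vcomp ?G ?F) 1) A = fo (precompose I2 (K I2) fm sgf) A" .
  next
    fix A assume A: "A \<in> Arr (Prod I2 (K I2))"
    have Ai: "A i \<in> Arr (K I2 i)" if "i \<in> I2" for i using A that by (auto simp: Prod_simps)
    have sA: "(\<lambda>i\<in>I2. fa (sf I2 i) (A i)) \<in> Arr (Prod I2 (\<lambda>_. D))"
      using hom_arr[OF functor_hom[OF sf_functor[OF f] arr_hom[OF Ai]]] by (simp add: Prod_simps)
    have "(\<lambda>j\<in>I2. fa (cmps ?F j) (restrict A (fibre (idm I2) j))) = (\<lambda>i\<in>I2. fa (sf I2 i) (A i))"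
    proof (rule restrict_ext)
      fix j assume j: "j \<in> I2"
      have "restrict A {j} \<in> Arr (Prod {j} (K I2))" using Ai j by (simp add: Prod_simps)
      then show "fa (cmps ?F j) (restrict A (fibre (idm I2) j)) = fa (sf I2 j) (A j)"
        unfolding fib[OF j] c[OF j] by (simp add: multi_simps)
    qed
    then have "fa (cmps (vcomp ?G ?F) 1) A = fa T (\<lambda>i\<in>I2. fa (sf I2 i) (A i))"
      using cmps_vcomp(2)[OF 1, of A ?F, unfolded d fib1 g(2) b(1), OF A] by simp
    also have "\<dots> = fa fm (\<lambda>i\<in>I2. fa (sg I2 i) (fa (sf I2 i) (A i)))"
      unfolding T_def precompose_simps(2)[OF sA]
      by (rule arg_cong[of _ _ "fa fm"], rule restrict_ext) simp
    also have "\<dots> = fa (precompose I2 (K I2) fm sgf) A"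
      unfolding precompose_simps(2)[OF A]
      by (rule arg_cong[of _ _ "fa fm"], rule restrict_ext) (use Ai in \<open>simp add: sgf_def\<close>)
    finally show "fa (cmps (vcomp ?G ?F) 1) A = fa (precompose I2 (K I2) fm sgf) A" .
  next
    show "fo (cmps (vcomp ?G ?F) 1) \<in> extensional (Obj (Prod I2 (K I2)))"
      "fa (cmps (vcomp ?G ?F) 1) \<in> extensional (Arr (Prod I2 (K I2)))"
      using d 1 by (simp_all add: vcomp_def Let_def)
  qed (simp_all add: precompose_def)
  then have "cmps (vcomp ?G ?F) = (\<lambda>j\<in>{1}. precompose I2 (K I2) fm sgf)"
    by (intro extensionalityI[of _ "{1}"]) (simp_all add: vcomp_def g)
  then show ?thesis
    by (intro coll_arr.equality) (simp_all only: vcomp_simps b g comp coll_arr.simps unit_eq)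
qed

lemma fold_map_par:
  "par H fold_map \<in> varrs {0..}" "src (par H fold_map) = pob H (ones I2)"
  "tgt (par H fold_map) = ({1}, \<lambda>i\<in>{1}. C)" "base (par H fold_map) = col I2" "cmps (par H fold_map) 1 = fm"
proof -
  have "pointed_map I2 (col I2) {1}" by (rule pointed_col) auto
  note p = par[OF this]
  show "par H fold_map \<in> varrs {0..}" "src (par H fold_map) = pob H (ones I2)"
    "tgt (par H fold_map) = ({1}, \<lambda>i\<in>{1}. C)" "base (par H fold_map) = col I2" "cmps (par H fold_map) 1 = fm"
    unfolding fold_map_def collapse_def p pob1 fm_def act_def using p(1) by simp_all
qed

definition Th where
  "Th M = \<lparr>tsrc = vcomp (tensor_arr C M) (segal H C), ttgt = par H fold_map,
     tcmps = (\<lambda>j\<in>{1}. \<lambda>A \<in> Obj (Prod I2 (K I2)). th A)\<rparr>"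

lemma Th:
  assumes "tenO M = tO" "tenA M = tA"
  shows "Th M \<in> hom2 (GrVect {0..}) (vcomp (tensor_arr C M) (segal H C)) (par H fold_map)"
    and "invertible2 (GrVect {0..}) (Th M)"
proof -
  let ?F = "vcomp (tensor_arr C M) (segal H C)"
  note F = tensor_segal[OF assms]
  have f: "finite I2" by simp
  have "multi_exact I2 (K I2) D (precompose I2 (K I2) fm sgf)"
    by (rule multi_exact_precompose[OF _ fm_exact sgf(1)]) (simp_all add: linear_K)
  moreover have "of_degree 0 I2 (snd (pob H (ones I2))) C (precompose I2 (K I2) fm sgf)"
    using of_degree_precompose[OF fm_degree, of "snd (pob H (ones I2))" sgf] sgf(3) by (simp add: K_def[abs_def])
  moreover have KI: "K I2 = (\<lambda>i. tot (snd (pob H (ones I2)) i))" by (simp add: K_def fun_eq_iff)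
  ultimately have "bounded_multi_exact {0..} I2 (snd (pob H (ones I2))) C (precompose I2 (K I2) fm sgf)"
    using cat_K[OF f] unfolding KI by (intro bounded_multi_exactI[where d = 0] linear_D) auto
  moreover have "pointed_map I2 (col I2) {1}" by (rule pointed_col) auto
  ultimately have v: "?F \<in> varrs {0..}"
    unfolding F varrs_def using pob_vobjs[OF f] C_vobjs fst_pob[OF f] fibre_col[of I2] by simp
  have n: "nat_iso (vdom ?F j) (vcod ?F j) (cmps ?F j) (cmps (par H fold_map) j)
      ((\<lambda>j\<in>{1}. \<lambda>A \<in> Obj (Prod I2 (K I2)). th A) j)" if "j \<in> fst (tgt ?F)" for j
  proof -
    have j: "j = 1" using that by (simp add: F)
    show ?thesis
      unfolding j F coll_arr.simps fibre_col fold_map_par KI[symmetric] using th_nat_iso by simp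
  qed
  have e: "(\<lambda>j\<in>{1}. \<lambda>A \<in> Obj (Prod I2 (K I2)). th A) \<in> extensional (fst (tgt ?F))"
    unfolding F by simp
  have "src (par H fold_map) = src ?F" "tgt (par H fold_map) = tgt ?F" "base (par H fold_map) = base ?F"
    unfolding F fold_map_par by simp_all
  note c = cellI[OF v fold_map_par(1) this e n, folded Th_def]
  show "Th M \<in> hom2 (GrVect {0..}) ?F (par H fold_map)" by (rule c(1))
  show "invertible2 (GrVect {0..}) (Th M)" by (rule c(2))
qed

text \<open>
  \<open>Nh J S u\<close> is the action on maps of the functor \<open>A \<mapsto> mprod H J S A\<close>, and \<open>cc I \<sigma> J S A\<close> is the
  compositor from \<open>mprod H J S (\<sigma>\<^sub>* A)\<close> to \<open>mprod H I (\<sigma>\<inverse> S) A\<close>.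
\<close>

abbreviation Nn where
  "Nn J S A \<equiv> mprod H J S A"

definition Nh where
  "Nh J S u = pusha J (col S) {1} u 1"

definition cc where
  "cc I \<sigma> J S A = muf I \<sigma> J (col S) {1} A 1"

lemma mprod_push: "Nn J S A = push J (col S) {1} A 1"
  unfolding mprod_def push_def act_def collapse_def using fibre_col[of S] by simp

lemma Nn_obj:
  assumes "finite J" "S \<subseteq> J" "A \<in> Obj (Prod J (K J))"
  shows "Nn J S A \<in> Obj D"
  using PiE_mem[OF push_obj[OF pointed_col[OF assms(1,2)] assms(3), unfolded Prod_simps], of 1] K1
  unfolding mprod_push by simp

lemma Nh_hom:
  assumes "finite J" "S \<subseteq> J" "u \<in> hom (Prod J (K J)) A B"
  shows "Nh J S u \<in> hom D (Nn J S A) (Nn J S B)"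
  using pusha_hom[OF pointed_col[OF assms(1,2)] assms(3)] K1
  unfolding mprod_push Nh_def by (simp add: hom_Prod)

lemma cc:
  assumes "pointed_map I \<sigma> J" "S \<subseteq> J" "A \<in> Obj (Prod I (K I))"
  shows cc_hom: "cc I \<sigma> J S A \<in> hom D (Nn J S (push I \<sigma> J A)) (Nn I (pre \<sigma> S) A)"
    and cc_iso: "iso_arr D (cc I \<sigma> J S A)"
    and cc_nat: "u \<in> hom (Prod I (K I)) A B \<Longrightarrow>
      Cmp D (cc I \<sigma> J S B) (Nh J S (pusha I \<sigma> J u)) = Cmp D (Nh I (pre \<sigma> S) u) (cc I \<sigma> J S A)"
proof -
  have p: "pointed_map J (col S) {1}" by (rule pointed_col[OF finite_pointed(2)[OF assms(1)] assms(2)])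
  have 1: "1 \<in> {1 :: nat}" by simp
  have m: "cc I \<sigma> J S A = mu I \<sigma> J (col S) {1} 1 (restrict A (fibre (col S \<circ>\<^sub>m \<sigma>) 1))" for A
    by (simp add: cc_def muf_def)
  note h = mu[OF assms(1) p 1 assms(3), folded m, unfolded K1 col_comp]
  show "cc I \<sigma> J S A \<in> hom D (Nn J S (push I \<sigma> J A)) (Nn I (pre \<sigma> S) A)"
    unfolding mprod_push by (rule h(1))
  show "iso_arr D (cc I \<sigma> J S A)" by (rule h(2))
  show "u \<in> hom (Prod I (K I)) A B \<Longrightarrow>
      Cmp D (cc I \<sigma> J S B) (Nh J S (pusha I \<sigma> J u)) = Cmp D (Nh I (pre \<sigma> S) u) (cc I \<sigma> J S A)"
    unfolding Nh_def using h(3) .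
qed

text \<open>This is associativity of the compositors with a collapse as the last map; by
  \<open>col_comp\<close> the composites with it are again collapses, of inverse images.\<close>

lemma cc_assoc:
  assumes "pointed_map I \<sigma> J" "pointed_map J \<tau> L" "S \<subseteq> L" "A \<in> Obj (Prod I (K I))"
  shows "Cmp D (cc I (\<tau> \<circ>\<^sub>m \<sigma>) L S A) (Nh L S (muf I \<sigma> J \<tau> L A)) =
    Cmp D (cc I \<sigma> J (pre \<tau> S) A) (cc J \<tau> L S (push I \<sigma> J A))"
proof -
  have p: "pointed_map L (col S) {1}" by (rule pointed_col[OF finite_pointed(2)[OF assms(2)] assms(3)])
  have 1: "1 \<in> {1 :: nat}" by simp
  show ?thesis
    using mu_assoc[OF assms(1,2) p 1 assms(4), unfolded K1 col_comp]
    by (simp only: cc_def Nh_def)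
qed

text \<open>The product with one factor is the Segal functor of that factor. This links the abstract
  products to the objects of \<open>C\<close> that a tuple lifts.\<close>

lemma Nh_single:
  assumes "i \<in> I"
  shows "A \<in> Obj (Prod I (K I)) \<Longrightarrow> Nn I {i} A = fo (sf I i) (A i)"
    and "u \<in> Arr (Prod I (K I)) \<Longrightarrow> Nh I {i} u = fa (sf I i) (u i)"
  using push_sf[OF assms] by (simp_all only: mprod_push Nh_def)

lemma fm_push: "A \<in> Obj (Prod I2 (K I2)) \<Longrightarrow> Nn I2 I2 A = fo fm A"
  "u \<in> Arr (Prod I2 (K I2)) \<Longrightarrow> Nh I2 I2 u = fa fm u"
proof -
  have r: "restrict f I2 = f" if "f \<in> extensional I2" for f :: "nat \<Rightarrow> 'z"
    using that by (auto simp: extensional_def fun_eq_iff)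
  show "A \<in> Obj (Prod I2 (K I2)) \<Longrightarrow> Nn I2 I2 A = fo fm A"
    "u \<in> Arr (Prod I2 (K I2)) \<Longrightarrow> Nh I2 I2 u = fa fm u"
    unfolding mprod_push Nh_def push_def pusha_def fm_def using fibre_col[of I2] r[of A] r[of u]
    by (simp_all add: Prod_simps PiE_def)
qed

text \<open>The source of \<open>th_nat_iso\<close> involves \<open>sg sf\<close> in each variable;
  by \<open>Nh_single\<close> it is the tensor product of the two one-factor products, while its
  target is the product over both indices.\<close>

lemma th:
  assumes A: "A \<in> Obj (Prod I2 (K I2))"
  shows th_hom: "th A \<in> hom D (tO (Nn I2 {1} A) (Nn I2 {2} A)) (Nn I2 I2 A)"
    and th_iso: "iso_arr D (th A)"
    and th_nat: "u \<in> hom (Prod I2 (K I2)) A B \<Longrightarrow>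
      Cmp D (th B) (tA (Nh I2 {1} u) (Nh I2 {2} u)) = Cmp D (Nh I2 I2 u) (th A)"
proof -
  note t = nat_isoD[OF th_nat_iso]
  have f: "finite I2" by simp
  have O: "fo (precompose I2 (K I2) fm sgf) A = tO (Nn I2 {1} A) (Nn I2 {2} A)"
    if A: "A \<in> Obj (Prod I2 (K I2))" for A
  proof -
    have Ai: "A i \<in> Obj (K I2 i)" if "i \<in> I2" for i using A that by (auto simp: Prod_simps)
    have "Nn I2 {1} A \<in> Obj D" "Nn I2 {2} A \<in> Obj D" using Nn_obj[OF f _ A] by auto
    then have o: "pair (Nn I2 {1} A) (Nn I2 {2} A) \<in> Obj (Prod I2 (\<lambda>_. D))" by (rule pair_obj)
    have "fo (sgf i) (A i) = fo (sg I2 i) (pair (Nn I2 {1} A) (Nn I2 {2} A) i)" if i: "i \<in> I2" for i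
      using i Ai[OF i] Nh_single(1)[OF i A] by (auto simp: sgf_def pair_def)
    then show ?thesis
      unfolding tO_def T_def precompose_simps(1)[OF A] precompose_simps(1)[OF o]
      by (intro arg_cong[of _ _ "fo fm"] restrict_ext)
  qed
  have P: "category (Prod I2 (K I2))" by (rule cat_PK) auto
  show "th A \<in> hom D (tO (Nn I2 {1} A) (Nn I2 {2} A)) (Nn I2 I2 A)"
    using t(1)[OF A] A unfolding O[OF A] fm_push(1)[OF A] by simp
  show "iso_arr D (th A)" using t(2)[OF A] A by simp
  assume u: "u \<in> hom (Prod I2 (K I2)) A B"
  note B = category.hom_obj(2)[OF P u]
  have ui: "u i \<in> Arr (K I2 i)" if "i \<in> I2" for i using hom_arr[OF u] that by (auto simp: Prod_simps)
  have "Nh I2 {1} u \<in> hom D (Nn I2 {1} A) (Nn I2 {1} B)" "Nh I2 {2} u \<in> hom D (Nn I2 {2} A) (Nn I2 {2} B)"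
    using Nh_hom[OF f _ u] by auto
  then have o: "pair (Nh I2 {1} u) (Nh I2 {2} u) \<in> Arr (Prod I2 (\<lambda>_. D))" by (rule hom_arr[OF pair_hom])
  have "fa (sgf i) (u i) = fa (sg I2 i) (pair (Nh I2 {1} u) (Nh I2 {2} u) i)" if i: "i \<in> I2" for i
    using i ui[OF i] Nh_single(2)[OF i hom_arr[OF u]] by (auto simp: sgf_def pair_def)
  then have "fa (precompose I2 (K I2) fm sgf) u = tA (Nh I2 {1} u) (Nh I2 {2} u)"
    unfolding tA_def T_def precompose_simps(2)[OF hom_arr[OF u]] precompose_simps(2)[OF o]
    by (intro arg_cong[of _ _ "fa fm"] restrict_ext)
  then show "Cmp D (th B) (tA (Nh I2 {1} u) (Nh I2 {2} u)) = Cmp D (Nh I2 I2 u) (th A)"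
    using t(3)[OF u] A B fm_push(2)[OF hom_arr[OF u]] by simp
qed

lemma tensor_functor:
  shows tO_obj: "X \<in> Obj D \<Longrightarrow> Y \<in> Obj D \<Longrightarrow> tO X Y \<in> Obj D"
    and tA_hom: "f \<in> hom D X X' \<Longrightarrow> g \<in> hom D Y Y' \<Longrightarrow> tA f g \<in> hom D (tO X Y) (tO X' Y')"
    and tA_idn: "X \<in> Obj D \<Longrightarrow> Y \<in> Obj D \<Longrightarrow> tA (Idn D X) (Idn D Y) = Idn D (tO X Y)"
    and tA_cmp: "f \<in> hom D X X' \<Longrightarrow> f' \<in> hom D X' X'' \<Longrightarrow> g \<in> hom D Y Y' \<Longrightarrow> g' \<in> hom D Y' Y'' \<Longrightarrow>
      tA (Cmp D f' f) (Cmp D g' g) = Cmp D (tA f' g') (tA f g)"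
proof -
  show "X \<in> Obj D \<Longrightarrow> Y \<in> Obj D \<Longrightarrow> tO X Y \<in> Obj D"
    unfolding tO_def by (rule functor_obj[OF T_functor pair_obj])
  show "f \<in> hom D X X' \<Longrightarrow> g \<in> hom D Y Y' \<Longrightarrow> tA f g \<in> hom D (tO X Y) (tO X' Y')"
    unfolding tO_def tA_def by (rule functor_hom[OF T_functor pair_hom])
  show "X \<in> Obj D \<Longrightarrow> Y \<in> Obj D \<Longrightarrow> tA (Idn D X) (Idn D Y) = Idn D (tO X Y)"
  proof -
    assume o: "X \<in> Obj D" "Y \<in> Obj D"
    have "pair (Idn D X) (Idn D Y) = Idn (Prod I2 (\<lambda>_. D)) (pair X Y)"
      by (auto simp: pair_def Prod_simps fun_eq_iff)
    then show ?thesis unfolding tO_def tA_def using functor_idn[OF T_functor pair_obj[OF o]] by simp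
  qed
  show "tA (Cmp D f' f) (Cmp D g' g) = Cmp D (tA f' g') (tA f g)"
    if "f \<in> hom D X X'" "f' \<in> hom D X' X''" "g \<in> hom D Y Y'" "g' \<in> hom D Y' Y''"
  proof -
    have "pair (Cmp D f' f) (Cmp D g' g) = Cmp (Prod I2 (\<lambda>_. D)) (pair f' g') (pair f g)"
      by (auto simp: pair_def Prod_simps fun_eq_iff)
    then show ?thesis
      unfolding tA_def using functor_cmp[OF T_functor pair_hom[OF that(1,3)] pair_hom[OF that(2,4)]] by simp
  qed
qed

lemma tA_iso:
  assumes "f \<in> hom D X X'" "iso_arr D f" "g \<in> hom D Y Y'" "iso_arr D g"
  shows "iso_arr D (tA f g)"
proof -
  have "iso_arr (Prod I2 (\<lambda>_. D)) (pair f g)"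
    by (rule iso_Prod[OF cat_D pair_hom[OF assms(1,3)]]) (use assms in \<open>auto simp: pair_def\<close>)
  then show ?thesis
    unfolding tA_def
    by (rule functor_iso[OF category_Prod[OF cat_D] cat_D T_functor pair_hom[OF assms(1,3)]])
qed

section \<open>Binary multiplication of unbiased products\<close>

definition mult where
  "mult I S S' A = Cmp D (cc I (spl S S') I2 I2 A)
     (Cmp D (th (push I (spl S S') I2 A))
       (inv_arr D (tA (cc I (spl S S') I2 {1} A) (cc I (spl S S') I2 {2} A))))"

text \<open>The compositors in \<open>mult_iso\<close> are instances of \<open>cc\<close> for the
  splitting map, because the inverse images of \<open>{1}\<close>, \<open>{2}\<close> and
  \<open>{1, 2}\<close> under it are \<open>S\<close>, \<open>S'\<close> and their union.\<close>

lemma mult_iso_mult: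
  assumes I: "finite I" "S \<subseteq> I" "S' \<subseteq> I" "S \<inter> S' = {}" and A: "A \<in> Obj (Prod I (K I))"
    and M: "tenO M = tO" "tenA M = tA"
  shows "mult_iso H C M (Th M) I S S' A = mult I S S' A"
proof -
  note p = pointed_spl[OF I(1-3)]
  have c: "tcmps (pmu H (collapse I2 R) (split_map I S S')) 1 (restrict A (pre (spl S S') R)) =
      cc I (spl S S') I2 R A" for R
    unfolding cc_def muf_def mu_def col_comp collapse_def split_map_def using fibre_col[of "pre (spl S S') R"]
    by simp
  have b: "base (split_map I S S') = spl S S'" by (simp add: split_map_def ids_def)
  have push: "(\<lambda>j \<in> I2. fo (cmps (par H (split_map I S S')) j) (restrict A (fibre (spl S S') j))) =
      push I (spl S S') I2 A"
    by (simp add: push_def act_def split_map_def)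
  have t: "tcmps (Th M) 1 (push I (spl S S') I2 A) = th (push I (spl S S') I2 A)"
    using push_obj[OF p A] by (simp add: Th_def)
  show ?thesis
    unfolding mult_iso_def Let_def b push t mult_def M
    using c[of "{1}"] c[of "{2}"] c[of I2] unfolding pre_spl[OF I(4)] fold_map_def by simp
qed

text \<open>\<open>mult_eq\<close> is the definition of \<open>mult\<close> freed of its inverse.
  Equations about \<open>mult\<close> are proved below by precomposing with the invertible
  \<open>tA\<close> term and rewriting with it.\<close>

lemma mult_char:
  assumes I: "finite I" "S \<subseteq> I" "S' \<subseteq> I" "S \<inter> S' = {}" and A: "A \<in> Obj (Prod I (K I))"
  defines "\<sigma> \<equiv> spl S S'"
  shows mult_hom: "mult I S S' A \<in> hom D (tO (Nn I S A) (Nn I S' A)) (Nn I (S \<union> S') A)"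
    and mult_is_iso: "iso_arr D (mult I S S' A)"
    and mult_eq: "Cmp D (mult I S S' A) (tA (cc I \<sigma> I2 {1} A) (cc I \<sigma> I2 {2} A)) =
      Cmp D (cc I \<sigma> I2 I2 A) (th (push I \<sigma> I2 A))"
    and cc_spl: "cc I \<sigma> I2 {1} A \<in> hom D (Nn I2 {1} (push I \<sigma> I2 A)) (Nn I S A)"
      "cc I \<sigma> I2 {2} A \<in> hom D (Nn I2 {2} (push I \<sigma> I2 A)) (Nn I S' A)"
      "cc I \<sigma> I2 I2 A \<in> hom D (Nn I2 I2 (push I \<sigma> I2 A)) (Nn I (S \<union> S') A)"
    and cc_spl_iso: "iso_arr D (tA (cc I \<sigma> I2 {1} A) (cc I \<sigma> I2 {2} A))"
proof -
  interpret category D by (rule cat_D)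
  note p = pointed_spl[OF I(1-3), folded \<sigma>_def]
  note P = push_obj[OF p A]
  show 1: "cc I \<sigma> I2 {1} A \<in> hom D (Nn I2 {1} (push I \<sigma> I2 A)) (Nn I S A)"
    and 2: "cc I \<sigma> I2 {2} A \<in> hom D (Nn I2 {2} (push I \<sigma> I2 A)) (Nn I S' A)"
    and 3: "cc I \<sigma> I2 I2 A \<in> hom D (Nn I2 I2 (push I \<sigma> I2 A)) (Nn I (S \<union> S') A)"
    using cc_hom[OF p _ A, of "{1}"] cc_hom[OF p _ A, of "{2}"] cc_hom[OF p _ A, of I2]
    unfolding \<sigma>_def pre_spl[OF I(4)] by simp_all
  have i: "iso_arr D (cc I \<sigma> I2 {1} A)" "iso_arr D (cc I \<sigma> I2 {2} A)" "iso_arr D (cc I \<sigma> I2 I2 A)"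
    using cc_iso[OF p _ A] by auto
  note k = tA_hom[OF 1 2]
  show ki: "iso_arr D (tA (cc I \<sigma> I2 {1} A) (cc I \<sigma> I2 {2} A))" by (rule tA_iso[OF 1 i(1) 2 i(2)])
  note t = th_hom[OF P] and ti = th_iso[OF P]
  note k' = inv_hom[OF ki k] and ki' = iso_inv[OF ki k]
  show "mult I S S' A \<in> hom D (tO (Nn I S A) (Nn I S' A)) (Nn I (S \<union> S') A)"
    unfolding mult_def \<sigma>_def[symmetric] by (rule cmp_hom[OF cmp_hom[OF k' t] 3])
  show "iso_arr D (mult I S S' A)"
    unfolding mult_def \<sigma>_def[symmetric]
    by (rule iso_cmp[OF iso_cmp[OF ki' k' ti t] cmp_hom[OF k' t] i(3) 3])
  have "Cmp D (Cmp D (cc I \<sigma> I2 I2 A) (Cmp D (th (push I \<sigma> I2 A))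
      (inv_arr D (tA (cc I \<sigma> I2 {1} A) (cc I \<sigma> I2 {2} A))))) (tA (cc I \<sigma> I2 {1} A) (cc I \<sigma> I2 {2} A)) =
      Cmp D (cc I \<sigma> I2 I2 A) (th (push I \<sigma> I2 A))"
    using cmp_assoc[OF k cmp_hom[OF k' t] 3] cancel_right'[OF ki k t] by simp
  then show "Cmp D (mult I S S' A) (tA (cc I \<sigma> I2 {1} A) (cc I \<sigma> I2 {2} A)) =
      Cmp D (cc I \<sigma> I2 I2 A) (th (push I \<sigma> I2 A))"
    unfolding mult_def \<sigma>_def[symmetric] .
qed

text \<open>Both sides are compared after precomposition with the invertible \<open>?kA\<close>,
  where naturality of \<open>cc\<close> along \<open>u\<close> and of \<open>th\<close> along the
  pushed map \<open>?u\<close> suffices.\<close>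

lemma mult_nat:
  assumes I: "finite I" "S \<subseteq> I" "S' \<subseteq> I" "S \<inter> S' = {}" and u: "u \<in> hom (Prod I (K I)) A B"
  shows "Cmp D (Nh I (S \<union> S') u) (mult I S S' A) = Cmp D (mult I S S' B) (tA (Nh I S u) (Nh I S' u))"
proof -
  interpret category D by (rule cat_D)
  have "category (Prod I (K I))" by (rule cat_PK[OF I(1)]) simp
  note A = category.hom_obj(1)[OF this u] and B = category.hom_obj(2)[OF this u]
  define \<sigma> where "\<sigma> = spl S S'"
  note p = pointed_spl[OF I(1-3), folded \<sigma>_def]
  note pu = pusha_hom[OF p u]
  note mA = mult_char[OF I A, folded \<sigma>_def] and mB = mult_char[OF I B, folded \<sigma>_def]
  have f: "finite I2" by simp
  let ?u = "pusha I \<sigma> I2 u"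
  have N: "Nh I2 {1} ?u \<in> hom D (Nn I2 {1} (push I \<sigma> I2 A)) (Nn I2 {1} (push I \<sigma> I2 B))"
    "Nh I2 {2} ?u \<in> hom D (Nn I2 {2} (push I \<sigma> I2 A)) (Nn I2 {2} (push I \<sigma> I2 B))"
    "Nh I2 I2 ?u \<in> hom D (Nn I2 I2 (push I \<sigma> I2 A)) (Nn I2 I2 (push I \<sigma> I2 B))"
    using Nh_hom[OF f _ pu] by auto
  have Nu: "Nh I S u \<in> hom D (Nn I S A) (Nn I S B)" "Nh I S' u \<in> hom D (Nn I S' A) (Nn I S' B)"
    "Nh I (S \<union> S') u \<in> hom D (Nn I (S \<union> S') A) (Nn I (S \<union> S') B)"
    using Nh_hom[OF I(1) _ u] I by auto
  have n: "Cmp D (cc I \<sigma> I2 {1} B) (Nh I2 {1} ?u) = Cmp D (Nh I S u) (cc I \<sigma> I2 {1} A)"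
    "Cmp D (cc I \<sigma> I2 {2} B) (Nh I2 {2} ?u) = Cmp D (Nh I S' u) (cc I \<sigma> I2 {2} A)"
    "Cmp D (cc I \<sigma> I2 I2 B) (Nh I2 I2 ?u) = Cmp D (Nh I (S \<union> S') u) (cc I \<sigma> I2 I2 A)"
    using cc_nat[OF p _ A u, of "{1}"] cc_nat[OF p _ A u, of "{2}"] cc_nat[OF p _ A u, of I2]
    unfolding \<sigma>_def pre_spl[OF I(4)] by simp_all
  let ?kA = "tA (cc I \<sigma> I2 {1} A) (cc I \<sigma> I2 {2} A)" and ?kB = "tA (cc I \<sigma> I2 {1} B) (cc I \<sigma> I2 {2} B)"
  note tA = th_hom[OF push_obj[OF p A]] and tB = th_hom[OF push_obj[OF p B]]
  note kA = tA_hom[OF mA(4,5)] and kB = tA_hom[OF mB(4,5)]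
  have "Cmp D (Cmp D (Nh I (S \<union> S') u) (mult I S S' A)) ?kA =
      Cmp D (Nh I (S \<union> S') u) (Cmp D (cc I \<sigma> I2 I2 A) (th (push I \<sigma> I2 A)))"
    using cmp_assoc[OF kA mA(1) Nu(3)] mA(3) by simp
  also have "\<dots> = Cmp D (Cmp D (cc I \<sigma> I2 I2 B) (Nh I2 I2 ?u)) (th (push I \<sigma> I2 A))"
    using cmp_assoc[OF tA mA(6) Nu(3)] n(3) by simp
  also have "\<dots> = Cmp D (cc I \<sigma> I2 I2 B) (Cmp D (th (push I \<sigma> I2 B)) (tA (Nh I2 {1} ?u) (Nh I2 {2} ?u)))"
    using cmp_assoc[OF tA N(3) mB(6)] th_nat[OF push_obj[OF p A] pu] by simp
  also have "\<dots> = Cmp D (Cmp D (mult I S S' B) ?kB) (tA (Nh I2 {1} ?u) (Nh I2 {2} ?u))"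
    using cmp_assoc[OF tA_hom[OF N(1,2)] tB mB(6)] mB(3) by simp
  also have "\<dots> = Cmp D (mult I S S' B) (tA (Cmp D (Nh I S u) (cc I \<sigma> I2 {1} A)) (Cmp D (Nh I S' u) (cc I \<sigma> I2 {2} A)))"
    using cmp_assoc[OF tA_hom[OF N(1,2)] kB mB(1)] tA_cmp[OF N(1) mB(4) N(2) mB(5)] n by simp
  also have "\<dots> = Cmp D (Cmp D (mult I S S' B) (tA (Nh I S u) (Nh I S' u))) ?kA"
    using cmp_assoc[OF kA tA_hom[OF Nu(1,2)] mB(1)] tA_cmp[OF mA(4) Nu(1) mA(5) Nu(2)] by simp
  finally show ?thesis
    by (rule iso_epic[OF mA(7) kA cmp_hom[OF mA(1) Nu(3)] cmp_hom[OF tA_hom[OF Nu(1,2)] mB(1)]])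
qed

text \<open>Splitting \<open>J\<close> after \<open>\<sigma>\<close> is splitting \<open>I\<close>
  by inverse images. The tuple pushed in two steps and the tuple pushed in one step are related by
  the compositor \<open>w\<close>; \<open>th\<close> is natural along \<open>w\<close>, and
  \<open>cc_assoc\<close> relates the compositors over \<open>{1}\<close>, \<open>{2}\<close> and
  \<open>{1, 2}\<close>.\<close>

lemma mult_push:
  assumes s: "pointed_map I \<sigma> J" and S: "S \<subseteq> J" "S' \<subseteq> J" "S \<inter> S' = {}" and A: "A \<in> Obj (Prod I (K I))"
  shows "Cmp D (cc I \<sigma> J (S \<union> S') A) (mult J S S' (push I \<sigma> J A)) =
    Cmp D (mult I (pre \<sigma> S) (pre \<sigma> S') A) (tA (cc I \<sigma> J S A) (cc I \<sigma> J S' A))"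
proof -
  interpret category D by (rule cat_D)
  have fin: "finite I" "finite J" "finite I2" using finite_pointed[OF s] by auto
  define \<tau> where "\<tau> = spl S S'"
  note t = pointed_spl[OF fin(2) S(1,2), folded \<tau>_def]
  note B = push_obj[OF s A]
  define B where "B = push I \<sigma> J A"
  note B' = B[folded B_def]
  have ts: "\<tau> \<circ>\<^sub>m \<sigma> = spl (pre \<sigma> S) (pre \<sigma> S')" unfolding \<tau>_def by (rule spl_comp[OF S(3)])
  note st = pointed_comp[OF s t]
  define w where "w = muf I \<sigma> J \<tau> I2 A"
  note w = muf_hom[OF s t A, folded w_def B_def]
  note mB = mult_char[OF fin(2) S B', folded \<tau>_def]
  note mA = mult_char[OF fin(1) pointed_pre[OF s] pointed_pre[OF s] pre_simps(3)[OF S(3)] A, folded ts]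
  have N: "Nh I2 {1} w \<in> hom D (Nn I2 {1} (push J \<tau> I2 B)) (Nn I2 {1} (push I (\<tau> \<circ>\<^sub>m \<sigma>) I2 A))"
    "Nh I2 {2} w \<in> hom D (Nn I2 {2} (push J \<tau> I2 B)) (Nn I2 {2} (push I (\<tau> \<circ>\<^sub>m \<sigma>) I2 A))"
    "Nh I2 I2 w \<in> hom D (Nn I2 I2 (push J \<tau> I2 B)) (Nn I2 I2 (push I (\<tau> \<circ>\<^sub>m \<sigma>) I2 A))"
    using Nh_hom[OF fin(3) _ w] by auto
  have c: "cc I \<sigma> J S A \<in> hom D (Nn J S B) (Nn I (pre \<sigma> S) A)"
    "cc I \<sigma> J S' A \<in> hom D (Nn J S' B) (Nn I (pre \<sigma> S') A)"
    "cc I \<sigma> J (S \<union> S') A \<in> hom D (Nn J (S \<union> S') B) (Nn I (pre \<sigma> S \<union> pre \<sigma> S') A)"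
    using cc_hom[OF s S(1) A] cc_hom[OF s S(2) A] cc_hom[OF s Un_least[OF S(1,2)] A]
    unfolding B_def pre_simps(1) by simp_all
  have n: "Cmp D (cc I (\<tau> \<circ>\<^sub>m \<sigma>) I2 {1} A) (Nh I2 {1} w) = Cmp D (cc I \<sigma> J S A) (cc J \<tau> I2 {1} B)"
    "Cmp D (cc I (\<tau> \<circ>\<^sub>m \<sigma>) I2 {2} A) (Nh I2 {2} w) = Cmp D (cc I \<sigma> J S' A) (cc J \<tau> I2 {2} B)"
    "Cmp D (cc I (\<tau> \<circ>\<^sub>m \<sigma>) I2 I2 A) (Nh I2 I2 w) = Cmp D (cc I \<sigma> J (S \<union> S') A) (cc J \<tau> I2 I2 B)"
    using cc_assoc[OF s t _ A, of "{1}"] cc_assoc[OF s t _ A, of "{2}"] cc_assoc[OF s t _ A, of I2]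
    unfolding w_def B_def \<tau>_def pre_spl[OF S(3)] by simp_all
  note thB = th_hom[OF push_obj[OF t B']] and thA = th_hom[OF push_obj[OF st A]]
  note kB = tA_hom[OF mB(4,5)] and kA = tA_hom[OF mA(4,5)]
  let ?k = "tA (cc J \<tau> I2 {1} B) (cc J \<tau> I2 {2} B)"
  have "Cmp D (Cmp D (cc I \<sigma> J (S \<union> S') A) (mult J S S' B)) ?k =
      Cmp D (Cmp D (cc I \<sigma> J (S \<union> S') A) (cc J \<tau> I2 I2 B)) (th (push J \<tau> I2 B))"
    using cmp_assoc[OF kB mB(1) c(3)] cmp_assoc[OF thB mB(6) c(3)] mB(3) by simp
  also have "\<dots> = Cmp D (cc I (\<tau> \<circ>\<^sub>m \<sigma>) I2 I2 A)
      (Cmp D (th (push I (\<tau> \<circ>\<^sub>m \<sigma>) I2 A)) (tA (Nh I2 {1} w) (Nh I2 {2} w)))"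
    using n(3)[symmetric] cmp_assoc[OF thB N(3) mA(6)] th_nat[OF push_obj[OF t B'] w] by simp
  also have "\<dots> = Cmp D (Cmp D (mult I (pre \<sigma> S) (pre \<sigma> S') A)
      (tA (cc I (\<tau> \<circ>\<^sub>m \<sigma>) I2 {1} A) (cc I (\<tau> \<circ>\<^sub>m \<sigma>) I2 {2} A))) (tA (Nh I2 {1} w) (Nh I2 {2} w))"
    using cmp_assoc[OF tA_hom[OF N(1,2)] thA mA(6)] mA(3) by simp
  also have "\<dots> = Cmp D (mult I (pre \<sigma> S) (pre \<sigma> S') A)
      (tA (Cmp D (cc I \<sigma> J S A) (cc J \<tau> I2 {1} B)) (Cmp D (cc I \<sigma> J S' A) (cc J \<tau> I2 {2} B)))"
    using cmp_assoc[OF tA_hom[OF N(1,2)] kA mA(1)] tA_cmp[OF N(1) mA(4) N(2) mA(5)] n by simp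
  also have "\<dots> = Cmp D (Cmp D (mult I (pre \<sigma> S) (pre \<sigma> S') A) (tA (cc I \<sigma> J S A) (cc I \<sigma> J S' A))) ?k"
    using cmp_assoc[OF kB tA_hom[OF c(1,2)] mA(1)] tA_cmp[OF mB(4) c(1) mB(5) c(2)] by simp
  finally show ?thesis
    unfolding B_def[symmetric]
    by (rule iso_epic[OF mB(7) kB cmp_hom[OF mB(1) c(3)] cmp_hom[OF tA_hom[OF c(1,2)] mA(1)]])
qed

section \<open>Families of objects, the unit, and extension of maps\<close>

definition Fam where
  "Fam = {(I, A). finite I \<and> A \<in> Obj (Prod I (K I))}"

text \<open>The unit is taken to be the product over the empty index set itself, so that the
  comparison \<open>\<upsilon>\<close> can be an identity.\<close>

definition U where
  "U = Nn {} {} (\<lambda>_. undefined)"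

lemma empty_obj: "(\<lambda>_. undefined) \<in> Obj (Prod {} (K {}))"
  by (simp add: Prod_simps)

lemma restrict_empty: "restrict f {} = (\<lambda>_. undefined)"
  by (simp add: fun_eq_iff)

lemma push_empty: "push I \<sigma> {} A = (\<lambda>_. undefined)"
  by (simp add: push_def restrict_empty)

lemma U_obj: "U \<in> Obj D"
  unfolding U_def by (rule Nn_obj[OF _ _ empty_obj]) auto

text \<open>Pushing along the empty map into the empty set forgets \<open>A\<close>, so the
  compositor starts at the fixed object \<open>U\<close>.\<close>

lemma empty_iso:
  assumes "finite I" "A \<in> Obj (Prod I (K I))"
  shows "cc I Map.empty {} {} A \<in> hom D U (Nn I {} A)" "iso_arr D (cc I Map.empty {} {} A)"
  using cc_hom[OF pointed_empty[OF assms(1), of "{}"] _ assms(2), of "{}"]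
    cc_iso[OF pointed_empty[OF assms(1), of "{}"] _ assms(2), of "{}"]
  by (simp_all add: push_empty U_def pre_simps)

text \<open>The product over the empty set has a single arrow, an identity, so every
  \<open>u\<close> acts as the identity.\<close>

lemma Nh_empty: "Nh {} {} u = Idn D U"
proof -
  have p: "pointed_map {} (col {}) {1}" by (rule pointed_col) auto
  note F = act_functor[OF p, of 1, unfolded fibre_col K1]
  have "Idn (Prod {} (K {})) (\<lambda>_. undefined) = restrict u {}" by (simp add: Prod_simps fun_eq_iff)
  then show ?thesis
    using functor_idn[OF F empty_obj] fibre_col[of "{}"]
    unfolding Nh_def U_def mprod_push pusha_def push_def by simp
qed

lemma unit_iso_eq:
  assumes "finite I" "A \<in> Obj (Prod I (K I))"
  shows "unit_iso H C (Idn D U) I = cc I Map.empty {} {} A"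
proof -
  have "tcmps (pmu H (collapse {} {}) (ids I Map.empty {})) 1 (\<lambda>_. undefined) = cc I Map.empty {} {} A"
    unfolding cc_def muf_def mu_def collapse_def by (simp add: fibre_def restrict_empty)
  then show ?thesis
    unfolding unit_iso_def using category.idn_right[OF cat_D empty_iso(1)[OF assms]] by simp
qed

text \<open>
  Extending maps between members of two families: lift the maps along the fully faithful Segal
  functors to a map \<open>u : B \<rightarrow> \<sigma>\<^sub>* A\<close>, where \<open>\<sigma>\<close> sends \<open>S j\<close> to \<open>j\<close>, and compose its images with
  the compositors.
\<close>

lemma extend_family:
  assumes A: "finite I" "A \<in> Obj (Prod I (K I))" and B: "finite J" "B \<in> Obj (Prod J (K J))"
    and S: "\<And>j. j \<in> J \<Longrightarrow> S j \<subseteq> I" "\<And>i j. i \<in> J \<Longrightarrow> j \<in> J \<Longrightarrow> i \<noteq> j \<Longrightarrow> S i \<inter> S j = {}"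
    and h: "\<And>j. j \<in> J \<Longrightarrow> h j \<in> hom D (Nn J {j} B) (Nn I (S j) A)"
  shows "\<exists>h'. (\<forall>T \<subseteq> J. h' T \<in> hom D (Nn J T B) (Nn I (\<Union>j \<in> T. S j) A)) \<and>
      (\<forall>j \<in> J. h' {j} = h j) \<and>
      (\<forall>T \<subseteq> J. \<forall>T' \<subseteq> J. T \<inter> T' = {} \<longrightarrow>
         Cmp D (h' (T \<union> T')) (mult J T T' B) =
         Cmp D (mult I (\<Union>j \<in> T. S j) (\<Union>j \<in> T'. S j) A) (tA (h' T) (h' T'))) \<and>
      Cmp D (h' {}) (cc J Map.empty {} {} B) = cc I Map.empty {} {} A"
proof -
  interpret category D by (rule cat_D)
  \<comment> \<open>Disjointness of the sets \<open>S j\<close> makes the index \<open>j\<close>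
    unique; elements of \<open>I\<close> in none of them go to the base point.\<close>
  define \<sigma> where "\<sigma> i = (if \<exists>j\<in>J. i \<in> S j then Some (THE j. j \<in> J \<and> i \<in> S j) else None)" for i
  have \<sigma>: "\<sigma> i = Some j \<longleftrightarrow> j \<in> J \<and> i \<in> S j" for i j
  proof
    assume "j \<in> J \<and> i \<in> S j"
    moreover from this have "(THE j. j \<in> J \<and> i \<in> S j) = j" using S(2) by (intro the_equality) auto
    ultimately show "\<sigma> i = Some j" by (auto simp: \<sigma>_def)
  next
    assume *: "\<sigma> i = Some j"
    then obtain k where k: "k \<in> J" "i \<in> S k" by (auto simp: \<sigma>_def split: if_splits)
    then have "(THE j. j \<in> J \<and> i \<in> S j) = k" using S(2) by (intro the_equality) auto
    then show "j \<in> J \<and> i \<in> S j" using * k by (auto simp: \<sigma>_def split: if_splits)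
  qed
  have p: "pointed_map I \<sigma> J"
    using A(1) B(1) S(1) by (auto simp: pointed_map_def dom_def ran_def \<sigma>)
  have pre: "pre \<sigma> T = (\<Union>j\<in>T. S j)" if "T \<subseteq> J" for T
    using that by (auto simp: pre_def \<sigma>)
  define E where "E = push I \<sigma> J A"
  have E: "E \<in> Obj (Prod J (K J))" unfolding E_def by (rule push_obj[OF p A(2)])
  have c: "cc I \<sigma> J T A \<in> hom D (Nn J T E) (Nn I (\<Union>j\<in>T. S j) A)" "iso_arr D (cc I \<sigma> J T A)"
    if "T \<subseteq> J" for T
    using cc_hom[OF p that A(2)] cc_iso[OF p that A(2)] pre[OF that] by (simp_all add: E_def)
  \<comment> \<open>\<open>h j\<close> ends in the product over \<open>S j\<close>. Undoing the
    compositor moves its target to the one-factor product of the pushed tuple \<open>E\<close>,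
    where fullness of \<open>sf J j\<close> provides a lift.\<close>
  have "\<forall>j\<in>J. \<exists>u \<in> hom (K J j) (B j) (E j). fa (sf J j) u = Cmp D (inv_arr D (cc I \<sigma> J {j} A)) (h j)"
  proof
    fix j assume j: "j \<in> J"
    have "{j} \<subseteq> J" using j by simp
    note cj = c[OF this]
    have cj': "cc I \<sigma> J {j} A \<in> hom D (Nn J {j} E) (Nn I (S j) A)" using cj(1) by simp
    have "Cmp D (inv_arr D (cc I \<sigma> J {j} A)) (h j) \<in> hom D (fo (sf J j) (B j)) (fo (sf J j) (E j))"
      using cmp_hom[OF h[OF j] inv_hom[OF cj(2) cj']] Nh_single(1)[OF j B(2)] Nh_single(1)[OF j E] by simp
    moreover have "B j \<in> Obj (K J j)" "E j \<in> Obj (K J j)" using B(2) E j by (auto simp: Prod_simps)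
    ultimately show "\<exists>u \<in> hom (K J j) (B j) (E j).
        fa (sf J j) u = Cmp D (inv_arr D (cc I \<sigma> J {j} A)) (h j)"
      using sf_full[OF B(1) j] by blast
  qed
  then obtain u0 where u0: "\<And>j. j \<in> J \<Longrightarrow> u0 j \<in> hom (K J j) (B j) (E j)"
    "\<And>j. j \<in> J \<Longrightarrow> fa (sf J j) (u0 j) = Cmp D (inv_arr D (cc I \<sigma> J {j} A)) (h j)"
    by metis
  define u where "u = (\<lambda>j\<in>J. u0 j)"
  have u: "u \<in> hom (Prod J (K J)) B E"
    using u0(1) B(2) E by (auto simp: hom_Prod u_def Prod_simps PiE_def)
  note Nu = Nh_hom[OF B(1) _ u]
  define h' where "h' T = Cmp D (cc I \<sigma> J T A) (Nh J T u)" for T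
  have h': "h' T \<in> hom D (Nn J T B) (Nn I (\<Union>j \<in> T. S j) A)" if "T \<subseteq> J" for T
    unfolding h'_def by (rule cmp_hom[OF Nu[OF that] c(1)[OF that]])
  moreover have "h' {j} = h j" if j: "j \<in> J" for j
  proof -
    have J: "{j} \<subseteq> J" using j by simp
    have "Nh J {j} u = Cmp D (inv_arr D (cc I \<sigma> J {j} A)) (h j)"
      using Nh_single(2)[OF j hom_arr[OF u]] u0(2)[OF j] j by (simp add: u_def)
    then show ?thesis
      unfolding h'_def using cancel_left'[OF c(2)[OF J] c(1)[OF J], of "h j"] h[OF j] by simp
  qed
  moreover have "Cmp D (h' (T \<union> T')) (mult J T T' B) =
      Cmp D (mult I (\<Union>j \<in> T. S j) (\<Union>j \<in> T'. S j) A) (tA (h' T) (h' T'))"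
    if T: "T \<subseteq> J" "T' \<subseteq> J" "T \<inter> T' = {}" for T T'
  proof -
    have TT: "T \<union> T' \<subseteq> J" using T by simp
    note mB = mult_hom[OF B(1) T B(2)] and mE = mult_hom[OF B(1) T E]
    have mI: "mult I (\<Union>j \<in> T. S j) (\<Union>j \<in> T'. S j) A \<in>
        hom D (tO (Nn I (\<Union>j \<in> T. S j) A) (Nn I (\<Union>j \<in> T'. S j) A)) (Nn I ((\<Union>j \<in> T. S j) \<union> (\<Union>j \<in> T'. S j)) A)"
      unfolding pre[OF T(1), symmetric] pre[OF T(2), symmetric]
      by (rule mult_hom[OF A(1) pointed_pre[OF p] pointed_pre[OF p] pre_simps(3)[OF T(3)] A(2)])
    note NT = Nu[OF T(1)] Nu[OF T(2)]
    \<comment> \<open>Naturality moves the multiplication from \<open>B\<close> to \<open>E\<close>,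
      and compatibility with pushing moves it from \<open>E\<close> to \<open>A\<close>.\<close>
    have "Cmp D (h' (T \<union> T')) (mult J T T' B) =
        Cmp D (cc I \<sigma> J (T \<union> T') A) (Cmp D (mult J T T' E) (tA (Nh J T u) (Nh J T' u)))"
      unfolding h'_def using cmp_assoc[OF mB Nu[OF TT] c(1)[OF TT]] mult_nat[OF B(1) T u] by simp
    also have "\<dots> = Cmp D (Cmp D (mult I (\<Union>j \<in> T. S j) (\<Union>j \<in> T'. S j) A) (tA (cc I \<sigma> J T A) (cc I \<sigma> J T' A)))
        (tA (Nh J T u) (Nh J T' u))"
      using cmp_assoc[OF tA_hom[OF NT] mE c(1)[OF TT]] mult_push[OF p T A(2)] pre[OF T(1)] pre[OF T(2)]
      by (simp add: E_def)
    also have "\<dots> = Cmp D (mult I (\<Union>j \<in> T. S j) (\<Union>j \<in> T'. S j) A) (tA (h' T) (h' T'))"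
      unfolding h'_def
      using cmp_assoc[OF tA_hom[OF NT] tA_hom[OF c(1)[OF T(1)] c(1)[OF T(2)]] mI]
        tA_cmp[OF NT(1) c(1)[OF T(1)] NT(2) c(1)[OF T(2)]] by simp
    finally show ?thesis .
  qed
  \<comment> \<open>All unit comparisons are compositors along empty maps. Naturality turns the one
    for \<open>B\<close> into the one for \<open>E\<close>; since the empty map composed with
    \<open>\<sigma>\<close> is empty, associativity turns that into the one for
    \<open>A\<close>.\<close>
  moreover have "Cmp D (h' {}) (cc J Map.empty {} {} B) = cc I Map.empty {} {} A"
  proof -
    note eB = empty_iso(1)[OF B] and eE = empty_iso(1)[OF B(1) E] and eA = empty_iso(1)[OF A]
    have pJ: "pointed_map J Map.empty {}" using pointed_empty[OF B(1), of "{}"] by simp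
    have "Cmp D (cc J Map.empty {} {} E) (Nh {} {} (pusha J Map.empty {} u)) =
        Cmp D (Nh J {} u) (cc J Map.empty {} {} B)"
      using cc_nat[OF pJ _ B(2) u, of "{}"] by (simp add: pre_simps)
    then have 1: "Cmp D (Nh J {} u) (cc J Map.empty {} {} B) = cc J Map.empty {} {} E"
      using Nh_empty idn_right[OF eE] by simp
    have "Map.empty \<circ>\<^sub>m \<sigma> = (Map.empty :: nat \<rightharpoonup> nat)"
      by (auto simp: map_comp_def fun_eq_iff split: option.splits)
    then have 2: "Cmp D (cc I \<sigma> J {} A) (cc J Map.empty {} {} E) = cc I Map.empty {} {} A"
      using cc_assoc[OF p pJ _ A(2), of "{}"] Nh_empty idn_right[OF eA] by (simp add: pre_simps E_def)
    show ?thesis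
      unfolding h'_def using cmp_assoc[OF eB Nu[OF empty_subsetI] c(1)[OF empty_subsetI]] 1 2 by simp
  qed
  ultimately show ?thesis by blast
qed

text \<open>Applying \<open>sg\<close> to each object gives the lift: its one-factor products are
  \<open>sf (sg (X j))\<close>, isomorphic to \<open>X j\<close> by \<open>sf_sg\<close>.\<close>

lemma realize_family:
  assumes J: "finite J" and X: "\<And>j. j \<in> J \<Longrightarrow> X j \<in> Obj D"
  shows "\<exists>B \<in> Obj (Prod J (K J)). \<exists>v. \<forall>j\<in>J. v j \<in> hom D (X j) (Nn J {j} B) \<and> iso_arr D (v j)"
proof (rule bexI)
  interpret category D by (rule cat_D)
  define B where "B = (\<lambda>j\<in>J. fo (sg J j) (X j))"
  show B: "B \<in> Obj (Prod J (K J))"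
    using functor_obj[OF sg_functor[OF J] X] by (simp add: B_def Prod_simps)
  have "\<exists>v. v \<in> hom D (X j) (Nn J {j} B) \<and> iso_arr D v" if j: "j \<in> J" for j
  proof -
    obtain b where b: "nat_iso D D (cmp_functor D (sf J j) (sg J j)) (id_functor D) b"
      using sf_sg[OF J j] by blast
    have "b (X j) \<in> hom D (Nn J {j} B) (X j)" "iso_arr D (b (X j))"
      using nat_isoD(1,2)[OF b X[OF j]] X[OF j] Nh_single(1)[OF j B] j by (simp_all add: B_def)
    then show ?thesis using inv_hom iso_inv by blast
  qed
  then show "\<exists>v. \<forall>j\<in>J. v j \<in> hom D (X j) (Nn J {j} B) \<and> iso_arr D (v j)" by metis
qed

text \<open>The lifting results \<open>realize_family\<close> and \<open>extend_family\<close>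
  supply the two substantial axioms of the abstract argument; \<open>e\<close> is the compositor
  along the empty map.\<close>

lemma tensor_families: "tensor_families D tO tA U Fam fst (\<lambda>x S. Nn (fst x) S (snd x))
    (\<lambda>x S S'. mult (fst x) S S' (snd x)) (\<lambda>x. cc (fst x) Map.empty {} {} (snd x))"
proof (rule tensor_families.intro[OF cat_D], unfold_locales)
  fix J :: "nat set" and V assume "finite J" "\<And>j. j \<in> J \<Longrightarrow> V j \<in> Obj D"
  from realize_family[OF this] \<open>finite J\<close>
  show "\<exists>y \<in> Fam. fst y = J \<and> (\<exists>v. \<forall>j\<in>J. v j \<in> hom D (V j) (Nn (fst y) {j} (snd y)) \<and> iso_arr D (v j))"
    by (fastforce simp: Fam_def)
next
  fix x y and Q :: "nat \<Rightarrow> nat set" and h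
  assume "x \<in> Fam" "y \<in> Fam"
  then have "finite (fst x)" "snd x \<in> Obj (Prod (fst x) (K (fst x)))"
    "finite (fst y)" "snd y \<in> Obj (Prod (fst y) (K (fst y)))"
    by (auto simp: Fam_def)
  note e = extend_family[OF this]
  assume "\<And>j. j \<in> fst y \<Longrightarrow> Q j \<subseteq> fst x"
    "\<And>i j. i \<in> fst y \<Longrightarrow> j \<in> fst y \<Longrightarrow> i \<noteq> j \<Longrightarrow> Q i \<inter> Q j = {}"
    "\<And>j. j \<in> fst y \<Longrightarrow> h j \<in> hom D (Nn (fst y) {j} (snd y)) (Nn (fst x) (Q j) (snd x))"
  from e[OF this]
  show "\<exists>h'. (\<forall>T \<subseteq> fst y. h' T \<in> hom D (Nn (fst y) T (snd y)) (Nn (fst x) (\<Union>j \<in> T. Q j) (snd x))) \<and>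
      (\<forall>j \<in> fst y. h' {j} = h j) \<and>
      (\<forall>T \<subseteq> fst y. \<forall>T' \<subseteq> fst y. T \<inter> T' = {} \<longrightarrow>
         Cmp D (h' (T \<union> T')) (mult (fst y) T T' (snd y)) =
         Cmp D (mult (fst x) (\<Union>j \<in> T. Q j) (\<Union>j \<in> T'. Q j) (snd x)) (tA (h' T) (h' T'))) \<and>
      Cmp D (h' {}) (cc (fst y) Map.empty {} {} (snd y)) = cc (fst x) Map.empty {} {} (snd x)" .
qed (auto simp: Fam_def tO_obj tA_hom tA_idn tA_cmp U_obj Nn_obj mult_hom mult_is_iso empty_iso)

text \<open>The witnesses are the abstract monoidal structure, the 2-cell \<open>Th\<close> and the
  identity of \<open>U\<close>. With these, \<open>mult_iso\<close> and \<open>unit_iso\<close>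
  become the maps \<open>m\<close> and \<open>e\<close> of the locale, so the constraint equations
  are \<open>m_assoc\<close>, \<open>m_braid\<close> and \<open>m_unit\<close>.\<close>

lemma symmetric_monoidal_structure:
  "\<exists>M \<Theta> \<upsilon>. symmetric_monoidal D M \<and>
     tensor_arr C M \<in> Ar1 TwoVectGrTensor \<and> degree_zero (tensor_arr C M) \<and>
     \<Theta> \<in> hom2 TwoVectGrTensor
           (cmp1 TwoVectGrTensor (tensor_arr C M) (segal H C)) (par H fold_map) \<and>
     invertible2 TwoVectGrTensor \<Theta> \<and>
     \<upsilon> \<in> hom D (unit_ob M) (mprod H {} {} (\<lambda>_. undefined)) \<and>
     iso_arr D \<upsilon> \<and> constraints_from H C M \<Theta> \<upsilon>"
proof -
  interpret F: tensor_families D tO tA U Fam fst "\<lambda>x S. Nn (fst x) S (snd x)"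
    "\<lambda>x S S'. mult (fst x) S S' (snd x)" "\<lambda>x. cc (fst x) Map.empty {} {} (snd x)"
    by (rule tensor_families)
  let ?M = "F.monoidal"
  note M = F.monoidal_simps(1,2)
  have "constraints_from H C ?M (Th ?M) (Idn D U)"
    unfolding constraints_from_def Let_def K_def[symmetric]
  proof (intro allI impI conjI; elim conjE)
    fix I A assume "finite I" "A \<in> Obj (Prod I (K I))"
    then have x: "(I, A) \<in> Fam" and IA: "finite I" "A \<in> Obj (Prod I (K I))" by (auto simp: Fam_def)
    note mm = mult_iso_mult[OF IA(1) _ _ _ IA(2) M] and ee = unit_iso_eq[OF IA]
    {
      fix S S' S''
      assume s: "S \<subseteq> I" "S' \<subseteq> I" "S'' \<subseteq> I" "S \<inter> S' = {}" "S \<inter> S'' = {}" "S' \<inter> S'' = {}"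
      then have s': "S \<union> S' \<subseteq> I" "S' \<union> S'' \<subseteq> I" "(S \<union> S') \<inter> S'' = {}" "S \<inter> (S' \<union> S'') = {}" by auto
      show "Cmp D (mult_iso H C ?M (Th ?M) I (S \<union> S') S'' A)
          (tenA ?M (mult_iso H C ?M (Th ?M) I S S' A) (Idn D (Nn I S'' A))) =
        Cmp D (mult_iso H C ?M (Th ?M) I S (S' \<union> S'') A)
          (Cmp D (tenA ?M (Idn D (Nn I S A)) (mult_iso H C ?M (Th ?M) I S' S'' A))
            (assoc ?M (Nn I S A) (Nn I S' A) (Nn I S'' A)))"
        unfolding mm[OF s'(1) s(3) s'(3)] mm[OF s(1) s'(2) s'(4)] mm[OF s(1,2,4)] mm[OF s(2,3,6)]
        using F.m_assoc[OF x, of S S' S''] s by simp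
    }
    {
      fix S S' assume s: "S \<subseteq> I" "S' \<subseteq> I" "S \<inter> S' = {}"
      then have s': "S' \<inter> S = {}" by auto
      show "Cmp D (mult_iso H C ?M (Th ?M) I S' S A) (braid ?M (Nn I S A) (Nn I S' A)) =
          mult_iso H C ?M (Th ?M) I S S' A"
        unfolding mm[OF s] mm[OF s(2,1) s'] using F.m_braid[OF x, of S S'] s by simp
    }
    {
      fix S assume s: "S \<subseteq> I"
      show "Cmp D (mult_iso H C ?M (Th ?M) I {} S A) (tenA ?M (unit_iso H C (Idn D U) I) (Idn D (Nn I S A))) =
          lunit ?M (Nn I S A)"
        "Cmp D (mult_iso H C ?M (Th ?M) I S {} A) (tenA ?M (Idn D (Nn I S A)) (unit_iso H C (Idn D U) I)) =
          runit ?M (Nn I S A)"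
        using F.m_unit[OF x, of S] s mm[of "{}" S] mm[of S "{}"] ee by simp_all
    }
  qed
  moreover have "Idn D U \<in> hom D (unit_ob ?M) (mprod H {} {} (\<lambda>_. undefined))" "iso_arr D (Idn D U)"
    using category.idn_hom[OF cat_D U_obj] category.iso_idn[OF cat_D U_obj] by (simp_all add: U_def[symmetric])
  ultimately show ?thesis
    using F.symmetric_monoidal tensor_arr[OF M] Th[OF M]
    unfolding TwoVectGrTensor_def GrVect_simps by blast
qed

end

theorem proposition3p18:
  fixes H :: "('o, 'a, 'k :: field_char_0) ssh_data"
    and C :: "('o, 'a, 'k) grcat"
  assumes "ssh_structure H C"
  shows "equivalence1 TwoVectGrTensor (segal H C) \<and>
    (\<exists>M \<Theta> \<upsilon>.
       symmetric_monoidal (tot C) M \<and>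
       tensor_arr C M \<in> Ar1 TwoVectGrTensor \<and> degree_zero (tensor_arr C M) \<and>
       \<Theta> \<in> hom2 TwoVectGrTensor
             (cmp1 TwoVectGrTensor (tensor_arr C M) (segal H C)) (par H fold_map) \<and>
       invertible2 TwoVectGrTensor \<Theta> \<and>
       \<upsilon> \<in> hom (tot C) (unit_ob M) (mprod H {} {} (\<lambda>_. undefined)) \<and>
       iso_arr (tot C) \<upsilon> \<and>
       constraints_from H C M \<Theta> \<upsilon>)"
proof -
  interpret ssh H C by (rule ssh.intro) (rule assms)
  show ?thesis using segal_equivalence symmetric_monoidal_structure by blast
qed

end
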